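(* There is an algorithm that, given an instance of BMST, outputs a feasible leader's choice $X$ whose objective value $c(X\cup Y)$ ($Y$ the follower's response) is at most $2$ times the optimum value, in time $f(|E^f|)\cdot p(\text{input size})$ for a computable function $f$ and polynomial $p$; i.e., 2-approximating BMST is fixed-parameter tractable in the number of edges controlled by the follower.
   Context: An instance of BMST consists of a finite connected undirected graph $G=(V,E)$, possibly with parallel edges, whose edge set is partitioned into disjoint sets $E^\ell$ (leader's edges) and $E^f$ (follower's edges), cost functions $c,d\colon E\to\mathbb{R}_{\ge 0}$, and a fixed linear order $e_1,\dots,e_m$ of $E^f$ nondecreasing in $d$. For $Z\subseteq E$, $c(Z)=\sum_{e\in Z}c(e)$. A leader's choice is a cycle-free $X\subseteq E^\ell$, feasible if $(V,X\cup E^f)$ is connected. The follower's response $Y$ to $X$: start with $Y=\emptyset$, for $i=1,\dots,m$ add $e_i$ if $X\cup Y\cup\{e_i\}$ is cycle-free (for feasible $X$, $X\cup Y$ is a spanning tree minimizing $d(Y)$). The leader seeks a feasible $X$ minimizing $c(X\cup Y)$; this minimum is the optimum value. *)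

theory Defs
  imports Complex_Main "HOL-Computational_Algebra.Polynomial" "HOL-Library.Log_Nat"
begin

section \<open>Undirected multigraphs\<close>

text \<open>Edges are names; \<open>en e\<close> is the set of end vertices of \<open>e\<close>, so that distinct edges may
  be parallel. A walk is a vertex list together with the list of the edges traversed.\<close>

definition walk :: "('e \<Rightarrow> 'v set) \<Rightarrow> 'e set \<Rightarrow> 'v list \<Rightarrow> 'e list \<Rightarrow> bool" where
  "walk en F vs es \<longleftrightarrow>
     length vs = Suc (length es) \<and> set es \<subseteq> F \<and>
     (\<forall>i<length es. en (es ! i) = {vs ! i, vs ! Suc i})"

definition connected_graph :: "('e \<Rightarrow> 'v set) \<Rightarrow> 'v set \<Rightarrow> 'e set \<Rightarrow> bool" where
  "connected_graph en V F \<longleftrightarrow>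
     V \<noteq> {} \<and> (\<forall>u\<in>V. \<forall>v\<in>V. \<exists>vs es. walk en F vs es \<and> hd vs = u \<and> last vs = v)"

text \<open>Because only the edges are required to be distinct, two parallel edges form a cycle.\<close>

definition is_cycle :: "('e \<Rightarrow> 'v set) \<Rightarrow> 'e set \<Rightarrow> 'v list \<Rightarrow> 'e list \<Rightarrow> bool" where
  "is_cycle en F vs es \<longleftrightarrow>
     walk en F vs es \<and> es \<noteq> [] \<and> hd vs = last vs \<and> distinct (tl vs) \<and> distinct es"

definition cycle_free :: "('e \<Rightarrow> 'v set) \<Rightarrow> 'e set \<Rightarrow> bool" where
  "cycle_free en F \<longleftrightarrow> (\<nexists>vs es. is_cycle en F vs es)"


section \<open>The bilevel minimum spanning tree problem\<close>

text \<open>The follower's edges are given as a list, which is their fixed linear order. Vertices and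
  edges are named by natural numbers so that instances can be handed to a program.\<close>

record bmst =
  verts :: "nat set"
  leader :: "nat set"
  follower :: "nat list"
  ends :: "nat \<Rightarrow> nat set"
  ccost :: "nat \<Rightarrow> real"
  dcost :: "nat \<Rightarrow> real"

definition edges :: "bmst \<Rightarrow> nat set" where
  "edges I = leader I \<union> set (follower I)"

definition bmst_instance :: "bmst \<Rightarrow> bool" where
  "bmst_instance I \<longleftrightarrow>
     finite (verts I) \<and> finite (leader I) \<and>
     distinct (follower I) \<and> leader I \<inter> set (follower I) = {} \<and>
     (\<forall>e\<in>edges I. ends I e \<subseteq> verts I \<and> card (ends I e) = 2) \<and>
     connected_graph (ends I) (verts I) (edges I) \<and>
     (\<forall>e\<in>edges I. 0 \<le> ccost I e \<and> 0 \<le> dcost I e) \<and>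
     sorted (map (dcost I) (follower I))"

definition leader_choice :: "bmst \<Rightarrow> nat set \<Rightarrow> bool" where
  "leader_choice I X \<longleftrightarrow> X \<subseteq> leader I \<and> cycle_free (ends I) X"

definition feasible :: "bmst \<Rightarrow> nat set \<Rightarrow> bool" where
  "feasible I X \<longleftrightarrow>
     leader_choice I X \<and> connected_graph (ends I) (verts I) (X \<union> set (follower I))"

definition response :: "bmst \<Rightarrow> nat set \<Rightarrow> nat set" where
  "response I X =
     foldl (\<lambda>Y e. if cycle_free (ends I) (X \<union> Y \<union> {e}) then Y \<union> {e} else Y) {} (follower I)"

definition objective :: "bmst \<Rightarrow> nat set \<Rightarrow> real" where
  "objective I X = sum (ccost I) (X \<union> response I X)"

definition opt_value :: "bmst \<Rightarrow> real" where
  "opt_value I = Min (objective I ` {X. feasible I X})"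


section \<open>Model of computation\<close>

text \<open>A first-order functional language with call-by-value recursion. Values are binary trees
  (heap cells) whose leaves are numbers. The only arithmetic is addition, subtraction and
  comparison, and the only numeric constants are natural numbers: arbitrary real constants would
  allow programs to compute functions that are not Turing-computable.\<close>

datatype val = Num real | Pair val val

datatype exp =
    Var nat                 \<comment> \<open>position in the environment\<close>
  | Lit nat
  | Add exp exp
  | Sub exp exp
  | Less exp exp            \<comment> \<open>truth values are the numbers 0 and 1\<close>
  | MkPair exp exp
  | Head exp
  | Tail exp
  | IsPair exp
  | Cond exp exp exp
  | Bind exp exp            \<comment> \<open>binds position 0 in the second expression\<close>
  | Call nat "exp list"

text \<open>A program is the list of its function bodies; \<open>Call i\<close> evaluates the \<open>i\<close>-th
  body in the environment made of the actual arguments.\<close>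

type_synonym prog = "exp list"

text \<open>\<open>ev w P \<rho> a v t\<close>: under program \<open>P\<close> and environment \<open>\<rho>\<close>, the expression \<open>a\<close>
  evaluates to \<open>v\<close> in time \<open>t\<close>. Every evaluation step costs one unit; an arithmetic step
  is charged in addition the lengths \<open>w\<close> of its operands. A variable is a reference to a
  (shared) heap value, so looking it up does not copy. There is no rule for ill-typed
  operations: they have no result.\<close>

inductive ev :: "(real \<Rightarrow> nat) \<Rightarrow> prog \<Rightarrow> val list \<Rightarrow> exp \<Rightarrow> val \<Rightarrow> nat \<Rightarrow> bool"
  and evs :: "(real \<Rightarrow> nat) \<Rightarrow> prog \<Rightarrow> val list \<Rightarrow> exp list \<Rightarrow> val list \<Rightarrow> nat \<Rightarrow> bool"
  for w :: "real \<Rightarrow> nat" and P :: prog where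
  ev_Var: "i < length \<rho> \<Longrightarrow> ev w P \<rho> (Var i) (\<rho> ! i) 1"
| ev_Lit: "ev w P \<rho> (Lit n) (Num (real n)) 1"
| ev_Add: "ev w P \<rho> a (Num x) s \<Longrightarrow> ev w P \<rho> b (Num y) t \<Longrightarrow>
    ev w P \<rho> (Add a b) (Num (x + y)) (1 + s + t + w x + w y)"
| ev_Sub: "ev w P \<rho> a (Num x) s \<Longrightarrow> ev w P \<rho> b (Num y) t \<Longrightarrow>
    ev w P \<rho> (Sub a b) (Num (x - y)) (1 + s + t + w x + w y)"
| ev_Less: "ev w P \<rho> a (Num x) s \<Longrightarrow> ev w P \<rho> b (Num y) t \<Longrightarrow>
    ev w P \<rho> (Less a b) (Num (if x < y then 1 else 0)) (1 + s + t + w x + w y)"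
| ev_MkPair: "ev w P \<rho> a u s \<Longrightarrow> ev w P \<rho> b v t \<Longrightarrow> ev w P \<rho> (MkPair a b) (Pair u v) (1 + s + t)"
| ev_Head: "ev w P \<rho> a (Pair u v) s \<Longrightarrow> ev w P \<rho> (Head a) u (1 + s)"
| ev_Tail: "ev w P \<rho> a (Pair u v) s \<Longrightarrow> ev w P \<rho> (Tail a) v (1 + s)"
| ev_IsPair: "ev w P \<rho> a u s \<Longrightarrow>
    ev w P \<rho> (IsPair a) (Num (if \<exists>x y. u = Pair x y then 1 else 0)) (1 + s)"
| ev_Cond_true: "ev w P \<rho> a u s \<Longrightarrow> u \<noteq> Num 0 \<Longrightarrow> ev w P \<rho> b v t \<Longrightarrow>
    ev w P \<rho> (Cond a b c) v (1 + s + t)"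
| ev_Cond_false: "ev w P \<rho> a (Num 0) s \<Longrightarrow> ev w P \<rho> c v t \<Longrightarrow> ev w P \<rho> (Cond a b c) v (1 + s + t)"
| ev_Bind: "ev w P \<rho> a u s \<Longrightarrow> ev w P (u # \<rho>) b v t \<Longrightarrow> ev w P \<rho> (Bind a b) v (1 + s + t)"
| ev_Call: "i < length P \<Longrightarrow> evs w P \<rho> as us s \<Longrightarrow> ev w P us (P ! i) v t \<Longrightarrow>
    ev w P \<rho> (Call i as) v (1 + s + t)"
| evs_Nil: "evs w P \<rho> [] [] 0"
| evs_Cons: "ev w P \<rho> a u s \<Longrightarrow> evs w P \<rho> as us t \<Longrightarrow> evs w P \<rho> (a # as) (u # us) (s + t)"

inductive_cases ev_elims:
  "ev w P \<rho> (Var i) v t" "ev w P \<rho> (Lit n) v t" "ev w P \<rho> (Add a b) v t"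
  "ev w P \<rho> (Sub a b) v t" "ev w P \<rho> (Less a b) v t" "ev w P \<rho> (MkPair a b) v t"
  "ev w P \<rho> (Head a) v t" "ev w P \<rho> (Tail a) v t" "ev w P \<rho> (IsPair a) v t"
  "ev w P \<rho> (Cond a b c) v t" "ev w P \<rho> (Bind a b) v t" "ev w P \<rho> (Call i as) v t"
  "evs w P \<rho> [] us t" "evs w P \<rho> (a # as) us t"

lemma ev_deterministic:
  shows "ev w P \<rho> a v t \<Longrightarrow> ev w P \<rho> a v' t' \<Longrightarrow> v' = v \<and> t' = t"
    and "evs w P \<rho> as us t \<Longrightarrow> evs w P \<rho> as us' t' \<Longrightarrow> us' = us \<and> t' = t"
proof (induction arbitrary: v' t' and us' t' rule: ev_evs.inducts)
  case ev_Var
  from ev_Var.prems show ?case by (rule ev_elims) auto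
next
  case ev_Lit
  from ev_Lit.prems show ?case by (rule ev_elims) auto
next
  case ev_Add
  from ev_Add.prems show ?case by (rule ev_elims) (auto dest!: ev_Add.IH(2,4))
next
  case ev_Sub
  from ev_Sub.prems show ?case by (rule ev_elims) (auto dest!: ev_Sub.IH(2,4))
next
  case ev_Less
  from ev_Less.prems show ?case by (rule ev_elims) (auto dest!: ev_Less.IH(2,4))
next
  case ev_MkPair
  from ev_MkPair.prems show ?case by (rule ev_elims) (auto dest!: ev_MkPair.IH(2,4))
next
  case ev_Head
  from ev_Head.prems show ?case by (rule ev_elims) (auto dest!: ev_Head.IH(2))
next
  case ev_Tail
  from ev_Tail.prems show ?case by (rule ev_elims) (auto dest!: ev_Tail.IH(2))
next
  case ev_IsPair
  from ev_IsPair.prems show ?case by (rule ev_elims) (auto dest!: ev_IsPair.IH(2))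
next
  case ev_Cond_true
  from ev_Cond_true.prems show ?case by (rule ev_elims) (auto simp: ev_Cond_true.hyps dest!: ev_Cond_true.IH(2,4))
next
  case ev_Cond_false
  from ev_Cond_false.prems show ?case by (rule ev_elims) (auto dest!: ev_Cond_false.IH(2,4))
next
  case ev_Bind
  from ev_Bind.prems show ?case by (rule ev_elims) (auto dest!: ev_Bind.IH(2,4))
next
  case ev_Call
  from ev_Call.prems show ?case by (rule ev_elims) (auto dest!: ev_Call.IH(3,5))
next
  case evs_Nil
  from evs_Nil.prems show ?case by (rule ev_elims) auto
next
  case evs_Cons
  from evs_Cons.prems show ?case by (rule ev_elims) (auto dest!: evs_Cons.IH(2,4))
qed

text \<open>Running a program means applying its first function to the input.\<close>

definition runs :: "(real \<Rightarrow> nat) \<Rightarrow> prog \<Rightarrow> val \<Rightarrow> val \<Rightarrow> nat \<Rightarrow> bool" where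
  "runs w P inp out t \<longleftrightarrow> P \<noteq> [] \<and> ev w P [inp] (P ! 0) out t"

text \<open>Two notions of the length of a number: every number counts one (unit-cost arithmetic on
  reals), or a rational number counts the bits of its reduced fraction (logarithmic cost).
  The latter is meaningful only for rational arguments.\<close>

definition unit_length :: "real \<Rightarrow> nat" where
  "unit_length x = 1"

definition bit_length :: "real \<Rightarrow> nat" where
  "bit_length x =
     (let (a, b) = quotient_of (the_inv of_rat x) in 1 + nat (bitlen \<bar>a\<bar>) + nat (bitlen b))"

primrec val_size :: "(real \<Rightarrow> nat) \<Rightarrow> val \<Rightarrow> nat" where
  "val_size w (Num x) = w x"
| "val_size w (Pair u v) = 1 + val_size w u + val_size w v"

text \<open>On natural number inputs all numbers arising are integers, so this is ordinary
  computability; the cost measure plays no role.\<close>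

definition computable :: "(nat \<Rightarrow> nat) \<Rightarrow> bool" where
  "computable f \<longleftrightarrow>
     (\<exists>P. \<forall>n. \<exists>t. runs unit_length P (Num (real n)) (Num (real (f n))) t)"


section \<open>Encoding of instances and solutions\<close>

abbreviation enc_nat :: "nat \<Rightarrow> val" where
  "enc_nat n \<equiv> Num (real n)"

primrec enc_list :: "val list \<Rightarrow> val" where
  "enc_list [] = Num 0"
| "enc_list (v # vs) = Pair v (enc_list vs)"

definition enc_edge :: "bmst \<Rightarrow> nat \<Rightarrow> val" where
  "enc_edge I e =
     enc_list [enc_nat e, enc_nat (Min (ends I e)), enc_nat (Max (ends I e)),
       Num (ccost I e), Num (dcost I e)]"

definition enc_instance :: "bmst \<Rightarrow> val" where
  "enc_instance I =
     enc_list [enc_list (map enc_nat (sorted_list_of_set (verts I))),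
       enc_list (map (enc_edge I) (sorted_list_of_set (leader I))),
       enc_list (map (enc_edge I) (follower I))]"

definition enc_edge_names :: "nat list \<Rightarrow> val" where
  "enc_edge_names xs = enc_list (map enc_nat xs)"

definition rational_costs :: "bmst \<Rightarrow> bool" where
  "rational_costs I \<longleftrightarrow> (\<forall>e\<in>edges I. ccost I e \<in> \<rat> \<and> dcost I e \<in> \<rat>)"

text \<open>The pairs of a length measure and an instance for which running times are measured:
  arbitrary real costs with unit-cost arithmetic, and rational costs given in binary with
  logarithmic-cost arithmetic.\<close>

definition admissible :: "(real \<Rightarrow> nat) \<Rightarrow> bmst \<Rightarrow> bool" where
  "admissible w I \<longleftrightarrow> w = unit_length \<or> w = bit_length \<and> rational_costs I"

end

theory Submission imports Defs begin

text \<open>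
  Let \<open>X\<close> be an optimal leader's choice and let \<open>T\<close> be the set of the at most \<open>2k\<close> end vertices of
  the follower's edges. The follower rejects an edge iff its end vertices are connected by the
  leader's edges together with the earlier follower's edges, so the response depends only on how the
  leader connects \<open>T\<close>, and it shrinks when the leader connects more. Enumerating the partitions of
  \<open>T\<close> and joining each block by a cheapest Steiner tree, one meets an edge set \<open>Z\<close> that connects
  \<open>T\<close> at least as well as \<open>X\<close> and costs at most \<open>c(X)\<close>. A cheapest set \<open>M\<close> of leader's edges that
  connects the graph together with \<open>E\<^sup>f\<close>, found by Kruskal's algorithm, costs at most \<open>c(X)\<close> as well.
  A spanning forest of \<open>Z \<union> M\<close> is then feasible of cost at most \<open>2 c(X)\<close>, and the response to it is
  contained in the response to \<open>X\<close>.

  Steiner trees are computed by the recursion of Dreyfus and Wagner, one table over the vertices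
  per terminal set; tables are recomputed instead of stored, which only affects the factor that
  depends on \<open>k\<close>. The recursions over \<open>n\<close> terminals are charged \<open>2 ^ 2 ^ (n + 3)\<close> or its square,
  since squaring, the effect of one more terminal, outweighs the \<open>2 ^ n\<close> ways to split a set.
  Costs are always recomputed from duplicate-free edge lists, so that every number that occurs has
  length linear in the input, also for rational costs in binary.
\<close>

section \<open>Connectivity\<close>

text \<open>The search cannot know the optimal choice \<open>H\<close>, so its invariant
  \<open>good\<close> is stated for every \<open>H\<close> at once: on some branch of the
  enumeration the blocks are those that \<open>H\<close> induces on the terminals, and there the
  block of a terminal \<open>t\<close> is paid for by the component of \<open>t\<close> in
  \<open>H\<close>. Components are disjoint, hence all Steiner trees together cost at most
  \<open>c(H)\<close>. Nothing is ever handled as a tree: competitors are arbitrary edge sets, table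
  entries need only connect enough and cost little, and cycles are removed when a choice is
  completed. Walks and cycles occur only up to \<open>conn_iff_walk\<close> and
  \<open>cycle_free_insert\<close>; afterwards everything is phrased through \<open>conn\<close>.
  For the running time, \<open>B\<close> exceeds the numbers of vertices and edges and
  \<open>1000 * (W + 1)\<close>, where \<open>W\<close> bounds the length of numbers. One factor
  \<open>B\<close> pays for a loop or a constant number of steps, so nesting depth becomes an
  exponent, and only the recursions over terminals are charged to \<open>fpt\<close>. The parameter
  is \<open>2k + 1\<close> because a search over \<open>n\<close> terminals contains Steiner calls
  charged \<open>fpt n\<close>, and so is charged \<open>fpt (n + 1)\<close>.\<close>

definition conn :: "('e \<Rightarrow> 'v set) \<Rightarrow> 'e set \<Rightarrow> 'v \<Rightarrow> 'v \<Rightarrow> bool" where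
  "conn en F = (\<lambda>u v. \<exists>e\<in>F. en e = {u, v})\<^sup>*\<^sup>*"

lemma conn_refl [simp]: "conn en F u u"
  by (simp add: conn_def)

lemma conn_trans: "conn en F u v \<Longrightarrow> conn en F v x \<Longrightarrow> conn en F u x"
  by (simp add: conn_def)

lemma conn_edge: "e \<in> F \<Longrightarrow> en e = {u, v} \<Longrightarrow> conn en F u v"
  unfolding conn_def by (rule r_into_rtranclp) blast

lemma conn_sym: "conn en F u v \<Longrightarrow> conn en F v u"
proof -
  have "symp (\<lambda>u v. \<exists>e\<in>F. en e = {u, v})"
    by (rule sympI) (metis insert_commute)
  then show "conn en F u v \<Longrightarrow> conn en F v u"
    unfolding conn_def by (meson symp_rtranclp sympD)
qed

lemma conn_induct [consumes 1, case_names refl step]: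
  assumes "conn en F u v" and "P u"
    and "\<And>x y e. conn en F u x \<Longrightarrow> e \<in> F \<Longrightarrow> en e = {x, y} \<Longrightarrow> P x \<Longrightarrow> P y"
  shows "P v"
  using assms(1) unfolding conn_def
proof (induction rule: rtranclp_induct)
  case base
  show ?case by (rule assms(2))
next
  case (step y z)
  then show ?case using assms(3) unfolding conn_def by blast
qed

lemma conn_first_edge: "conn en F u v \<Longrightarrow> u \<noteq> v \<Longrightarrow> \<exists>e\<in>F. \<exists>x. en e = {u, x}"
  unfolding conn_def by (erule converse_rtranclpE) auto

text \<open>This is how two edge sets are compared below: edge by edge instead of path by
  path.\<close>

lemma conn_span:
  assumes "\<And>e x y. e \<in> G \<Longrightarrow> en e = {x, y} \<Longrightarrow> conn en F x y" and "conn en G u v"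
  shows "conn en F u v"
  using assms(2)
proof (induction rule: conn_induct)
  case refl
  show ?case by simp
next
  case (step x y e)
  then show ?case using assms(1) conn_trans by metis
qed

lemma conn_mono: "F \<subseteq> G \<Longrightarrow> conn en F u v \<Longrightarrow> conn en G u v"
  by (rule conn_span[of F]) (auto intro: conn_edge)

text \<open>A connection needs \<open>e\<close> at most once: it avoids \<open>e\<close> or crosses
  it in one of two directions. The formula is also what relabelling one class of a partition
  computes.\<close>

lemma conn_insert:
  assumes e: "en e = {a, b}"
  shows "conn en (insert e F) u v \<longleftrightarrow>
    conn en F u v \<or> conn en F u a \<and> conn en F b v \<or> conn en F u b \<and> conn en F a v"
    (is "?L \<longleftrightarrow> ?R v")
proof
  assume ?L
  then show "?R v"
  proof (induction rule: conn_induct)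
    case refl
    show ?case by simp
  next
    case (step x y f)
    show ?case
    proof (cases "f = e")
      case True
      then have "x = a \<and> y = b \<or> x = b \<and> y = a"
        using step e by (metis doubleton_eq_iff)
      then show ?thesis using step.IH by auto
    next
      case False
      then have "conn en F x y" using step conn_edge by (metis insertE)
      then show ?thesis using step.IH conn_trans by metis
    qed
  qed
next
  have ab: "conn en (insert e F) a b" using e by (auto intro: conn_edge)
  have m: "conn en F x y \<Longrightarrow> conn en (insert e F) x y" for x y
    by (rule conn_mono[of F]) auto
  assume "?R v"
  then show ?L using ab m conn_trans conn_sym by metis
qed

lemma conn_insert_absorb:
  assumes "en e = {a, b}" and "conn en F a b"
  shows "conn en (insert e F) u v \<longleftrightarrow> conn en F u v"
  using conn_insert[of en e a b F u v] assms conn_trans[of en F] conn_sym[of en F] by blast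

text \<open>The exchange property of the graphic matroid: every connection of \<open>a\<close> and
  \<open>b\<close> crosses \<open>f\<close>, so closing it with \<open>e\<close> gives a detour
  around \<open>f\<close>.\<close>

lemma conn_exchange:
  assumes e: "en e = {a, b}" and f: "en f = {x, y}"
    and "conn en (insert f R) a b" and "\<not> conn en R a b"
  shows "conn en (insert e R) x y"
  using assms(3,4) conn_insert[of en f x y R a b, OF f] conn_insert[of en e a b R x y, OF e]
    conn_sym[of en R] by blast

text \<open>Applied to the empty edge set, over which connectivity is equality.\<close>

lemma conn_singleton_class:
  assumes "\<And>e. e \<in> F \<Longrightarrow> u \<notin> en e" and "conn en F u v"
  shows "v = u"
  using assms(2) by (induction rule: conn_induct) (use assms(1) in auto)

text \<open>A set of edges rather than vertices: \<open>F\<close> falls into this part and its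
  complement, so that costs add up while every path keeps to one of the two parts.\<close>

definition component :: "('e \<Rightarrow> 'v set) \<Rightarrow> 'e set \<Rightarrow> 'v \<Rightarrow> 'e set" where
  "component en F u = {e \<in> F. \<exists>x\<in>en e. conn en F u x}"

lemma component_subset: "component en F u \<subseteq> F"
  by (auto simp: component_def)

lemma conn_component: "conn en F u v \<Longrightarrow> conn en (component en F u) u v"
proof (induction rule: conn_induct)
  case refl
  show ?case by simp
next
  case (step x y e)
  then have "e \<in> component en F u" by (auto simp: component_def)
  then show ?case using step conn_edge conn_trans by metis
qed

text \<open>A path from \<open>v\<close> never meets the component of \<open>u\<close>, for
  otherwise \<open>u\<close> and \<open>v\<close> would be connected.\<close>

lemma conn_minus_component:
  assumes "conn en F v x" and nu: "\<not> conn en F u v"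
  shows "conn en (F - component en F u) v x"
  using assms(1)
proof (induction rule: conn_induct)
  case refl
  show ?case by simp
next
  case (step x y e)
  have "conn en F x y" using step conn_edge by metis
  then have "\<not> conn en F u x \<and> \<not> conn en F u y"
    using step(1) nu conn_trans conn_sym by metis
  then have "e \<in> F - component en F u"
    using step by (auto simp: component_def)
  then show ?case using step conn_edge conn_trans by metis
qed

text \<open>Edge sets that agree on the terminals \<open>T\<close> are interchangeable when only edges between
  terminals are added: a path is cut at its visits to \<open>T\<close>.\<close>

lemma conn_terminals:
  assumes T: "\<And>s t. s \<in> T \<Longrightarrow> t \<in> T \<Longrightarrow> conn en H s t \<Longrightarrow> conn en Z s t"
    and F: "\<And>e. e \<in> F \<Longrightarrow> en e \<subseteq> T"
    and s: "s \<in> T" and t: "t \<in> T" and c: "conn en (H \<union> F) s t"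
  shows "conn en (Z \<union> F) s t"
proof -
  \<comment> \<open>The path is already rerouted up to the terminal \<open>y\<close>; behind
    \<open>y\<close> only edges of \<open>H\<close> have been used. An edge outside \<open>H\<close>
    has both ends in \<open>T\<close>, so \<open>y\<close> can be moved past it.\<close>
  have "\<exists>y\<in>T. conn en (Z \<union> F) s y \<and> conn en H y t"
    using c
  proof (induction rule: conn_induct)
    case refl
    show ?case using s by (intro bexI[of _ s]) auto
  next
    case (step x x' e)
    then obtain y where y: "y \<in> T" "conn en (Z \<union> F) s y" "conn en H y x" by blast
    show ?case
    proof (cases "e \<in> H")
      case True
      then show ?thesis using y step conn_edge conn_trans by metis
    next
      case False
      then have e: "e \<in> F" using step by blast
      then have x: "x \<in> T" "x' \<in> T" using F step by auto
      have "conn en Z y x" using T y x by blast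
      then have "conn en (Z \<union> F) y x" by (rule conn_mono[rotated]) auto
      moreover have "conn en (Z \<union> F) x x'" using e step by (auto intro: conn_edge)
      ultimately show ?thesis using y x conn_trans conn_refl by metis
    qed
  qed
  then obtain y where y: "y \<in> T" "conn en (Z \<union> F) s y" "conn en H y t" by blast
  have "conn en Z y t" using T y t by blast
  then have "conn en (Z \<union> F) y t" by (rule conn_mono[rotated]) auto
  then show ?thesis using y conn_trans by metis
qed

section \<open>Walks and cycles\<close>

text \<open>The edge set is exactly that of the segment between the two positions, so that one edge
  of a cycle can be left out when the rest serves as a path.\<close>

lemma walk_conn:
  assumes "walk en F vs es" and "i \<le> j" and "j < length vs"
  shows "conn en (set (take (j - i) (drop i es))) (vs ! i) (vs ! j)"
  using assms(2,3)
proof (induction j rule: dec_induct)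
  case base
  show ?case by simp
next
  case (step n)
  have n: "n < length es" using step assms(1) by (simp add: walk_def)
  then have e: "en (es ! n) = {vs ! n, vs ! Suc n}" using assms(1) by (simp add: walk_def)
  have *: "take (Suc n - i) (drop i es) = take (n - i) (drop i es) @ [es ! n]"
    using n step(1) by (simp add: Suc_diff_le take_Suc_conv_app_nth)
  have "conn en (set (take (Suc n - i) (drop i es))) (vs ! n) (vs ! Suc n)"
    by (rule conn_edge[of "es ! n"]) (simp_all add: * e)
  moreover have "conn en (set (take (Suc n - i) (drop i es))) (vs ! i) (vs ! n)"
    by (rule conn_mono[OF _ step.IH]) (use step in \<open>auto simp: *\<close>)
  ultimately show ?case using conn_trans by metis
qed

lemma walk_snoc:
  "walk en F vs es \<Longrightarrow> e \<in> F \<Longrightarrow> en e = {last vs, y} \<Longrightarrow> walk en F (vs @ [y]) (es @ [e])"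
  unfolding walk_def
  by (cases vs rule: rev_cases) (auto simp: nth_append less_Suc_eq)

lemma walk_take:
  "walk en F vs es \<Longrightarrow> i < length vs \<Longrightarrow> walk en F (take (Suc i) vs) (take i es)"
  unfolding walk_def by (auto dest: in_set_takeD)

lemma conn_imp_path:
  "conn en F u v \<Longrightarrow> \<exists>vs es. walk en F vs es \<and> hd vs = u \<and> last vs = v \<and> distinct vs"
proof (induction rule: conn_induct)
  case refl
  have "walk en F [u] []" by (simp add: walk_def)
  then show ?case by (metis distinct_singleton last.simps list.sel(1))
next
  case (step x y e)
  then obtain vs es where w: "walk en F vs es" "hd vs = u" "last vs = x" "distinct vs" by blast
  then have ne: "vs \<noteq> []" by (auto simp: walk_def)
  show ?case
  proof (cases "y \<in> set vs")
    \<comment> \<open>If \<open>y\<close> already lies on the path, the path is cut there instead of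
      extended.\<close>
    case True
    then obtain i where i: "i < length vs" "vs ! i = y" by (auto simp: in_set_conv_nth)
    have "walk en F (take (Suc i) vs) (take i es)" using w i walk_take by metis
    moreover have "last (take (Suc i) vs) = y"
      using i by (simp add: take_Suc_conv_app_nth)
    ultimately show ?thesis using w ne by (metis distinct_take hd_take zero_less_Suc)
  next
    case False
    have "walk en F (vs @ [y]) (es @ [e])" using w step walk_snoc by metis
    then show ?thesis using w ne False
      by (metis distinct_append distinct_singleton disjoint_insert(1) hd_append2 inf_bot_right
          last_snoc list.simps(15) empty_set)
  qed
qed

lemma conn_iff_walk:
  "conn en F u v \<longleftrightarrow> (\<exists>vs es. walk en F vs es \<and> hd vs = u \<and> last vs = v)"
proof
  assume "\<exists>vs es. walk en F vs es \<and> hd vs = u \<and> last vs = v"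
  then obtain vs es where w: "walk en F vs es" "hd vs = u" "last vs = v" by blast
  then have ne: "vs \<noteq> []" by (auto simp: walk_def)
  have "conn en (set (take (length es - 0) (drop 0 es))) (vs ! 0) (vs ! length es)"
    by (rule walk_conn[OF w(1)]) (use w in \<open>auto simp: walk_def\<close>)
  moreover have "vs ! 0 = u" using w ne by (simp add: hd_conv_nth)
  moreover have "vs ! length es = v" using w ne by (simp add: last_conv_nth walk_def)
  ultimately show "conn en F u v"
    using w(1) by (auto simp: walk_def intro: conn_mono)
qed (use conn_imp_path in metis)

lemma connected_graph_iff:
  "connected_graph en V F \<longleftrightarrow> V \<noteq> {} \<and> (\<forall>u\<in>V. \<forall>v\<in>V. conn en F u v)"
  by (simp add: connected_graph_def conn_iff_walk)

text \<open>Different positions of a duplicate-free vertex list cannot carry the same pair of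
  neighbours. This supplies the distinct edges that \<open>is_cycle\<close> demands when a path is
  closed.\<close>

lemma path_distinct_edges:
  assumes w: "walk en F vs es" and d: "distinct vs"
  shows "distinct es"
proof -
  have "i = j" if i: "i < length es" and j: "j < length es" and eq: "es ! i = es ! j" for i j
  proof -
    have "{vs ! i, vs ! Suc i} = {vs ! j, vs ! Suc j}" using w i j eq by (metis walk_def)
    moreover have "length vs = Suc (length es)" using w by (simp add: walk_def)
    ultimately show "i = j"
      using d i j by (auto simp: doubleton_eq_iff nth_eq_iff_index_eq)
  qed
  then show ?thesis by (auto simp: distinct_conv_nth)
qed

text \<open>Turns the cycle tests of the definitions into connectivity tests, which the program can
  perform. A path closes up with \<open>e\<close> to a cycle; conversely a new cycle must use
  \<open>e\<close>, and the rest of it is a path.\<close>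

lemma cycle_free_insert:
  assumes F: "cycle_free en F" and nF: "e \<notin> F" and e: "en e = {a, b}" and ab: "a \<noteq> b"
  shows "cycle_free en (insert e F) \<longleftrightarrow> \<not> conn en F a b"
proof
  assume cf: "cycle_free en (insert e F)"
  show "\<not> conn en F a b"
  proof
    assume "conn en F a b"
    then obtain vs es where w: "walk en F vs es" "hd vs = a" "last vs = b" "distinct vs"
      using conn_imp_path by metis
    have ne: "vs \<noteq> []" using w by (auto simp: walk_def)
    have "walk en (insert e F) vs es" using w(1) by (auto simp: walk_def)
    then have "walk en (insert e F) (vs @ [a]) (es @ [e])"
      using w e by (intro walk_snoc) (auto simp: insert_commute)
    moreover have "distinct (es @ [e])"
      using path_distinct_edges[OF w(1,4)] w(1) nF by (auto simp: walk_def)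
    moreover have "distinct (tl (vs @ [a]))"
      using w ne by (cases vs) auto
    ultimately have "is_cycle en (insert e F) (vs @ [a]) (es @ [e])"
      using w ne by (simp add: is_cycle_def)
    then show False using cf by (auto simp: cycle_free_def)
  qed
next
  assume nc: "\<not> conn en F a b"
  show "cycle_free en (insert e F)"
    unfolding cycle_free_def
  proof (rule notI, elim exE)
    fix vs es
    assume c: "is_cycle en (insert e F) vs es"
    have w: "walk en (insert e F) vs es" and ne: "es \<noteq> []" and hl: "hd vs = last vs"
      and dv: "distinct (tl vs)" and de: "distinct es"
      using c by (auto simp: is_cycle_def)
    have "e \<in> set es"
    proof (rule ccontr)
      assume "e \<notin> set es"
      then have "walk en F vs es" using w by (auto simp: walk_def)
      then have "is_cycle en F vs es" using c by (simp add: is_cycle_def)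
      then show False using F by (auto simp: cycle_free_def)
    qed
    then obtain i where i: "i < length es" "es ! i = e" by (auto simp: in_set_conv_nth)
    have len: "length vs = Suc (length es)" using w by (simp add: walk_def)
    have es: "set es \<subseteq> insert e F" using w by (simp add: walk_def)
    have split: "es = take i es @ e # drop (Suc i) es" using i by (metis id_take_nth_drop)
    then have "e \<notin> set (take i es) \<and> e \<notin> set (drop (Suc i) es)"
      using de by (metis distinct_append distinct.simps(2) disjoint_iff list.set_intros(1))
    then have sub: "set (take i es) \<subseteq> F" "set (drop (Suc i) es) \<subseteq> F"
      using es by (auto dest: in_set_takeD in_set_dropD)
    have "conn en (set (take (i - 0) (drop 0 es))) (vs ! 0) (vs ! i)"
      by (rule walk_conn[OF w]) (use i len in auto)
    then have 1: "conn en F (hd vs) (vs ! i)"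
      using sub(1) len conn_mono[of "set (take i es)" F] by (cases vs) auto
    have "conn en (set (take (length es - Suc i) (drop (Suc i) es))) (vs ! Suc i) (vs ! length es)"
      by (rule walk_conn[OF w]) (use i len in auto)
    then have "conn en F (vs ! Suc i) (vs ! length es)"
      using sub(2) by (auto intro: conn_mono)
    \<comment> \<open>The cycle need not start at \<open>e\<close>: the part behind \<open>e\<close>
      and the part before it are glued at the common first and last vertex.\<close>
    moreover have "vs ! length es = hd vs" using len hl last_conv_nth[of vs] by (cases vs) auto
    ultimately have 2: "conn en F (vs ! Suc i) (vs ! i)" using 1 conn_trans by metis
    have "{vs ! i, vs ! Suc i} = {a, b}" using w i e by (metis walk_def)
    then show False using 2 nc conn_sym by (metis doubleton_eq_iff)
  qed
qed

lemma cycle_free_empty: "cycle_free en {}"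
  by (auto simp: cycle_free_def is_cycle_def walk_def)

section \<open>Greedy selection\<close>

text \<open>\<open>F\<close> holds what is already present, and only new edges are returned. One
  function serves as the follower's response (\<open>F\<close> the leader's choice), as Kruskal's
  algorithm (\<open>F\<close> the follower's edges, list sorted by cost) and as spanning forest
  (\<open>F\<close> empty).\<close>

fun select :: "('e \<Rightarrow> 'v \<times> 'v) \<Rightarrow> ('e \<Rightarrow> 'v set) \<Rightarrow> 'e set \<Rightarrow> 'e list \<Rightarrow> 'e list" where
  "select ab en F [] = []"
| "select ab en F (e # es) =
     (if conn en F (fst (ab e)) (snd (ab e)) then select ab en F es
      else e # select ab en (insert e F) es)"

text \<open>\<open>ab\<close> orders the two ends of an edge, as an encoded edge does, whereas
  \<open>en\<close> forgets the order.\<close>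

locale edge_ends =
  fixes ab :: "'e \<Rightarrow> 'v \<times> 'v" and en :: "'e \<Rightarrow> 'v set" and E :: "'e set"
  assumes ends: "e \<in> E \<Longrightarrow> en e = {fst (ab e), snd (ab e)}"
    and ends_neq: "e \<in> E \<Longrightarrow> fst (ab e) \<noteq> snd (ab e)"
begin

lemma set_select: "set (select ab en F es) \<subseteq> set es"
  by (induction es arbitrary: F) auto

lemma distinct_select: "distinct es \<Longrightarrow> distinct (select ab en F es)"
proof (induction es arbitrary: F)
  case (Cons e es)
  then show ?case using set_select[of "insert e F" es] by auto
qed simp

lemma conn_select:
  "set es \<subseteq> E \<Longrightarrow> conn en (F \<union> set (select ab en F es)) u v \<longleftrightarrow> conn en (F \<union> set es) u v"
proof (induction es arbitrary: F)
  case (Cons e es)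
  have e: "en e = {fst (ab e), snd (ab e)}" using Cons.prems ends by auto
  show ?case
  proof (cases "conn en F (fst (ab e)) (snd (ab e))")
    case True
    then have "conn en (F \<union> set es) (fst (ab e)) (snd (ab e))"
      by (rule conn_mono[rotated]) auto
    then show ?thesis using Cons True conn_insert_absorb[of en e _ _ "F \<union> set es", OF e] by auto
  next
    case False
    then show ?thesis using Cons.IH[of "insert e F"] Cons.prems by auto
  qed
qed simp

lemma cycle_free_select:
  "set es \<subseteq> E \<Longrightarrow> distinct es \<Longrightarrow> set es \<inter> F = {} \<Longrightarrow> cycle_free en F \<Longrightarrow>
    cycle_free en (F \<union> set (select ab en F es))"
proof (induction es arbitrary: F)
  case (Cons e es)
  have "en e = {fst (ab e), snd (ab e)}" "fst (ab e) \<noteq> snd (ab e)"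
    using Cons.prems ends ends_neq by auto
  then have "\<not> conn en F (fst (ab e)) (snd (ab e)) \<Longrightarrow> cycle_free en (insert e F)"
    using Cons.prems cycle_free_insert by (metis disjoint_iff list.set_intros(1))
  then show ?case using Cons.prems Cons.IH[of F] Cons.IH[of "insert e F"] by auto
qed simp

text \<open>Along the fold \<open>X \<union> Y\<close> stays cycle-free, so
  \<open>cycle_free_insert\<close> turns each cycle test into a connectivity test.\<close>

lemma foldl_select:
  assumes "set es \<subseteq> E" and "distinct es" and "set es \<inter> (X \<union> Y) = {}" and "cycle_free en (X \<union> Y)"
  shows "foldl (\<lambda>Y e. if cycle_free en (X \<union> Y \<union> {e}) then Y \<union> {e} else Y) Y es
    = Y \<union> set (select ab en (X \<union> Y) es)"
  using assms
proof (induction es arbitrary: Y)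
  case (Cons e es)
  have "en e = {fst (ab e), snd (ab e)}" "fst (ab e) \<noteq> snd (ab e)"
    using Cons.prems ends ends_neq by auto
  then have "cycle_free en (insert e (X \<union> Y)) \<longleftrightarrow> \<not> conn en (X \<union> Y) (fst (ab e)) (snd (ab e))"
    using Cons.prems by (intro cycle_free_insert) auto
  then show ?case using Cons.IH[of Y] Cons.IH[of "insert e Y"] Cons.prems by auto
qed simp

text \<open>The hypothesis mentions all earlier edges \<open>es1\<close>, not just the accepted
  ones, so it can be checked without running the selection; accepted and offered edges span the same
  connections.\<close>

lemma select_antimono:
  assumes "set es \<subseteq> E"
    and "\<And>es1 e es2. es = es1 @ e # es2 \<Longrightarrow> conn en (G \<union> set es1) (fst (ab e)) (snd (ab e)) \<Longrightarrow>
      conn en (F \<union> set es1) (fst (ab e)) (snd (ab e))"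
  shows "set (select ab en F es) \<subseteq> set (select ab en G es)"
  using assms
proof (induction es arbitrary: F G)
  case (Cons e es)
  have e: "en e = {fst (ab e), snd (ab e)}" using Cons.prems ends by auto
  let ?c = "\<lambda>F. conn en F (fst (ab e)) (snd (ab e))"
  have hd: "?c G \<Longrightarrow> ?c F" using Cons.prems(2)[of "[]" e es] by simp
  have ins: "set (select ab en (insert e F) es) \<subseteq> set (select ab en (insert e G) es)"
  proof (rule Cons.IH)
    show "set es \<subseteq> E" using Cons.prems by simp
  next
    fix es1 f es2
    assume "es = es1 @ f # es2" "conn en (insert e G \<union> set es1) (fst (ab f)) (snd (ab f))"
    then show "conn en (insert e F \<union> set es1) (fst (ab f)) (snd (ab f))"
      using Cons.prems(2)[of "e # es1" f es2] by simp
  qed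
  \<comment> \<open>An edge rejected against \<open>H\<close> is redundant, so putting it into
    \<open>H\<close> leaves the rest of the run unchanged. Hence \<open>e\<close> can be added on
    both sides whatever the two decisions were.\<close>
  have same: "select ab en (insert e H) es = select ab en H es" if "?c H" for H
  proof -
    have "conn en (insert e H \<union> A) u v \<longleftrightarrow> conn en (H \<union> A) u v" for A u v
    proof -
      have "?c (H \<union> A)" using that by (rule conn_mono[rotated]) auto
      then show ?thesis using conn_insert_absorb[of en e _ _ "H \<union> A", OF e] by auto
    qed
    then have "select ab en (insert e H \<union> A) es = select ab en (H \<union> A) es" for A
    proof (induction es arbitrary: A)
      case (Cons f fs)
      have "conn en (insert e H \<union> A) u v = conn en (H \<union> A) u v" for A u v by (rule Cons.prems)
      then show ?case using Cons.IH[of A] Cons.IH[of "insert f A"] by simp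
    qed simp
    from this[of "{}"] show ?thesis by simp
  qed
  show ?case using hd ins same[of F] same[of G] by auto
qed simp

text \<open>\<open>f\<close> is taken from a minimal subset \<open>Z'\<close> of \<open>Z\<close>
  that joins \<open>a\<close> and \<open>b\<close> together with \<open>F\<close>; by minimality the
  connection crosses \<open>f\<close>, and \<open>conn_exchange\<close> applies.\<close>

lemma exchange_edge:
  assumes "finite Z" and Z: "Z \<subseteq> E" and e: "en e = {a, b}"
    and c: "conn en (F \<union> Z) a b" and n: "\<not> conn en F a b"
  shows "\<exists>f\<in>Z. \<forall>u v. conn en (F \<union> Z) u v \<longrightarrow> conn en (insert e F \<union> (Z - {f})) u v"
proof -
  obtain Z' where Z': "Z' \<subseteq> Z" "conn en (F \<union> Z') a b"
    and min: "\<And>Y. Y \<subset> Z' \<Longrightarrow> \<not> conn en (F \<union> Y) a b"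
  proof -
    have "finite {Y. Y \<subseteq> Z \<and> conn en (F \<union> Y) a b}" using assms(1) by simp
    moreover have "Z \<in> {Y. Y \<subseteq> Z \<and> conn en (F \<union> Y) a b}" using c by simp
    ultimately obtain m where "m \<in> {Y. Y \<subseteq> Z \<and> conn en (F \<union> Y) a b}"
      and "\<forall>Y\<in>{Y. Y \<subseteq> Z \<and> conn en (F \<union> Y) a b}. Y \<subseteq> m \<longrightarrow> m = Y"
      using finite_has_minimal2 by (metis (no_types, lifting))
    then show thesis using that[of m] by blast
  qed
  have "Z' \<noteq> {}" using Z' n by auto
  then obtain f where f: "f \<in> Z'" by blast
  let ?R = "F \<union> (Z' - {f})"
  obtain x y where xy: "en f = {x, y}" using f Z' Z ends by blast
  have "conn en (insert e ?R) x y"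
  proof (rule conn_exchange[of en e a b f])
    show "en e = {a, b}" "en f = {x, y}" by fact+
  next
    show "conn en (insert f ?R) a b"
      using Z'(2) by (rule conn_mono[rotated]) auto
    show "\<not> conn en ?R a b" using min[of "Z' - {f}"] f by auto
  qed
  then have fxy: "conn en (insert e F \<union> (Z - {f})) x y"
    by (rule conn_mono[rotated]) (use Z' in auto)
  have "conn en (F \<union> Z) u v \<Longrightarrow> conn en (insert e F \<union> (Z - {f})) u v" for u v
  proof (erule conn_span[rotated])
    fix g s t
    assume g: "g \<in> F \<union> Z" "en g = {s, t}"
    show "conn en (insert e F \<union> (Z - {f})) s t"
    proof (cases "g = f")
      case True
      then show ?thesis using g xy fxy conn_sym by (metis doubleton_eq_iff)
    next
      case False
      then show ?thesis using g by (intro conn_edge[of g]) auto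
    qed
  qed
  moreover have "f \<in> Z" using f Z'(1) by blast
  ultimately show ?thesis by metis
qed

text \<open>Kruskal's algorithm with \<open>F\<close> contracted. The competitor \<open>Z\<close>
  follows the run: a rejected edge is dropped from it, an accepted one is exchanged for an edge of
  \<open>Z\<close> that costs no less.\<close>

lemma select_sorted_minimal:
  fixes c :: "'e \<Rightarrow> real"
  assumes "set es \<subseteq> E" and "sorted (map c es)" and "distinct es"
    and "\<And>e. e \<in> set es \<Longrightarrow> 0 \<le> c e"
    and "Z \<subseteq> set es" and "\<And>e. e \<in> set es \<Longrightarrow> conn en (F \<union> Z) (fst (ab e)) (snd (ab e))"
  shows "sum c (set (select ab en F es)) \<le> sum c Z"
  using assms
proof (induction es arbitrary: F Z)
  case Nil
  then have "Z = {}" by simp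
  then show ?case by simp
next
  case (Cons e es)
  have e: "en e = {fst (ab e), snd (ab e)}" using Cons.prems(1) ends by auto
  have fin: "finite Z" using Cons.prems(5) finite_subset by blast
  show ?case
  proof (cases "conn en F (fst (ab e)) (snd (ab e))")
    case True
    have "conn en (F \<union> (Z - {e})) u v" if "conn en (F \<union> Z) u v" for u v
    proof -
      have "conn en (F \<union> (Z - {e})) (fst (ab e)) (snd (ab e))"
        using True by (rule conn_mono[rotated]) auto
      then have "conn en (insert e (F \<union> (Z - {e}))) u v \<longleftrightarrow> conn en (F \<union> (Z - {e})) u v"
        by (rule conn_insert_absorb[of en e, OF e])
      moreover have "conn en (insert e (F \<union> (Z - {e}))) u v"
        using that by (rule conn_mono[rotated]) auto
      ultimately show ?thesis by simp
    qed
    moreover have "conn en (F \<union> Z) (fst (ab f)) (snd (ab f))" if "f \<in> set es" for f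
      using Cons.prems(6) that by simp
    ultimately have "conn en (F \<union> (Z - {e})) (fst (ab f)) (snd (ab f))" if "f \<in> set es" for f
      using that by blast
    moreover have "set es \<subseteq> E" "sorted (map c es)" "distinct es" "Z - {e} \<subseteq> set es"
      "\<And>f. f \<in> set es \<Longrightarrow> 0 \<le> c f"
      using Cons.prems(1-5) by auto
    ultimately have "sum c (set (select ab en F es)) \<le> sum c (Z - {e})"
      by (intro Cons.IH)
    also have "\<dots> \<le> sum c Z"
      using Cons.prems(4,5) fin by (intro sum_mono2) auto
    finally show ?thesis using True by simp
  next
    case False
    \<comment> \<open>If \<open>Z\<close> contains \<open>e\<close>, then \<open>e\<close> itself
      has to leave, so that the remaining competitor consists of later edges. Otherwise
      \<open>f\<close> comes after \<open>e\<close> and is at least as expensive.\<close>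
    obtain f where f: "f \<in> Z"
      and conn: "\<And>u v. conn en (F \<union> Z) u v \<Longrightarrow> conn en (insert e F \<union> (Z - {f})) u v"
      and ef: "e \<in> Z \<Longrightarrow> f = e"
    proof (cases "e \<in> Z")
      case True
      then have "insert e F \<union> (Z - {e}) = F \<union> Z" by auto
      then show thesis by (intro that[OF True]) simp_all
    next
      case F: False
      have ce: "conn en (F \<union> Z) (fst (ab e)) (snd (ab e))" using Cons.prems(6) by simp
      have "Z \<subseteq> E" using Cons.prems(1,5) by auto
      from exchange_edge[OF fin this e ce False] obtain f where f: "f \<in> Z"
        "\<And>u v. conn en (F \<union> Z) u v \<Longrightarrow> conn en (insert e F \<union> (Z - {f})) u v" by blast
      show thesis by (rule that[of f]) (use f F in blast)+
    qed
    have "e \<notin> set (select ab en (insert e F) es)"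
      using set_select[of "insert e F" es] Cons.prems(3) by auto
    moreover have "sum c (set (select ab en (insert e F) es)) \<le> sum c (Z - {f})"
    proof (rule Cons.IH)
      show "set es \<subseteq> E" "sorted (map c es)" "distinct es" "\<And>f. f \<in> set es \<Longrightarrow> 0 \<le> c f"
        using Cons.prems(1-4) by auto
      show "Z - {f} \<subseteq> set es" using Cons.prems(5) ef by auto
      show "conn en (insert e F \<union> (Z - {f})) (fst (ab g)) (snd (ab g))" if "g \<in> set es" for g
        using Cons.prems(6) that by (intro conn) simp
    qed
    moreover have "c e \<le> c f" using Cons.prems(2,5) f by auto
    moreover have "sum c Z = c f + sum c (Z - {f})" using fin f by (rule sum.remove)
    ultimately show ?thesis using False by simp
  qed
qed

end

section \<open>Bounded evaluation\<close>

text \<open>The language compares numbers only by \<open>Less\<close>.\<close>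

definition EqE :: "exp \<Rightarrow> exp \<Rightarrow> exp" where
  "EqE a b = Cond (Less a b) (Lit 0) (Cond (Less b a) (Lit 0) (Lit 1))"

definition IfCons :: "exp \<Rightarrow> exp \<Rightarrow> exp \<Rightarrow> exp" where
  "IfCons a b c = Cond (IsPair a) b c"

locale interpreter =
  fixes w :: "real \<Rightarrow> nat" and P :: prog and W :: nat
begin

text \<open>Upper bounds instead of exact times, so that bounds can be rounded up at every function
  boundary.\<close>

definition evb :: "val list \<Rightarrow> exp \<Rightarrow> val \<Rightarrow> nat \<Rightarrow> bool" where
  "evb \<rho> a v t \<longleftrightarrow> (\<exists>s\<le>t. ev w P \<rho> a v s)"

definition evsb :: "val list \<Rightarrow> exp list \<Rightarrow> val list \<Rightarrow> nat \<Rightarrow> bool" where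
  "evsb \<rho> as vs t \<longleftrightarrow> (\<exists>s\<le>t. evs w P \<rho> as vs s)"

definition fn :: "nat \<Rightarrow> val list \<Rightarrow> val \<Rightarrow> nat \<Rightarrow> bool" where
  "fn i us v t \<longleftrightarrow> i < length P \<and> evb us (P ! i) v t"

text \<open>Arithmetic on small operands has a uniform price, at most \<open>1 + 2 * W\<close> for
  the step itself.\<close>

definition small :: "real \<Rightarrow> bool" where
  "small x \<longleftrightarrow> w x \<le> W"

lemma evb_mono: "evb \<rho> a v s \<Longrightarrow> s \<le> t \<Longrightarrow> evb \<rho> a v t"
  unfolding evb_def by (auto intro: le_trans)

lemma fnI:
  "P ! i = b \<Longrightarrow> i < length P \<Longrightarrow> evb us b v' s \<Longrightarrow> v' = v \<Longrightarrow> s \<le> t \<Longrightarrow> fn i us v t"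
  unfolding fn_def by (auto intro: evb_mono)

lemma fn_mono: "fn i us v s \<Longrightarrow> s \<le> t \<Longrightarrow> fn i us v t"
  unfolding fn_def by (auto intro: evb_mono)

lemma evb_nth: "i < length \<rho> \<Longrightarrow> \<rho> ! i = v \<Longrightarrow> evb \<rho> (Var i) v 1"
  unfolding evb_def using ev_Var by blast

lemma evb_Var:
  "evb (a # \<rho>) (Var 0) a 1"
  "evb (a # b # \<rho>) (Var 1) b 1"
  "evb (a # b # c # \<rho>) (Var 2) c 1"
  "evb (a # b # c # d # \<rho>) (Var 3) d 1"
  "evb (a # b # c # d # e # \<rho>) (Var 4) e 1"
  "evb (a # b # c # d # e # f # \<rho>) (Var 5) f 1"
  by (rule evb_nth; simp)+

lemma evb_Lit: "evb \<rho> (Lit 0) (Num 0) 1" "evb \<rho> (Lit 1) (Num 1) 1"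
  unfolding evb_def using ev_Lit[of w P \<rho> 0] ev_Lit[of w P \<rho> 1] by auto

lemma evb_Add:
  assumes "evb \<rho> a (Num x) s" "evb \<rho> b (Num y) t" "small x" "small y"
  shows "evb \<rho> (Add a b) (Num (x + y)) (1 + 2 * W + s + t)"
proof -
  obtain s' t' where "ev w P \<rho> a (Num x) s'" "s' \<le> s" "ev w P \<rho> b (Num y) t'" "t' \<le> t"
    using assms by (auto simp: evb_def)
  moreover have "w x \<le> W" "w y \<le> W" using assms by (auto simp: small_def)
  ultimately show ?thesis
    unfolding evb_def by (intro exI[of _ "1 + s' + t' + w x + w y"] conjI ev_Add) auto
qed

lemma evb_Sub:
  assumes "evb \<rho> a (Num x) s" "evb \<rho> b (Num y) t" "small x" "small y"
  shows "evb \<rho> (Sub a b) (Num (x - y)) (1 + 2 * W + s + t)"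
proof -
  obtain s' t' where "ev w P \<rho> a (Num x) s'" "s' \<le> s" "ev w P \<rho> b (Num y) t'" "t' \<le> t"
    using assms by (auto simp: evb_def)
  moreover have "w x \<le> W" "w y \<le> W" using assms by (auto simp: small_def)
  ultimately show ?thesis
    unfolding evb_def by (intro exI[of _ "1 + s' + t' + w x + w y"] conjI ev_Sub) auto
qed

lemma evb_Less:
  assumes "evb \<rho> a (Num x) s" "evb \<rho> b (Num y) t" "small x" "small y"
  shows "evb \<rho> (Less a b) (Num (of_bool (x < y))) (1 + 2 * W + s + t)"
proof -
  obtain s' t' where "ev w P \<rho> a (Num x) s'" "s' \<le> s" "ev w P \<rho> b (Num y) t'" "t' \<le> t"
    using assms by (auto simp: evb_def)
  moreover have "w x \<le> W" "w y \<le> W" using assms by (auto simp: small_def)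
  ultimately show ?thesis
    unfolding evb_def of_bool_def
    by (intro exI[of _ "1 + s' + t' + w x + w y"] conjI ev_Less) auto
qed

lemma evb_MkPair:
  assumes "evb \<rho> a u s" "evb \<rho> b v t"
  shows "evb \<rho> (MkPair a b) (Pair u v) (1 + s + t)"
proof -
  obtain s' t' where "ev w P \<rho> a u s'" "s' \<le> s" "ev w P \<rho> b v t'" "t' \<le> t"
    using assms by (auto simp: evb_def)
  then show ?thesis
    unfolding evb_def by (intro exI[of _ "1 + s' + t'"] conjI ev_MkPair) auto
qed

lemma evb_Head: "evb \<rho> a (Pair u v) s \<Longrightarrow> evb \<rho> (Head a) u (1 + s)"
  unfolding evb_def by (blast intro: ev_Head add_left_mono)

lemma evb_Tail: "evb \<rho> a (Pair u v) s \<Longrightarrow> evb \<rho> (Tail a) v (1 + s)"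
  unfolding evb_def by (blast intro: ev_Tail add_left_mono)

text \<open>The premise for a branch may assume that it is taken: searching the tail of a table, for
  instance, succeeds only if the head has a different key. The maximum makes the time independent of
  the condition.\<close>

lemma evb_Cond:
  assumes "evb \<rho> a (Num (of_bool b)) s" "b \<Longrightarrow> evb \<rho> c v1 t1" "\<not> b \<Longrightarrow> evb \<rho> d v2 t2"
  shows "evb \<rho> (Cond a c d) (if b then v1 else v2) (1 + s + max t1 t2)"
proof (cases b)
  case True
  then obtain s' t' where "ev w P \<rho> a (Num 1) s'" "s' \<le> s" "ev w P \<rho> c v1 t'" "t' \<le> t1"
    using assms by (auto simp: evb_def)
  then show ?thesis using True
    unfolding evb_def by (intro exI[of _ "1 + s' + t'"] conjI ev_Cond_true[where u = "Num 1"]) auto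
next
  case False
  then obtain s' t' where "ev w P \<rho> a (Num 0) s'" "s' \<le> s" "ev w P \<rho> d v2 t'" "t' \<le> t2"
    using assms by (auto simp: evb_def)
  then show ?thesis using False
    unfolding evb_def by (intro exI[of _ "1 + s' + t'"] conjI ev_Cond_false) auto
qed

text \<open>Introducing the result of the scrutinee first makes rule application deterministic: its
  shape selects the branch.\<close>

definition branch :: "val \<Rightarrow> val list \<Rightarrow> exp \<Rightarrow> exp \<Rightarrow> val \<Rightarrow> nat \<Rightarrow> bool" where
  "branch u \<rho> b c v t \<longleftrightarrow> evb \<rho> (case u of Pair _ _ \<Rightarrow> b | Num _ \<Rightarrow> c) v t"

lemma branch_intros:
  "evb \<rho> b v t \<Longrightarrow> branch (Pair x y) \<rho> b c v t"
  "evb \<rho> c v t \<Longrightarrow> branch (Num r) \<rho> b c v t"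
  by (simp_all add: branch_def)

lemma evb_IfCons:
  assumes "evb \<rho> a u s" "branch u \<rho> b c v t"
  shows "evb \<rho> (IfCons a b c) v (2 + s + t)"
proof -
  obtain s' t' where *: "ev w P \<rho> a u s'" "s' \<le> s"
    "ev w P \<rho> (case u of Pair _ _ \<Rightarrow> b | Num _ \<Rightarrow> c) v t'" "t' \<le> t"
    using assms by (auto simp: evb_def branch_def)
  have "ev w P \<rho> (IfCons a b c) v (1 + (1 + s') + t')"
  proof (cases u)
    case (Num x)
    have "ev w P \<rho> (IsPair a) (Num 0) (1 + s')" using ev_IsPair[OF *(1)] Num by simp
    then show ?thesis unfolding IfCons_def using * Num by (intro ev_Cond_false) auto
  next
    case (Pair x y)
    have "ev w P \<rho> (IsPair a) (Num 1) (1 + s')" using ev_IsPair[OF *(1)] Pair by simp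
    then show ?thesis
      unfolding IfCons_def using * Pair by (intro ev_Cond_true[where u = "Num 1"]) auto
  qed
  then show ?thesis
    unfolding evb_def using * by (intro exI[of _ "1 + (1 + s') + t'"]) auto
qed

lemma evb_Bind:
  assumes "evb \<rho> a u s" "evb (u # \<rho>) b v t"
  shows "evb \<rho> (Bind a b) v (1 + s + t)"
proof -
  obtain s' t' where "ev w P \<rho> a u s'" "s' \<le> s" "ev w P (u # \<rho>) b v t'" "t' \<le> t"
    using assms by (auto simp: evb_def)
  then show ?thesis
    unfolding evb_def by (intro exI[of _ "1 + s' + t'"] conjI ev_Bind) auto
qed

lemma evb_Call:
  assumes "evsb \<rho> as us s" "fn i us v t"
  shows "evb \<rho> (Call i as) v (1 + s + t)"
proof -
  obtain s' t' where "evs w P \<rho> as us s'" "s' \<le> s" "ev w P us (P ! i) v t'" "t' \<le> t"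
    "i < length P"
    using assms by (auto simp: evb_def evsb_def fn_def)
  then show ?thesis
    unfolding evb_def by (intro exI[of _ "1 + s' + t'"] conjI ev_Call) auto
qed

lemma evsb_Nil: "evsb \<rho> [] [] 0"
  unfolding evsb_def using evs_Nil by blast

lemma evsb_Cons:
  assumes "evb \<rho> a u s" "evsb \<rho> as us t"
  shows "evsb \<rho> (a # as) (u # us) (s + t)"
proof -
  obtain s' t' where "ev w P \<rho> a u s'" "s' \<le> s" "evs w P \<rho> as us t'" "t' \<le> t"
    using assms by (auto simp: evb_def evsb_def)
  then show ?thesis
    unfolding evsb_def by (intro exI[of _ "s' + t'"] conjI evs_Cons) auto
qed

lemma evb_EqE:
  assumes "evb \<rho> a (Num x) s" "evb \<rho> b (Num y) t" "small x" "small y"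
  shows "evb \<rho> (EqE a b) (Num (of_bool (x = y))) (5 + 4 * W + 2 * s + 2 * t)"
proof -
  have "evb \<rho> (EqE a b) (if x < y then Num 0 else if y < x then Num 0 else Num 1)
      (1 + (1 + 2 * W + s + t) + max 1 (1 + (1 + 2 * W + t + s) + max 1 1))"
    unfolding EqE_def by (intro evb_Cond evb_Less evb_Lit assms)
  moreover have "(if x < y then Num 0 else if y < x then Num 0 else Num 1) = Num (of_bool (x = y))"
    by auto
  moreover have "1 + (1 + 2 * W + s + t) + max 1 (1 + (1 + 2 * W + t + s) + max 1 1)
      \<le> 5 + 4 * W + 2 * s + 2 * t"
    by simp
  ultimately show ?thesis by (auto intro: evb_mono)
qed

text \<open>Resolution with these rules executes a body symbolically: result and time start as
  unknowns, are built up along the expression, and are compared with the claimed ones at the end.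
  \<open>EqE\<close> and \<open>IfCons\<close> stay folded so that their own rules apply.\<close>

lemmas evb_rules = evb_Var evb_Lit evb_Add evb_Sub evb_Less evb_MkPair evb_Head evb_Tail evb_Cond
  evb_IfCons branch_intros
  evb_Bind evb_Call evsb_Nil evsb_Cons evb_EqE

end

section \<open>The parameter dependence\<close>

definition fpt :: "nat \<Rightarrow> nat" where
  "fpt n = 2 ^ 2 ^ (n + 3)"

lemma fpt_Suc: "fpt (Suc n) = fpt n * fpt n"
proof -
  have "(2 :: nat) ^ (Suc n + 3) = 2 ^ (n + 3) + 2 ^ (n + 3)" by (simp add: power_add)
  then show ?thesis by (simp only: fpt_def power_add)
qed

text \<open>From \<open>n + 4 \<le> 2 ^ (n + 3)\<close>. The factor \<open>16\<close> is the slack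
  from which squaring pays for the constants in \<open>fpt_step\<close>.\<close>

lemma fpt_ge: "2 ^ n * 16 \<le> fpt n"
proof -
  have "n < 2 ^ n" by (rule less_exp)
  moreover have "(2 :: nat) ^ (n + 3) = 8 * 2 ^ n" by (simp add: power_add)
  ultimately have "n + 4 \<le> 2 ^ (n + 3)" by linarith
  then have "(2 :: nat) ^ (n + 4) \<le> 2 ^ 2 ^ (n + 3)" by (rule power_increasing) simp
  then show ?thesis by (simp add: fpt_def power_add)
qed

lemma fpt_pos: "0 < fpt n"
  by (simp add: fpt_def)

lemma fpt_mono: "m \<le> n \<Longrightarrow> fpt m \<le> fpt n"
  by (simp add: fpt_def)

text \<open>The recurrence for \<open>Suc n\<close> terminals, in units of a power of
  \<open>B\<close>: \<open>2 ^ Suc n\<close> splits and the final call on the empty list, each with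
  two recursive calls and one unit of overhead; \<open>2 ^ (n + 3)\<close> for listing the splits
  and \<open>2\<close> for the rest.\<close>

lemma fpt_step: "(2 ^ Suc n + 1) * (2 * fpt n + 1) + 2 ^ (n + 3) + 2 \<le> fpt (Suc n)"
proof -
  define q :: nat where "q = 2 ^ n"
  define x where "x = fpt n"
  have q: "1 \<le> q" by (simp add: q_def)
  have x: "q * 16 \<le> x" using fpt_ge by (simp add: q_def x_def)
  have "x \<le> q * x" "q * 16 \<le> q * x" using q x by (auto intro: order_trans[OF _ mult_le_mono2])
  moreover have "q * 16 * x \<le> x * x" using x by (rule mult_le_mono1)
  moreover have "(2 * q + 1) * (2 * x + 1) + 8 * q + 2 = 4 * (q * x) + 10 * q + 2 * x + 3"
    by (simp add: algebra_simps)
  ultimately have "(2 * q + 1) * (2 * x + 1) + 8 * q + 2 \<le> x * x" using q by linarith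
  then show ?thesis by (simp add: q_def x_def fpt_Suc power_add mult.commute)
qed

section \<open>The program\<close>

definition EdgeName :: "exp \<Rightarrow> exp" where "EdgeName a = Head a"
definition EdgeFst :: "exp \<Rightarrow> exp" where "EdgeFst a = Head (Tail a)"
definition EdgeSnd :: "exp \<Rightarrow> exp" where "EdgeSnd a = Head (Tail (Tail a))"
definition EdgeCost :: "exp \<Rightarrow> exp" where "EdgeCost a = Head (Tail (Tail (Tail a)))"

definition InstVerts :: "exp \<Rightarrow> exp" where "InstVerts a = Head a"
definition InstLeader :: "exp \<Rightarrow> exp" where "InstLeader a = Head (Tail a)"
definition InstFollower :: "exp \<Rightarrow> exp" where "InstFollower a = Head (Tail (Tail a))"

abbreviation (input) "Lookup v tab \<equiv> Call 1 [v, tab]"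
abbreviation (input) "Update v x tab \<equiv> Call 2 [v, x, tab]"
abbreviation (input) "Relabel p q tab \<equiv> Call 3 [p, q, tab]"
abbreviation (input) "Join tab e \<equiv> Call 4 [tab, e]"
abbreviation (input) "Joins tab es \<equiv> Call 5 [tab, es]"
abbreviation (input) "Select tab es \<equiv> Call 6 [tab, es]"
abbreviation (input) "Identity vs \<equiv> Call 7 [vs]"
abbreviation (input) "Cost_sum es \<equiv> Call 8 [es]"
abbreviation (input) "Member n es \<equiv> Call 9 [n, es]"
abbreviation (input) "Insert e es \<equiv> Call 10 [e, es]"
abbreviation (input) "Unite xs ys \<equiv> Call 11 [xs, ys]"
abbreviation (input) "Cheaper xs ys \<equiv> Call 12 [xs, ys]"
abbreviation (input) "Insort e es \<equiv> Call 13 [e, es]"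
abbreviation (input) "Sort es \<equiv> Call 14 [es]"
abbreviation (input) "Relax_dir a b e tab \<equiv> Call 15 [a, b, e, tab]"
abbreviation (input) "Relax e tab \<equiv> Call 16 [e, tab]"
abbreviation (input) "Relax_all es tab \<equiv> Call 17 [es, tab]"
abbreviation (input) "Rounds cs es tab \<equiv> Call 18 [cs, es, tab]"
abbreviation (input) "Constant x vs \<equiv> Call 19 [x, vs]"
abbreviation (input) "Distribute s R \<equiv> Call 20 [s, R]"
abbreviation (input) "Splits S \<equiv> Call 21 [S]"
abbreviation (input) "Combine X U V \<equiv> Call 22 [X, U, V]"
abbreviation (input) "Merge i R tab \<equiv> Call 23 [i, R, tab]"
abbreviation (input) "Steiner i S \<equiv> Call 24 [i, S]"
abbreviation (input) "Complete i X Z \<equiv> Call 25 [i, X, Z]"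
abbreviation (input) "Objective i X \<equiv> Call 26 [i, X]"
abbreviation (input) "Better i X Y \<equiv> Call 27 [i, X, Y]"
abbreviation (input) "Search i X T Z b \<equiv> Call 28 [i, X, T, Z, b]"
abbreviation (input) "Search_block i X t R Z b \<equiv> Call 29 [i, X, t, R, Z, b]"
abbreviation (input) "Terminals es \<equiv> Call 30 [es]"
abbreviation (input) "Names es \<equiv> Call 31 [es]"

text \<open>Tables are association lists whose keys are the vertices of the instance.\<close>

definition main_body :: exp where
  "main_body =
    Bind (Select (Joins (Identity (InstVerts (Var 0))) (InstFollower (Var 0)))
            (Sort (InstLeader (Var 0))))
      (Names (Search (Var 1) (Var 0) (Terminals (InstFollower (Var 1))) (Lit 0)
                (Complete (Var 1) (Var 0) (Lit 0))))"

text \<open>There is no case for the empty table: a missing key would leave the program without a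
  result, but only vertices of the instance are looked up.\<close>

definition lookup_body :: exp where
  "lookup_body =
    Cond (EqE (Head (Head (Var 1))) (Var 0)) (Tail (Head (Var 1))) (Lookup (Var 0) (Tail (Var 1)))"

definition update_body :: exp where
  "update_body =
    IfCons (Var 2)
      (MkPair (Cond (EqE (Head (Head (Var 2))) (Var 0))
                 (MkPair (Head (Head (Var 2))) (Var 1)) (Head (Var 2)))
         (Update (Var 0) (Var 1) (Tail (Var 2))))
      (Lit 0)"

definition relabel_body :: exp where
  "relabel_body =
    IfCons (Var 2)
      (MkPair (Cond (EqE (Tail (Head (Var 2))) (Var 0))
                 (MkPair (Head (Head (Var 2))) (Var 1)) (Head (Var 2)))
         (Relabel (Var 0) (Var 1) (Tail (Var 2))))
      (Lit 0)"

definition join_body :: exp where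
  "join_body =
    Relabel (Lookup (EdgeFst (Var 1)) (Var 0)) (Lookup (EdgeSnd (Var 1)) (Var 0)) (Var 0)"

definition joins_body :: exp where
  "joins_body =
    IfCons (Var 1) (Joins (Join (Var 0) (Head (Var 1))) (Tail (Var 1))) (Var 0)"

definition select_body :: exp where
  "select_body =
    IfCons (Var 1)
      (Cond (EqE (Lookup (EdgeFst (Head (Var 1))) (Var 0)) (Lookup (EdgeSnd (Head (Var 1))) (Var 0)))
         (Select (Var 0) (Tail (Var 1)))
         (MkPair (Head (Var 1)) (Select (Join (Var 0) (Head (Var 1))) (Tail (Var 1)))))
      (Lit 0)"

definition identity_body :: exp where
  "identity_body =
    IfCons (Var 0) (MkPair (MkPair (Head (Var 0)) (Head (Var 0))) (Identity (Tail (Var 0)))) (Lit 0)"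

definition cost_sum_body :: exp where
  "cost_sum_body =
    IfCons (Var 0) (Add (EdgeCost (Head (Var 0))) (Cost_sum (Tail (Var 0)))) (Lit 0)"

definition member_body :: exp where
  "member_body =
    IfCons (Var 1)
      (Cond (EqE (EdgeName (Head (Var 1))) (Var 0)) (Lit 1) (Member (Var 0) (Tail (Var 1))))
      (Lit 0)"

definition insert_body :: exp where
  "insert_body =
    Cond (Member (EdgeName (Var 0)) (Var 1)) (Var 1) (MkPair (Var 0) (Var 1))"

definition unite_body :: exp where
  "unite_body =
    IfCons (Var 0) (Unite (Tail (Var 0)) (Insert (Head (Var 0)) (Var 1))) (Var 1)"

definition cheaper_body :: exp where
  "cheaper_body =
    Cond (Less (Cost_sum (Var 1)) (Cost_sum (Var 0))) (Var 1) (Var 0)"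

definition insort_body :: exp where
  "insort_body =
    IfCons (Var 1)
      (Cond (Less (EdgeCost (Head (Var 1))) (EdgeCost (Var 0)))
         (MkPair (Head (Var 1)) (Insort (Var 0) (Tail (Var 1))))
         (MkPair (Var 0) (Var 1)))
      (MkPair (Var 0) (Lit 0))"

definition sort_body :: exp where
  "sort_body =
    IfCons (Var 0) (Insort (Head (Var 0)) (Sort (Tail (Var 0)))) (Lit 0)"

definition relax_dir_body :: exp where
  "relax_dir_body =
    Update (Var 0)
      (Cheaper (Lookup (Var 0) (Var 3)) (Insert (Var 2) (Lookup (Var 1) (Var 3)))) (Var 3)"

definition relax_body :: exp where
  "relax_body =
    Relax_dir (EdgeSnd (Var 0)) (EdgeFst (Var 0)) (Var 0)
      (Relax_dir (EdgeFst (Var 0)) (EdgeSnd (Var 0)) (Var 0) (Var 1))"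

definition relax_all_body :: exp where
  "relax_all_body =
    IfCons (Var 0) (Relax_all (Tail (Var 0)) (Relax (Head (Var 0)) (Var 1))) (Var 1)"

text \<open>The first argument is a unary counter; it is called with the leader's edge list, one
  round per edge.\<close>

definition rounds_body :: exp where
  "rounds_body =
    IfCons (Var 0) (Rounds (Tail (Var 0)) (Var 1) (Relax_all (Var 1) (Var 2))) (Var 2)"

definition constant_body :: exp where
  "constant_body =
    IfCons (Var 1) (MkPair (MkPair (Head (Var 1)) (Var 0)) (Constant (Var 0) (Tail (Var 1)))) (Lit 0)"

definition distribute_body :: exp where
  "distribute_body =
    IfCons (Var 1)
      (MkPair (MkPair (MkPair (Var 0) (Head (Head (Var 1)))) (Tail (Head (Var 1))))
         (MkPair (MkPair (Head (Head (Var 1))) (MkPair (Var 0) (Tail (Head (Var 1)))))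
            (Distribute (Var 0) (Tail (Var 1)))))
      (Lit 0)"

definition splits_body :: exp where
  "splits_body =
    IfCons (Var 0) (Distribute (Head (Var 0)) (Splits (Tail (Var 0))))
      (MkPair (MkPair (Lit 0) (Lit 0)) (Lit 0))"

definition combine_body :: exp where
  "combine_body =
    IfCons (Var 0)
      (MkPair
         (MkPair (Head (Head (Var 0)))
            (Cheaper (Tail (Head (Var 0)))
               (Unite (Tail (Head (Var 1))) (Tail (Head (Var 2))))))
         (Combine (Tail (Var 0)) (Tail (Var 1)) (Tail (Var 2))))
      (Lit 0)"

text \<open>Splits with an empty part are skipped: the other part would be the whole terminal list,
  and the recursion would not terminate.\<close>

definition merge_body :: exp where
  "merge_body =
    IfCons (Var 1)
      (Merge (Var 0) (Tail (Var 1))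
         (IfCons (Head (Head (Var 1)))
            (IfCons (Tail (Head (Var 1)))
               (Combine (Var 2) (Steiner (Var 0) (Head (Head (Var 1))))
                  (Steiner (Var 0) (Tail (Head (Var 1)))))
               (Var 2))
            (Var 2)))
      (Var 2)"

text \<open>\<open>Merge\<close> joins trees for smaller terminal lists at a common root;
  \<open>Rounds\<close> then moves the root along edges as in the Bellman-Ford algorithm. A single
  terminal starts with the empty list at itself.\<close>

definition steiner_body :: exp where
  "steiner_body =
    Rounds (InstLeader (Var 0)) (InstLeader (Var 0))
      (Merge (Var 0) (Splits (Var 1))
         (IfCons (Tail (Var 1))
            (Constant (InstLeader (Var 0)) (InstVerts (Var 0)))
            (Update (Head (Var 1)) (Lit 0)
               (Constant (InstLeader (Var 0)) (InstVerts (Var 0))))))"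

definition complete_body :: exp where
  "complete_body =
    Select (Identity (InstVerts (Var 0))) (Unite (Var 2) (Var 1))"

definition objective_body :: exp where
  "objective_body =
    Add (Cost_sum (Var 1))
      (Cost_sum (Select (Joins (Identity (InstVerts (Var 0))) (Var 1)) (InstFollower (Var 0))))"

definition better_body :: exp where
  "better_body =
    Cond (Less (Objective (Var 0) (Var 2)) (Objective (Var 0) (Var 1))) (Var 2) (Var 1)"

text \<open>A partition is met by choosing the block of its first terminal among the splits of the
  others and continuing with what is left. \<open>Var 3\<close> accumulates Steiner trees and
  \<open>Var 4\<close> is the best choice so far.\<close>

definition search_body :: exp where
  "search_body =
    IfCons (Var 2)
      (Search_block (Var 0) (Var 1) (Head (Var 2)) (Splits (Tail (Var 2))) (Var 3) (Var 4))
      (Better (Var 0) (Var 4) (Complete (Var 0) (Var 1) (Var 3)))"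

definition search_block_body :: exp where
  "search_block_body =
    IfCons (Var 3)
      (Search_block (Var 0) (Var 1) (Var 2) (Tail (Var 3)) (Var 4)
         (Search (Var 0) (Var 1) (Tail (Head (Var 3)))
            (Unite (Lookup (Var 2) (Steiner (Var 0) (MkPair (Var 2) (Head (Head (Var 3)))))) (Var 4))
            (Var 5)))
      (Var 5)"

definition terminals_body :: exp where
  "terminals_body =
    IfCons (Var 0)
      (MkPair (EdgeFst (Head (Var 0)))
         (MkPair (EdgeSnd (Head (Var 0))) (Terminals (Tail (Var 0)))))
      (Lit 0)"

definition names_body :: exp where
  "names_body =
    IfCons (Var 0) (MkPair (EdgeName (Head (Var 0))) (Names (Tail (Var 0)))) (Lit 0)"

definition bmst_program :: prog where
  "bmst_program =
    [main_body, lookup_body, update_body, relabel_body, join_body, joins_body, select_body, identity_body, cost_sum_body, member_body, insert_body, unite_body, cheaper_body, insort_body, sort_body, relax_dir_body, relax_body, relax_all_body, rounds_body, constant_body, distribute_body, splits_body, combine_body, merge_body, steiner_body, complete_body, objective_body, better_body, search_body, search_block_body, terminals_body, names_body]"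

lemmas bodies = main_body_def lookup_body_def update_body_def relabel_body_def join_body_def joins_body_def select_body_def identity_body_def cost_sum_body_def member_body_def insert_body_def unite_body_def cheaper_body_def insort_body_def sort_body_def relax_dir_body_def relax_body_def relax_all_body_def rounds_body_def constant_body_def distribute_body_def splits_body_def combine_body_def merge_body_def steiner_body_def complete_body_def objective_body_def better_body_def search_body_def search_block_body_def terminals_body_def names_body_def

lemma nth_bmst_program:
  "bmst_program ! 0 = main_body"
  "bmst_program ! 1 = lookup_body"
  "bmst_program ! 2 = update_body"
  "bmst_program ! 3 = relabel_body"
  "bmst_program ! 4 = join_body"
  "bmst_program ! 5 = joins_body"
  "bmst_program ! 6 = select_body"
  "bmst_program ! 7 = identity_body"
  "bmst_program ! 8 = cost_sum_body"
  "bmst_program ! 9 = member_body"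
  "bmst_program ! 10 = insert_body"
  "bmst_program ! 11 = unite_body"
  "bmst_program ! 12 = cheaper_body"
  "bmst_program ! 13 = insort_body"
  "bmst_program ! 14 = sort_body"
  "bmst_program ! 15 = relax_dir_body"
  "bmst_program ! 16 = relax_body"
  "bmst_program ! 17 = relax_all_body"
  "bmst_program ! 18 = rounds_body"
  "bmst_program ! 19 = constant_body"
  "bmst_program ! 20 = distribute_body"
  "bmst_program ! 21 = splits_body"
  "bmst_program ! 22 = combine_body"
  "bmst_program ! 23 = merge_body"
  "bmst_program ! 24 = steiner_body"
  "bmst_program ! 25 = complete_body"
  "bmst_program ! 26 = objective_body"
  "bmst_program ! 27 = better_body"
  "bmst_program ! 28 = search_body"
  "bmst_program ! 29 = search_block_body"
  "bmst_program ! 30 = terminals_body"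
  "bmst_program ! 31 = names_body"
  by (simp_all add: bmst_program_def)

lemma length_bmst_program: "length bmst_program = 32"
  by (simp add: bmst_program_def)

definition enc_table :: "nat list \<Rightarrow> (nat \<Rightarrow> val) \<Rightarrow> val" where
  "enc_table vs g = enc_list (map (\<lambda>v. Pair (enc_nat v) (g v)) vs)"

lemma enc_table_simps [simp]:
  "enc_table [] g = Num 0"
  "enc_table (v # vs) g = Pair (Pair (enc_nat v) (g v)) (enc_table vs g)"
  by (simp_all add: enc_table_def)

lemma enc_table_cong: "(\<And>v. v \<in> set vs \<Longrightarrow> g v = h v) \<Longrightarrow> enc_table vs g = enc_table vs h"
  by (induction vs) auto

text \<open>\<open>W\<close> bounds the operands of all arithmetic: names and costs of
  duplicate-free edge lists, of which single costs are a special case. \<open>1000\<close> is a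
  generous common bound for the constants in the bodies.\<close>

locale bmst_run = interpreter w bmst_program W
  for w :: "real \<Rightarrow> nat" and W :: nat +
  fixes I :: bmst and B :: nat
  assumes inst: "bmst_instance I"
    and small_vert: "v \<in> verts I \<Longrightarrow> w (real v) \<le> W"
    and small_edge: "e \<in> edges I \<Longrightarrow> w (real e) \<le> W"
    and small_total: "distinct es \<Longrightarrow> set es \<subseteq> edges I \<Longrightarrow> w (sum_list (map (ccost I) es)) \<le> W"
    and B_W: "1000 * (W + 1) \<le> B"
    and B_verts: "card (verts I) < B"
    and B_edges: "card (edges I) < B"
begin

abbreviation "en \<equiv> ends I"
abbreviation "V \<equiv> verts I"
abbreviation "E \<equiv> edges I"
abbreviation "vlist \<equiv> sorted_list_of_set (verts I)"
abbreviation "llist \<equiv> sorted_list_of_set (leader I)"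
abbreviation "fst_end e \<equiv> Min (ends I e)"
abbreviation "snd_end e \<equiv> Max (ends I e)"
abbreviation "both e \<equiv> (fst_end e, snd_end e)"
abbreviation "cost es \<equiv> sum_list (map (ccost I) es)"
abbreviation "enc_edges es \<equiv> enc_list (map (enc_edge I) es)"
abbreviation "enc_nats vs \<equiv> enc_list (map enc_nat vs)"
abbreviation "enc_tab g \<equiv> enc_table vlist g"
abbreviation "enc_inst \<equiv> enc_instance I"

lemma B_pow: "m = Suc n \<Longrightarrow> 1000 * B ^ n \<le> B ^ m"
proof -
  assume m: "m = Suc n"
  have "1000 \<le> B" using B_W by simp
  then show ?thesis by (simp add: m mult_le_mono1)
qed

text \<open>Linear arithmetic treats the powers as atoms; these facts let a bounded number of calls
  at one level fit below the next.\<close>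

lemma B_pows:
  "1000 * (W + 1) \<le> B" "1000 * B \<le> B^2" "1000 * B^2 \<le> B^3" "1000 * B^3 \<le> B^4"
  "1000 * B^4 \<le> B^5" "1000 * B^5 \<le> B^6" "1000 * B^6 \<le> B^7" "1000 * B^7 \<le> B^8"
  "1000 * B^8 \<le> B^9" "1000 * B^9 \<le> B^10" "1000 * B^10 \<le> B^11" "1000 * B^11 \<le> B^12"
  "1000 * B^12 \<le> B^13"
  by (rule B_W B_pow[of 2 1, unfolded power_one_right] B_pow; simp)+

lemma finite_V: "finite V" and finite_leader: "finite (leader I)" and finite_E: "finite E"
  using inst by (auto simp: bmst_instance_def edges_def)

lemma set_vlist: "set vlist = V" and set_llist: "set llist = leader I"
  by (simp_all add: finite_V finite_leader)

lemma ends_E: "e \<in> E \<Longrightarrow> en e = {fst_end e, snd_end e} \<and> fst_end e \<noteq> snd_end e"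
proof -
  assume "e \<in> E"
  then have "card (en e) = 2" using inst by (simp add: bmst_instance_def)
  then obtain a b where "en e = {a, b}" "a \<noteq> b" by (auto simp: card_2_iff)
  then show ?thesis by (auto simp: min_def max_def)
qed

lemma ends_V: "e \<in> E \<Longrightarrow> fst_end e \<in> V \<and> snd_end e \<in> V"
  using inst ends_E unfolding bmst_instance_def by blast

lemma leader_E: "leader I \<subseteq> E" and follower_E: "set (follower I) \<subseteq> E"
  by (auto simp: edges_def)

sublocale edge_ends both en E
  using ends_E by unfold_locales auto

lemma small_v: "v \<in> V \<Longrightarrow> small (real v)"
  and small_e: "e \<in> E \<Longrightarrow> small (real e)"
  and small_cost: "distinct es \<Longrightarrow> set es \<subseteq> E \<Longrightarrow> small (cost es)"
  by (auto simp: small_def small_vert small_edge small_total)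

lemma small_ccost: "e \<in> E \<Longrightarrow> small (ccost I e)"
  using small_cost[of "[e]"] by simp

lemma length_edges: "distinct es \<Longrightarrow> set es \<subseteq> E \<Longrightarrow> length es < B"
  using B_edges card_mono[OF finite_E, of "set es"] by (simp add: distinct_card)

lemma length_vlist: "length vlist < B"
  using B_verts by simp

text \<open>\<open>n + 1\<close> counts the elements of a list and the final call on the empty
  list.\<close>

lemma pow_bound: "n < B \<Longrightarrow> m = Suc d \<Longrightarrow> (n + 1) * B ^ d \<le> B ^ m"
  using mult_le_mono1[of "n + 1" B "B ^ d"] by simp

lemma pow_bounds:
  assumes "n < B"
  shows "(n + 1) * B \<le> B^2" "(n + 1) * B^2 \<le> B^3" "(n + 1) * B^3 \<le> B^4" "(n + 1) * B^4 \<le> B^5"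
    "(n + 1) * B^5 \<le> B^6" "(n + 1) * B^6 \<le> B^7" "(n + 1) * B^7 \<le> B^8" "(n + 1) * B^8 \<le> B^9"
    "(n + 1) * B^9 \<le> B^10"
  by (rule pow_bound[OF assms, of 2 1, unfolded power_one_right] pow_bound[OF assms]; simp)+

subsection \<open>Primitive operations\<close>

lemma evb_edge:
  assumes "evb \<rho> a (enc_edge I e) s"
  shows "evb \<rho> (EdgeName a) (enc_nat e) (1 + s)"
    and "evb \<rho> (EdgeFst a) (enc_nat (fst_end e)) (2 + s)"
    and "evb \<rho> (EdgeSnd a) (enc_nat (snd_end e)) (3 + s)"
    and "evb \<rho> (EdgeCost a) (Num (ccost I e)) (4 + s)"
proof -
  have 0: "evb \<rho> a (Pair (enc_nat e) (Pair (enc_nat (fst_end e)) (Pair (enc_nat (snd_end e))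
      (Pair (Num (ccost I e)) (Pair (Num (dcost I e)) (Num 0)))))) s"
    using assms by (simp add: enc_edge_def)
  note 1 = evb_Tail[OF 0]
  note 2 = evb_Tail[OF 1]
  note 3 = evb_Tail[OF 2]
  show "evb \<rho> (EdgeName a) (enc_nat e) (1 + s)"
    using evb_Head[OF 0] by (simp add: EdgeName_def)
  show "evb \<rho> (EdgeFst a) (enc_nat (fst_end e)) (2 + s)"
    using evb_Head[OF 1] by (simp add: EdgeFst_def)
  show "evb \<rho> (EdgeSnd a) (enc_nat (snd_end e)) (3 + s)"
    using evb_Head[OF 2] by (simp add: EdgeSnd_def eval_nat_numeral)
  show "evb \<rho> (EdgeCost a) (Num (ccost I e)) (4 + s)"
    using evb_Head[OF 3] by (simp add: EdgeCost_def eval_nat_numeral)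
qed

lemma evb_inst:
  assumes "evb \<rho> a enc_inst s"
  shows "evb \<rho> (InstVerts a) (enc_nats vlist) (1 + s)"
    and "evb \<rho> (InstLeader a) (enc_edges llist) (2 + s)"
    and "evb \<rho> (InstFollower a) (enc_edges (follower I)) (3 + s)"
proof -
  have 0: "evb \<rho> a (Pair (enc_nats vlist) (Pair (enc_edges llist)
      (Pair (enc_edges (follower I)) (Num 0)))) s"
    using assms by (simp add: enc_instance_def)
  note 1 = evb_Tail[OF 0]
  note 2 = evb_Tail[OF 1]
  show "evb \<rho> (InstVerts a) (enc_nats vlist) (1 + s)"
    using evb_Head[OF 0] by (simp add: InstVerts_def)
  show "evb \<rho> (InstLeader a) (enc_edges llist) (2 + s)"
    using evb_Head[OF 1] by (simp add: InstLeader_def)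
  show "evb \<rho> (InstFollower a) (enc_edges (follower I)) (3 + s)"
    using evb_Head[OF 2] by (simp add: InstFollower_def eval_nat_numeral)
qed

lemma fn_body:
  assumes "bmst_program ! i = b" "i < 32" "evb us b v' s" "v' = v" "s \<le> t"
  shows "fn i us v t"
  using assms by (intro fnI) (auto simp: length_bmst_program)

lemmas fn_intro = nth_bmst_program[THEN fn_body, unfolded bodies]

lemmas step = evb_edge evb_inst evb_rules
lemmas enc_simps = enc_table_simps list.map enc_list.simps

lemma fn_lookup_list:
  assumes "v \<in> set vs" "set vs \<subseteq> V"
  shows "fn 1 [enc_nat v, enc_table vs g] (g v) ((length vs + 1) * B)"
  using assms
proof (induction vs)
  case (Cons u vs)
  have s: "small (real u)" "small (real v)" using Cons.prems by (auto intro: small_v)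
  have v: "real u \<noteq> real v \<Longrightarrow> v \<in> set vs" "set vs \<subseteq> V" using Cons.prems by auto
  show ?case
    by (simp only: enc_simps, rule fn_intro, simp,
        (rule step Cons.IH | (simp add: s v; fail))+,
        use B_pows in \<open>auto simp: algebra_simps\<close>)
qed simp

lemma fn_lookup:
  assumes "v \<in> V"
  shows "fn 1 [enc_nat v, enc_tab g] (g v) (B^2)"
  by (rule fn_mono[OF fn_lookup_list pow_bounds(1)[OF length_vlist]]) (simp_all add: set_vlist assms)

lemma fn_update_list:
  assumes "v \<in> V" "set vs \<subseteq> V"
  shows "fn 2 [enc_nat v, x, enc_table vs g] (enc_table vs (g(v := x))) ((length vs + 1) * B)"
  using assms(2)
proof (induction vs)
  case Nil
  show ?case 
    by (simp only: enc_simps, rule fn_intro, simp,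
        (rule step | (simp; fail))+,
        use B_pows in \<open>auto simp: algebra_simps\<close>)
next
  case (Cons u vs)
  have s: "small (real u)" "small (real v)" using Cons.prems assms by (auto intro: small_v)
  have v: "set vs \<subseteq> V" using Cons.prems by auto
  show ?case
    by (simp only: enc_simps, rule fn_intro, simp,
        (rule step Cons.IH | (simp add: s v; fail))+,
        use B_pows in \<open>auto simp: algebra_simps fun_upd_def\<close>)
qed

lemma fn_update:
  assumes "v \<in> V"
  shows "fn 2 [enc_nat v, x, enc_tab g] (enc_tab (g(v := x))) (B^2)"
  by (rule fn_mono[OF fn_update_list pow_bounds(1)[OF length_vlist]]) (simp_all add: set_vlist assms)

lemma fn_relabel_list:
  assumes "p \<in> V" "set vs \<subseteq> V" "\<And>v. v \<in> V \<Longrightarrow> l v \<in> V"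
  shows "fn 3 [enc_nat p, enc_nat q, enc_table vs (\<lambda>v. enc_nat (l v))]
    (enc_table vs (\<lambda>v. enc_nat (if l v = p then q else l v))) ((length vs + 1) * B)"
  using assms(2)
proof (induction vs)
  case Nil
  show ?case 
    by (simp only: enc_simps, rule fn_intro, simp,
        (rule step | (simp; fail))+,
        use B_pows in \<open>auto simp: algebra_simps\<close>)
next
  case (Cons u vs)
  have s: "small (real (l u))" "small (real p)" using Cons.prems assms by (auto intro: small_v)
  have v: "set vs \<subseteq> V" using Cons.prems by auto
  show ?case
    by (simp only: enc_simps, rule fn_intro, simp,
        (rule step Cons.IH | (simp add: s v; fail))+,
        use B_pows in \<open>auto simp: algebra_simps\<close>)
qed

lemma fn_relabel:
  assumes "p \<in> V" "\<And>v. v \<in> V \<Longrightarrow> l v \<in> V"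
  shows "fn 3 [enc_nat p, enc_nat q, enc_tab (\<lambda>v. enc_nat (l v))]
    (enc_tab (\<lambda>v. enc_nat (if l v = p then q else l v))) (B^2)"
  by (rule fn_mono[OF fn_relabel_list pow_bounds(1)[OF length_vlist]]) (simp_all add: set_vlist assms)

text \<open>A component is represented by the common label of its vertices. Labels are vertices
  themselves, so that comparing them involves small numbers only.\<close>

definition labelling :: "(nat \<Rightarrow> nat) \<Rightarrow> nat set \<Rightarrow> bool" where
  "labelling l F \<longleftrightarrow>
    (\<forall>v\<in>V. l v \<in> V) \<and> (\<forall>u\<in>V. \<forall>v\<in>V. l u = l v \<longleftrightarrow> conn en F u v)"

lemma labelling_empty: "labelling (\<lambda>v. v) {}"
  using conn_singleton_class[of "{}" _ en] by (fastforce simp: labelling_def)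

lemma labelling_join:
  assumes "labelling l F" and "e \<in> E"
  shows "labelling (\<lambda>v. if l v = l (fst_end e) then l (snd_end e) else l v) (insert e F)"
proof -
  have ab: "fst_end e \<in> V" "snd_end e \<in> V" using ends_V assms by auto
  have e: "en e = {fst_end e, snd_end e}" using ends_E assms by blast
  have l: "conn en F u v \<longleftrightarrow> l u = l v" if "u \<in> V" "v \<in> V" for u v
    using assms that by (auto simp: labelling_def)
  have lV: "v \<in> V \<Longrightarrow> l v \<in> V" for v using assms by (auto simp: labelling_def)
  show ?thesis
    unfolding labelling_def
    using ab by (auto simp: conn_insert[of en e, OF e] l lV)
qed

lemma fn_join:
  assumes "labelling l F" and "e \<in> E"
  shows "fn 4 [enc_tab (\<lambda>v. enc_nat (l v)), enc_edge I e]
    (enc_tab (\<lambda>v. enc_nat (if l v = l (fst_end e) then l (snd_end e) else l v))) (B^3)"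
proof -
  have ab: "fst_end e \<in> V" "snd_end e \<in> V" using ends_V assms by auto
  have lV: "\<And>v. v \<in> V \<Longrightarrow> l v \<in> V" using assms by (auto simp: labelling_def)
  show ?thesis
    by (rule fn_intro, simp,
        (rule step fn_lookup fn_relabel | (simp add: ab lV; fail))+,
        use B_pows in \<open>auto simp: algebra_simps fun_upd_def\<close>)
qed

lemma fn_joins_list:
  assumes "labelling l F" and "set es \<subseteq> E"
  shows "\<exists>l'. labelling l' (F \<union> set es) \<and>
    fn 5 [enc_tab (\<lambda>v. enc_nat (l v)), enc_edges es] (enc_tab (\<lambda>v. enc_nat (l' v)))
      ((length es + 1) * B^4)"
  using assms
proof (induction es arbitrary: l F)
  case Nil
  have "fn 5 [enc_tab (\<lambda>v. enc_nat (l v)), enc_edges []] (enc_tab (\<lambda>v. enc_nat (l v)))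
      ((length ([] :: nat list) + 1) * B^4)"
    by (simp only: enc_simps, rule fn_intro, simp,
        (rule step | (simp; fail))+,
        use B_pows in \<open>auto simp: algebra_simps fun_upd_def\<close>)
  then show ?case using Nil by auto
next
  case (Cons e es)
  have e: "e \<in> E" "set es \<subseteq> E" using Cons.prems by auto
  from Cons.IH[OF labelling_join[OF Cons.prems(1) e(1)] e(2)] obtain l' where
    l': "labelling l' (insert e F \<union> set es)" and
    fn: "fn 5 [enc_tab (\<lambda>v. enc_nat (if l v = l (fst_end e) then l (snd_end e) else l v)),
      enc_edges es] (enc_tab (\<lambda>v. enc_nat (l' v))) ((length es + 1) * B^4)"
    by blast
  have "fn 5 [enc_tab (\<lambda>v. enc_nat (l v)), enc_edges (e # es)] (enc_tab (\<lambda>v. enc_nat (l' v)))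
      ((length (e # es) + 1) * B^4)"
    by (simp only: enc_simps, rule fn_intro, simp,
        (rule step fn fn_join[OF Cons.prems(1) e(1)] | (simp; fail))+,
        use B_pows in \<open>auto simp: algebra_simps\<close>)
  then show ?case using l' by auto
qed

lemma fn_joins:
  assumes "labelling l F" and "set es \<subseteq> E" and "distinct es"
  shows "\<exists>l'. labelling l' (F \<union> set es) \<and>
    fn 5 [enc_tab (\<lambda>v. enc_nat (l v)), enc_edges es] (enc_tab (\<lambda>v. enc_nat (l' v))) (B^5)"
  using fn_joins_list[OF assms(1,2)] pow_bounds(4)[OF length_edges[OF assms(3,2)]]
  by (blast intro: fn_mono)

lemma fn_select_list:
  assumes "labelling l F" and "set es \<subseteq> E"
  shows "fn 6 [enc_tab (\<lambda>v. enc_nat (l v)), enc_edges es] (enc_edges (select both en F es))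
      ((length es + 1) * B^4)"
  using assms
proof (induction es arbitrary: l F)
  case Nil
  show ?case
    by (simp only: enc_simps, rule fn_intro, simp,
        (rule step | (simp; fail))+,
        use B_pows in \<open>auto simp: algebra_simps fun_upd_def\<close>)
next
  case (Cons e es)
  have e: "e \<in> E" "set es \<subseteq> E" using Cons.prems by auto
  have ab: "fst_end e \<in> V" "snd_end e \<in> V" using ends_V e by auto
  note lab = Cons.prems(1)
  have s: "v \<in> V \<Longrightarrow> small (real (l v))" for v using lab by (auto simp: labelling_def intro: small_v)
  have l: "l (fst_end e) = l (snd_end e) \<longleftrightarrow> conn en F (fst_end e) (snd_end e)"
    using lab ab by (auto simp: labelling_def)
  note IH = Cons.IH[OF lab e(2)] Cons.IH[OF labelling_join[OF lab e(1)] e(2)]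
  show ?case
    by (simp only: enc_simps, rule fn_intro, simp,
        (rule step IH fn_lookup fn_join[OF lab e(1)] | (simp add: ab s; fail))+,
        use B_pows l in \<open>auto simp: algebra_simps\<close>)
qed

lemma fn_select:
  assumes "labelling l F" and "set es \<subseteq> E" and "distinct es"
  shows "fn 6 [enc_tab (\<lambda>v. enc_nat (l v)), enc_edges es] (enc_edges (select both en F es)) (B^5)"
  by (rule fn_mono[OF fn_select_list[OF assms(1,2)] pow_bounds(4)[OF length_edges[OF assms(3,2)]]])

lemma fn_identity_list:
  "fn 7 [enc_nats vs] (enc_table vs enc_nat) ((length vs + 1) * B)"
proof (induction vs)
  case Nil
  show ?case
    by (simp only: enc_simps, rule fn_intro, simp,
        (rule step | (simp; fail))+,
        use B_pows in \<open>auto simp: algebra_simps fun_upd_def\<close>)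
next
  case (Cons v vs)
  show ?case
    by (simp only: enc_simps, rule fn_intro, simp,
        (rule step Cons.IH | (simp; fail))+,
        use B_pows in \<open>auto simp: algebra_simps\<close>)
qed

lemma fn_identity: "fn 7 [enc_nats vlist] (enc_tab enc_nat) (B^2)"
  by (rule fn_mono[OF fn_identity_list pow_bounds(1)[OF length_vlist]])

text \<open>The list is summed from its end, so each intermediate sum is the cost of a suffix, which
  is again duplicate-free and hence small.\<close>

lemma fn_total_list:
  assumes "distinct es" "set es \<subseteq> E"
  shows "fn 8 [enc_edges es] (Num (cost es)) ((length es + 1) * B)"
  using assms
proof (induction es)
  case Nil
  show ?case
    by (simp only: enc_simps, rule fn_intro, simp,
        (rule step | (simp; fail))+,
        use B_pows in \<open>auto simp: algebra_simps fun_upd_def\<close>)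
next
  case (Cons e es)
  have e: "distinct es" "set es \<subseteq> E" "small (ccost I e)" "small (cost es)"
    using Cons.prems by (auto intro: small_cost small_ccost)
  show ?case
    by (simp only: enc_simps, rule fn_intro, simp,
        (rule step Cons.IH | (simp add: e; fail))+,
        use B_pows in \<open>auto simp: algebra_simps\<close>)
qed

lemma fn_total:
  assumes "distinct es" "set es \<subseteq> E"
  shows "fn 8 [enc_edges es] (Num (cost es)) (B^2)"
  by (rule fn_mono[OF fn_total_list[OF assms] pow_bounds(1)[OF length_edges[OF assms]]])

lemma fn_member_list:
  assumes "n \<in> E" "set es \<subseteq> E"
  shows "fn 9 [enc_nat n, enc_edges es] (Num (of_bool (n \<in> set es))) ((length es + 1) * B)"
  using assms(2)
proof (induction es)
  case Nil
  show ?case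
    by (simp only: enc_simps, rule fn_intro, simp,
        (rule step | (simp; fail))+,
        use B_pows in \<open>auto simp: algebra_simps fun_upd_def\<close>)
next
  case (Cons e es)
  have e: "set es \<subseteq> E" "small (real e)" "small (real n)"
    using Cons.prems assms by (auto intro: small_e)
  show ?case
    by (simp only: enc_simps, rule fn_intro, simp,
        (rule step Cons.IH | (simp add: e; fail))+,
        use B_pows in \<open>auto simp: algebra_simps\<close>)
qed

lemma fn_insert:
  assumes "e \<in> E" "set es \<subseteq> E" "distinct es"
  shows "fn 10 [enc_edge I e, enc_edges es] (enc_edges (List.insert e es)) (B^3)"
proof -
  have "fn 9 [enc_nat e, enc_edges es] (Num (of_bool (e \<in> set es))) (B^2)"
    by (rule fn_mono[OF fn_member_list[OF assms(1,2)] pow_bounds(1)[OF length_edges[OF assms(3,2)]]])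
  note fn = this
  show ?thesis
    by (rule fn_intro, simp,
        (rule step fn | (simp; fail))+,
        use B_pows in \<open>auto simp: algebra_simps\<close>)
qed

lemma fn_union_list:
  assumes "set xs \<subseteq> E" "set ys \<subseteq> E" "distinct ys"
  shows "fn 11 [enc_edges xs, enc_edges ys] (enc_edges (List.union xs ys)) ((length xs + 1) * B^4)"
  using assms
proof (induction xs arbitrary: ys)
  case Nil
  show ?case
    by (simp only: enc_simps, rule fn_intro, simp,
        (rule step | (simp; fail))+,
        use B_pows in \<open>auto simp: algebra_simps List.union_def\<close>)
next
  case (Cons x xs)
  have e: "x \<in> E" "set xs \<subseteq> E" using Cons.prems by auto
  note IH = Cons.IH[of "List.insert x ys"]
  show ?case
    by (simp only: enc_simps, rule fn_intro, simp,
        (rule step IH fn_insert | (simp add: e Cons.prems distinct_insert; fail))+,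
        use B_pows in \<open>auto simp: algebra_simps List.union_def\<close>)
qed

lemma fn_union:
  assumes "set xs \<subseteq> E" "distinct xs" "set ys \<subseteq> E" "distinct ys"
  shows "fn 11 [enc_edges xs, enc_edges ys] (enc_edges (List.union xs ys)) (B^5)"
  by (rule fn_mono[OF fn_union_list[OF assms(1,3,4)] pow_bounds(4)[OF length_edges[OF assms(2,1)]]])

definition cheaper :: "nat list \<Rightarrow> nat list \<Rightarrow> nat list" where
  "cheaper xs ys = (if cost ys < cost xs then ys else xs)"

lemma fn_cheaper:
  assumes "set xs \<subseteq> E" "distinct xs" "set ys \<subseteq> E" "distinct ys"
  shows "fn 12 [enc_edges xs, enc_edges ys] (enc_edges (cheaper xs ys)) (B^3)"
  unfolding cheaper_def
  by (rule fn_intro, simp,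
      (rule step fn_total | (simp add: assms small_cost; fail))+,
      use B_pows in \<open>auto simp: algebra_simps\<close>)

lemma fn_insort:
  assumes "e \<in> E" "set es \<subseteq> E"
  shows "fn 13 [enc_edge I e, enc_edges es] (enc_edges (insort_key (ccost I) e es))
    ((length es + 1) * B)"
  using assms(2)
proof (induction es)
  case Nil
  show ?case
    by (simp only: enc_simps, rule fn_intro, simp,
        (rule step | (simp; fail))+,
        use B_pows in \<open>auto simp: algebra_simps fun_upd_def\<close>)
next
  case (Cons f es)
  have e: "set es \<subseteq> E" "small (ccost I e)" "small (ccost I f)"
    using Cons.prems assms by (auto intro: small_ccost)
  show ?case
    by (simp only: enc_simps, rule fn_intro, simp,
        (rule step Cons.IH | (simp add: e; fail))+,
        use B_pows in \<open>auto simp: algebra_simps\<close>)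
qed

lemma fn_sort_list:
  assumes "set es \<subseteq> E" "distinct es"
  shows "fn 14 [enc_edges es] (enc_edges (sort_key (ccost I) es)) ((length es + 1) * B^3)"
  using assms
proof (induction es)
  case Nil
  show ?case
    by (simp only: enc_simps, rule fn_intro, simp,
        (rule step | (simp; fail))+,
        use B_pows in \<open>auto simp: algebra_simps fun_upd_def\<close>)
next
  case (Cons e es)
  have e: "set es \<subseteq> E" "e \<in> E" "distinct es" using Cons.prems by auto
  have "fn 13 [enc_edge I e, enc_edges (sort_key (ccost I) es)]
      (enc_edges (insort_key (ccost I) e (sort_key (ccost I) es))) (B^2)"
    by (rule fn_mono[OF fn_insort pow_bounds(1)[OF length_edges]]) (use e in auto)
  note fn = this
  show ?case
    by (simp only: enc_simps, rule fn_intro, simp,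
        (rule step Cons.IH fn | (simp add: e; fail))+,
        use B_pows in \<open>auto simp: algebra_simps\<close>)
qed

lemma fn_sort:
  assumes "set es \<subseteq> E" "distinct es"
  shows "fn 14 [enc_edges es] (enc_edges (sort_key (ccost I) es)) (B^4)"
  by (rule fn_mono[OF fn_sort_list[OF assms] pow_bounds(3)[OF length_edges[OF assms(2,1)]]])

subsection \<open>Tables of Steiner trees\<close>

definition edge_table :: "(nat \<Rightarrow> nat list) \<Rightarrow> bool" where
  "edge_table U \<longleftrightarrow> (\<forall>v\<in>V. distinct (U v) \<and> set (U v) \<subseteq> leader I)"

abbreviation "enc_etab U \<equiv> enc_tab (\<lambda>v. enc_edges (U v))"

lemma edge_tableD:
  assumes "edge_table U" "v \<in> V"
  shows "distinct (U v)" "set (U v) \<subseteq> leader I" "set (U v) \<subseteq> E"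
  using assms leader_E by (auto simp: edge_table_def)

definition relax_dir :: "nat \<Rightarrow> nat \<Rightarrow> nat \<Rightarrow> (nat \<Rightarrow> nat list) \<Rightarrow> nat \<Rightarrow> nat list" where
  "relax_dir a b e U = U(a := cheaper (U a) (List.insert e (U b)))"

definition relax :: "nat \<Rightarrow> (nat \<Rightarrow> nat list) \<Rightarrow> nat \<Rightarrow> nat list" where
  "relax e U = relax_dir (snd_end e) (fst_end e) e (relax_dir (fst_end e) (snd_end e) e U)"

lemma edge_table_relax_dir:
  "edge_table U \<Longrightarrow> a \<in> V \<Longrightarrow> b \<in> V \<Longrightarrow> e \<in> leader I \<Longrightarrow> edge_table (relax_dir a b e U)"
  unfolding edge_table_def relax_dir_def cheaper_def by auto

lemma edge_table_relax: "edge_table U \<Longrightarrow> e \<in> leader I \<Longrightarrow> edge_table (relax e U)"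
  unfolding relax_def using ends_V leader_E by (blast intro: edge_table_relax_dir)

lemma edge_table_fold_relax:
  "edge_table U \<Longrightarrow> set es \<subseteq> leader I \<Longrightarrow> edge_table (fold relax es U)"
  by (induction es arbitrary: U) (auto intro: edge_table_relax)

lemma fn_relax_dir:
  assumes "edge_table U" "a \<in> V" "b \<in> V" "e \<in> leader I"
  shows "fn 15 [enc_nat a, enc_nat b, enc_edge I e, enc_etab U] (enc_etab (relax_dir a b e U)) (B^4)"
proof -
  have e: "e \<in> E" using assms leader_E by auto
  note U = edge_tableD[OF assms(1)]
  show ?thesis
    by (rule fn_intro, simp,
        (rule step fn_lookup fn_insert fn_cheaper fn_update | (simp add: assms U e distinct_insert; fail))+,
        use B_pows in \<open>auto simp: algebra_simps relax_dir_def intro!: enc_table_cong\<close>)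
qed

lemma fn_relax:
  assumes "edge_table U" "e \<in> leader I"
  shows "fn 16 [enc_edge I e, enc_etab U] (enc_etab (relax e U)) (B^5)"
proof -
  have e: "fst_end e \<in> V" "snd_end e \<in> V" using assms leader_E ends_V by auto
  show ?thesis
    by (rule fn_intro, simp,
        (rule step fn_relax_dir edge_table_relax_dir | (simp add: assms e; fail))+,
        use B_pows in \<open>auto simp: algebra_simps relax_def\<close>)
qed

lemma fn_relax_all_list:
  assumes "edge_table U" "set es \<subseteq> leader I"
  shows "fn 17 [enc_edges es, enc_etab U] (enc_etab (fold relax es U)) ((length es + 1) * B^6)"
  using assms
proof (induction es arbitrary: U)
  case Nil
  show ?case
    by (simp only: enc_simps, rule fn_intro, simp,
        (rule step | (simp; fail))+,
        use B_pows in \<open>auto simp: algebra_simps\<close>)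
next
  case (Cons e es)
  have e: "e \<in> leader I" "set es \<subseteq> leader I" "edge_table U" using Cons.prems by auto
  show ?case
    by (simp only: enc_simps, rule fn_intro, simp,
        (rule step Cons.IH fn_relax edge_table_relax | (simp add: e; fail))+,
        use B_pows in \<open>auto simp: algebra_simps\<close>)
qed

lemma distinct_llist: "distinct llist" and llist_E: "set llist \<subseteq> E"
  using set_llist leader_E by auto

lemma length_llist: "length llist < B"
  using length_edges[OF distinct_llist llist_E] .

lemma fn_relax_all:
  assumes "edge_table U"
  shows "fn 17 [enc_edges llist, enc_etab U] (enc_etab (fold relax llist U)) (B^7)"
  by (rule fn_mono[OF fn_relax_all_list pow_bounds(6)[OF length_llist]])
    (simp_all add: assms set_llist del: set_sorted_list_of_set)

lemma fn_rounds_list: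
  assumes "edge_table U"
  shows "fn 18 [enc_edges cs, enc_edges llist, enc_etab U]
    (enc_etab (((fold relax llist) ^^ length cs) U)) ((length cs + 1) * B^8)"
  using assms
proof (induction cs arbitrary: U)
  case Nil
  show ?case
    by (simp only: enc_simps, rule fn_intro, simp,
        (rule step | (simp; fail))+,
        use B_pows in \<open>auto simp: algebra_simps\<close>)
next
  case (Cons c cs)
  have e: "edge_table (fold relax llist U)"
    using edge_table_fold_relax[OF Cons.prems] set_llist by simp
  note fn = Cons.IH[OF e] fn_relax_all[OF Cons.prems]
  show ?case
    by (simp only: enc_simps, rule fn_intro, simp,
        (rule step fn | (simp; fail))+,
        use B_pows in \<open>auto simp: algebra_simps funpow_swap1\<close>)
qed

lemma fn_rounds:
  assumes "edge_table U"
  shows "fn 18 [enc_edges llist, enc_edges llist, enc_etab U]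
    (enc_etab (((fold relax llist) ^^ card (leader I)) U)) (B^9)"
  using fn_mono[OF fn_rounds_list[OF assms, of llist] pow_bounds(8)[OF length_llist]] by simp

lemma fn_constant_list:
  "fn 19 [x, enc_nats vs] (enc_table vs (\<lambda>_. x)) ((length vs + 1) * B)"
proof (induction vs)
  case Nil
  show ?case
    by (simp only: enc_simps, rule fn_intro, simp,
        (rule step | (simp; fail))+,
        use B_pows in \<open>auto simp: algebra_simps\<close>)
next
  case (Cons v vs)
  show ?case
    by (simp only: enc_simps, rule fn_intro, simp,
        (rule step Cons.IH | (simp; fail))+,
        use B_pows in \<open>auto simp: algebra_simps\<close>)
qed

lemma fn_constant: "fn 19 [x, enc_nats vlist] (enc_tab (\<lambda>_. x)) (B^2)"
  by (rule fn_mono[OF fn_constant_list pow_bounds(1)[OF length_vlist]])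

section \<open>Splits of a terminal list into two sublists\<close>

definition distribute :: "nat \<Rightarrow> (nat list \<times> nat list) list \<Rightarrow> (nat list \<times> nat list) list" where
  "distribute s R = concat (map (\<lambda>(A, B). [(s # A, B), (A, s # B)]) R)"

lemma distribute_simps [simp]:
  "distribute s [] = []"
  "distribute s ((A, C) # R) = (s # A, C) # (A, s # C) # distribute s R"
  by (simp_all add: distribute_def)

primrec splits :: "nat list \<Rightarrow> (nat list \<times> nat list) list" where
  "splits [] = [([], [])]"
| "splits (s # S) = distribute s (splits S)"

lemma length_distribute: "length (distribute s R) = 2 * length R"
  by (induction R) (auto simp: distribute_def)

lemma length_splits: "length (splits S) = 2 ^ length S"
  by (induction S) (auto simp: length_distribute)

lemma set_distribute:
  "(A, C) \<in> set (distribute s R) \<longleftrightarrow>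
    (\<exists>A'. A = s # A' \<and> (A', C) \<in> set R) \<or> (\<exists>C'. C = s # C' \<and> (A, C') \<in> set R)"
  by (induction R) auto

lemma splitsD:
  "(A, C) \<in> set (splits S) \<Longrightarrow> set A \<union> set C = set S \<and> length A + length C = length S"
proof (induction S arbitrary: A C)
  case (Cons s S)
  then show ?case by (auto simp: set_distribute dest!: Cons.IH)
qed simp

text \<open>Correctness needs the splits given by connectivity to a fixed vertex.\<close>

lemma filter_splits: "(filter p S, filter (\<lambda>s. \<not> p s) S) \<in> set (splits S)"
  by (induction S) (auto simp: set_distribute)

abbreviation "enc_splits R \<equiv> enc_list (map (\<lambda>(A, B). Pair (enc_nats A) (enc_nats B)) R)"

lemma fn_distribute:
  "fn 20 [enc_nat s, enc_splits R] (enc_splits (distribute s R)) ((length R + 1) * B)"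
proof (induction R)
  case Nil
  show ?case
    by (simp only: enc_simps, rule fn_intro, simp,
        (rule step | (simp; fail))+,
        use B_pows in \<open>auto simp: algebra_simps\<close>)
next
  case (Cons r R)
  obtain A B' where r: "r = (A, B')" by force
  show ?case
    by (simp only: enc_simps r prod.case, rule fn_intro, simp,
        (rule step Cons.IH | (simp; fail))+,
        use B_pows in \<open>auto simp: algebra_simps\<close>)
qed

lemma fn_splits: "fn 21 [enc_nats S] (enc_splits (splits S)) (2 ^ (length S + 2) * B)"
proof (induction S)
  case Nil
  show ?case
    by (simp only: enc_simps, rule fn_intro, simp,
        (rule step | (simp; fail))+,
        use B_pows in \<open>auto simp: algebra_simps\<close>)
next
  case (Cons s S)
  \<comment> \<open>With \<open>n\<close> the length of \<open>S\<close>, distributing over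
    \<open>2 ^ n\<close> pairs costs \<open>(2 ^ n + 1) * B\<close>, while the claimed bound grows
    by \<open>4 * 2 ^ n * B\<close>; the surplus has to cover \<open>B\<close> and a few single
    steps.\<close>
  have "1000 \<le> B" using B_W by simp
  then have "B + 9 \<le> B * 3" by simp
  also have "\<dots> \<le> B * (3 * 2 ^ length S)" by (intro mult_le_mono2) simp
  finally have 1: "B + 9 \<le> B * (3 * 2 ^ length S)" .
  show ?case
    by (simp only: enc_simps, rule fn_intro, simp,
        (rule step Cons.IH fn_distribute | (simp; fail))+,
        use B_pows 1 in \<open>auto simp: algebra_simps length_splits\<close>)
qed

definition combine :: "(nat \<Rightarrow> nat list) \<Rightarrow> (nat \<Rightarrow> nat list) \<Rightarrow> (nat \<Rightarrow> nat list) \<Rightarrow> nat \<Rightarrow> nat list" where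
  "combine X U U' v = cheaper (X v) (List.union (U v) (U' v))"

lemma fn_combine_list:
  assumes "edge_table X" "edge_table U" "edge_table U'" "set vs \<subseteq> V"
  shows "fn 22 [enc_table vs (\<lambda>v. enc_edges (X v)), enc_table vs (\<lambda>v. enc_edges (U v)),
      enc_table vs (\<lambda>v. enc_edges (U' v))]
    (enc_table vs (\<lambda>v. enc_edges (combine X U U' v))) ((length vs + 1) * B^6)"
  using assms(4)
proof (induction vs)
  case Nil
  show ?case
    by (simp only: enc_simps, rule fn_intro, simp,
        (rule step | (simp; fail))+,
        use B_pows in \<open>auto simp: algebra_simps\<close>)
next
  case (Cons v vs)
  have v: "v \<in> V" "set vs \<subseteq> V" using Cons.prems by auto
  note t = edge_tableD[OF assms(1) v(1)] edge_tableD[OF assms(2) v(1)] edge_tableD[OF assms(3) v(1)]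
  show ?case
    by (simp only: enc_simps, rule fn_intro, simp,
        (rule step Cons.IH fn_cheaper fn_union | (simp add: t v; fail))+,
        use B_pows in \<open>auto simp: algebra_simps combine_def\<close>)
qed

lemma fn_combine:
  assumes "edge_table X" "edge_table U" "edge_table U'"
  shows "fn 22 [enc_etab X, enc_etab U, enc_etab U'] (enc_etab (combine X U U')) (B^7)"
  by (rule fn_mono[OF fn_combine_list pow_bounds(6)[OF length_vlist]])
    (simp_all add: assms set_vlist del: set_sorted_list_of_set)

section \<open>Correctness of the Dreyfus-Wagner recursion\<close>

abbreviation "c \<equiv> ccost I"

definition reaches :: "nat set \<Rightarrow> nat set \<Rightarrow> nat \<Rightarrow> bool" where
  "reaches F S v \<longleftrightarrow> (\<forall>s\<in>S. conn en F v s)"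

text \<open>The leader's edge set plays the role of the value infinity: it connects whatever can be
  connected at all, so tables need no entry for ``unreachable''.\<close>

definition sound :: "nat set \<Rightarrow> (nat \<Rightarrow> nat list) \<Rightarrow> bool" where
  "sound S U \<longleftrightarrow> edge_table U \<and> (\<forall>v\<in>V. reaches (leader I) S v \<longrightarrow> reaches (set (U v)) S v)"

text \<open>Competitors are counted by edges, so that one round of relaxation corresponds to one
  more edge.\<close>

definition optimal_upto :: "nat \<Rightarrow> nat set \<Rightarrow> (nat \<Rightarrow> nat list) \<Rightarrow> bool" where
  "optimal_upto r S U \<longleftrightarrow>
    (\<forall>v\<in>V. \<forall>Z\<subseteq>leader I. card Z \<le> r \<longrightarrow> reaches Z S v \<longrightarrow> cost (U v) \<le> sum c Z)"

definition steiner_table :: "nat set \<Rightarrow> (nat \<Rightarrow> nat list) \<Rightarrow> bool" where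
  "steiner_table S U \<longleftrightarrow> sound S U \<and> optimal_upto (card (leader I)) S U"

text \<open>The inequality of Dreyfus and Wagner at the root \<open>v\<close>, stated against all
  competitors instead of the tables of the two parts, and only as an upper bound, so that it
  survives every later decrease of costs.\<close>

definition merged :: "(nat list \<times> nat list) list \<Rightarrow> (nat \<Rightarrow> nat list) \<Rightarrow> bool" where
  "merged R U \<longleftrightarrow>
    (\<forall>A C v Y Z. (A, C) \<in> set R \<longrightarrow> A \<noteq> [] \<longrightarrow> C \<noteq> [] \<longrightarrow> v \<in> V \<longrightarrow>
      Y \<subseteq> leader I \<longrightarrow> Z \<subseteq> leader I \<longrightarrow> reaches Y (set A) v \<longrightarrow> reaches Z (set C) v \<longrightarrow>
      cost (U v) \<le> sum c Y + sum c Z)"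

lemma c_nonneg: "e \<in> E \<Longrightarrow> 0 \<le> c e"
  using inst by (simp add: bmst_instance_def)

lemma cost_eq_sum: "distinct es \<Longrightarrow> cost es = sum c (set es)"
  by (rule sum_list_distinct_conv_sum_set)

lemma cost_insert: "e \<in> E \<Longrightarrow> cost (List.insert e es) \<le> cost es + c e"
  using c_nonneg by (simp add: List.insert_def)

lemma sum_c_Un:
  assumes "finite Y" "finite Z" "Z \<subseteq> E"
  shows "sum c (Y \<union> Z) \<le> sum c Y + sum c Z"
proof -
  have "sum c (Y \<union> Z) = sum c Y + sum c Z - sum c (Y \<inter> Z)"
    using assms by (intro sum_Un) auto
  moreover have "0 \<le> sum c (Y \<inter> Z)" using assms c_nonneg by (intro sum_nonneg) auto
  ultimately show ?thesis by simp
qed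

lemma sum_c_mono: "Y \<subseteq> Z \<Longrightarrow> Z \<subseteq> E \<Longrightarrow> sum c Y \<le> sum c Z"
  using finite_subset[OF _ finite_E] c_nonneg by (intro sum_mono2) auto

lemma cost_union:
  assumes "distinct xs" "distinct ys" "set ys \<subseteq> E"
  shows "cost (List.union xs ys) \<le> cost xs + cost ys"
  using assms sum_c_Un[of "set xs" "set ys"] by (simp add: cost_eq_sum)

lemma finite_leader_subset: "Z \<subseteq> leader I \<Longrightarrow> finite Z"
  using finite_leader finite_subset by blast

lemma cheaper_cases: "cheaper xs ys = xs \<or> cheaper xs ys = ys"
  by (simp add: cheaper_def)

lemma cost_cheaper: "cost (cheaper xs ys) \<le> cost xs" "cost (cheaper xs ys) \<le> cost ys"
  by (simp_all add: cheaper_def)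

lemma reaches_mono: "F \<subseteq> G \<Longrightarrow> reaches F S v \<Longrightarrow> reaches G S v"
  unfolding reaches_def using conn_mono by metis

lemma reaches_step:
  "conn en F v u \<Longrightarrow> reaches F S u \<Longrightarrow> reaches F S v"
  unfolding reaches_def using conn_trans by metis

lemma reaches_Un: "reaches F (S \<union> T) v \<longleftrightarrow> reaches F S v \<and> reaches F T v"
  by (auto simp: reaches_def)

lemma sound_relax_dir:
  assumes U: "sound S U" and e: "e \<in> leader I" "en e = {a, b}" and ab: "a \<in> V" "b \<in> V"
  shows "sound S (relax_dir a b e U)"
  unfolding sound_def
proof (intro conjI ballI impI)
  show "edge_table (relax_dir a b e U)"
    using U e ab by (intro edge_table_relax_dir) (auto simp: sound_def)
  fix v assume v: "v \<in> V" "reaches (leader I) S v"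
  have Uv: "reaches (set (U v)) S v" using U v by (auto simp: sound_def)
  have "reaches (set (List.insert e (U b))) S a" if "v = a"
  proof -
    \<comment> \<open>Soundness of the entry at \<open>b\<close> can be used because
      \<open>b\<close> reaches the terminals through \<open>e\<close> whenever \<open>a\<close>
      does.\<close>
    have "conn en (leader I) b a" using e by (intro conn_edge) auto
    then have "reaches (leader I) S b" using v that reaches_step by metis
    then have "reaches (set (U b)) S b" using U ab by (auto simp: sound_def)
    then have "reaches (set (List.insert e (U b))) S b" by (rule reaches_mono[rotated]) auto
    moreover have "conn en (set (List.insert e (U b))) a b" using e by (intro conn_edge) auto
    ultimately show ?thesis using reaches_step by metis
  qed
  then show "reaches (set (relax_dir a b e U v)) S v"
    using Uv cheaper_cases[of "U a" "List.insert e (U b)"] by (auto simp: relax_dir_def)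
qed

lemma cost_relax_dir:
  assumes "e \<in> leader I"
  shows "cost (relax_dir a b e U v) \<le> cost (U v)"
    and "cost (relax_dir a b e U a) \<le> cost (U b) + c e"
proof -
  have "cost (List.insert e (U b)) \<le> cost (U b) + c e"
    using assms leader_E by (intro cost_insert) auto
  then show "cost (relax_dir a b e U v) \<le> cost (U v)"
    and "cost (relax_dir a b e U a) \<le> cost (U b) + c e"
    using cost_cheaper[of "U a" "List.insert e (U b)"] by (auto simp: relax_dir_def)
qed

lemma sound_relax: "sound S U \<Longrightarrow> e \<in> leader I \<Longrightarrow> sound S (relax e U)"
  unfolding relax_def using ends_E[of e] ends_V[of e] leader_E
  by (intro sound_relax_dir) auto

lemma cost_relax:
  assumes e: "e \<in> leader I"
  shows "cost (relax e U v) \<le> cost (U v)"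
    and "en e = {a, b} \<Longrightarrow> cost (relax e U a) \<le> cost (U b) + c e"
proof -
  let ?U = "relax_dir (fst_end e) (snd_end e) e U"
  have 1: "cost (relax e U v) \<le> cost (?U v)" for v
    unfolding relax_def by (rule cost_relax_dir(1)[OF e])
  have 2: "cost (?U v) \<le> cost (U v)" for v by (rule cost_relax_dir(1)[OF e])
  show "cost (relax e U v) \<le> cost (U v)" using 1 2 by (rule order_trans)
  have 3: "cost (relax e U (snd_end e)) \<le> cost (U (fst_end e)) + c e"
    using cost_relax_dir(2)[OF e, of "snd_end e" "fst_end e" ?U] 2[of "fst_end e"]
    by (simp add: relax_def)
  have 4: "cost (relax e U (fst_end e)) \<le> cost (U (snd_end e)) + c e"
    using cost_relax_dir(2)[OF e, of "fst_end e" "snd_end e" U] 1[of "fst_end e"] by simp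
  show "cost (relax e U a) \<le> cost (U b) + c e" if "en e = {a, b}"
  proof -
    have "{a, b} = {fst_end e, snd_end e}" using that ends_E[of e] e leader_E by auto
    then have "a = fst_end e \<and> b = snd_end e \<or> a = snd_end e \<and> b = fst_end e"
      by (auto simp: doubleton_eq_iff)
    then show ?thesis using 3 4 by auto
  qed
qed

lemma sound_fold_relax: "sound S U \<Longrightarrow> set es \<subseteq> leader I \<Longrightarrow> sound S (fold relax es U)"
  by (induction es arbitrary: U) (auto intro: sound_relax)

lemma cost_fold_relax:
  assumes "set es \<subseteq> leader I"
  shows "cost (fold relax es U v) \<le> cost (U v)"
    and "e \<in> set es \<Longrightarrow> en e = {a, b} \<Longrightarrow> cost (fold relax es U a) \<le> cost (U b) + c e"
proof -
  have dec: "cost (fold relax es U v) \<le> cost (U v)" if "set es \<subseteq> leader I" for es U v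
    using that
  proof (induction es arbitrary: U)
    case (Cons f es)
    have "cost (fold relax (f # es) U v) \<le> cost (relax f U v)" using Cons by simp
    also have "\<dots> \<le> cost (U v)" using Cons.prems by (intro cost_relax) simp
    finally show ?case .
  qed simp
  show "cost (fold relax es U v) \<le> cost (U v)" by (rule dec[OF assms])
  show "cost (fold relax es U a) \<le> cost (U b) + c e" if "e \<in> set es" "en e = {a, b}"
    using that assms
  proof (induction es arbitrary: U)
    case (Cons f es)
    show ?case
    proof (cases "e = f")
      case True
      then show ?thesis
        using cost_relax(2)[of e a b U] dec[of es "relax f U" a] Cons.prems by auto
    next
      case False
      then show ?thesis
        using Cons.IH[of "relax f U"] cost_relax(1)[of f U b] Cons.prems by auto
    qed
  qed simp
qed

lemma mergedD:
  assumes "merged R U" "(A, C) \<in> set R" "A \<noteq> []" "C \<noteq> []" "v \<in> V"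
    and "Y \<subseteq> leader I" "Z \<subseteq> leader I" "reaches Y (set A) v" "reaches Z (set C) v"
  shows "cost (U v) \<le> sum c Y + sum c Z"
  by (rule assms(1)[unfolded merged_def, rule_format]; fact)

text \<open>Cut an edge \<open>e\<close> from the root \<open>v\<close> to \<open>u\<close> out of a
  competitor \<open>Z\<close>. If \<open>v\<close> and \<open>u\<close> stay connected, the rest of
  \<open>Z\<close> does as well. Otherwise the terminals split by the component of \<open>u\<close>:
  if one side has none, the smaller edge set serves \<open>v\<close> directly, or serves
  \<open>u\<close> and is relaxed along \<open>e\<close>; if both have some, the two parts meet at
  \<open>v\<close> and \<open>merged\<close> applies.\<close>

lemma optimal_upto_Suc:
  assumes opt: "optimal_upto r (set S) U" and zero: "optimal_upto 0 (set S) U"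
    and mg: "merged (splits S) U"
  shows "optimal_upto (Suc r) (set S) (fold relax llist U)"
  unfolding optimal_upto_def
proof (intro ballI allI impI)
  fix v Z
  assume v: "v \<in> V" and Z: "Z \<subseteq> leader I" "card Z \<le> Suc r" and re: "reaches Z (set S) v"
  let ?U = "fold relax llist U"
  have le: "cost (?U v) \<le> cost (U v)" for v by (rule cost_fold_relax) (simp add: set_llist)
  have finZ: "finite Z" using Z finite_leader_subset by blast
  have ZE: "Z \<subseteq> E" using Z leader_E by auto
  show "cost (?U v) \<le> sum c Z"
  proof (cases "set S \<subseteq> {v}")
    case True
    then have "reaches {} (set S) v" by (auto simp: reaches_def)
    then have "cost (U v) \<le> sum c {}" using zero v unfolding optimal_upto_def by force
    also have "\<dots> \<le> sum c Z" using sum_c_mono[OF _ ZE] by blast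
    finally show ?thesis using le[of v] by simp
  next
    case False
    then obtain s where s: "s \<in> set S" "s \<noteq> v" by auto
    then have "conn en Z v s" using re by (auto simp: reaches_def)
    then obtain e u where e: "e \<in> Z" "en e = {v, u}"
      using s(2) conn_first_edge by metis
    have u: "u \<in> V" using e ZE inst unfolding bmst_instance_def by blast
    let ?Z = "Z - {e}"
    have sumZ: "sum c Z = c e + sum c ?Z" using finZ e by (simp add: sum.remove)
    have ce: "0 \<le> c e" using e ZE c_nonneg by auto
    have cardZ: "card ?Z \<le> r" using Z finZ e by simp
    have insZ: "insert e ?Z = Z" using e by auto
    have con: "conn en Z v x \<longleftrightarrow> conn en ?Z v x \<or> conn en ?Z v u \<and> conn en ?Z v x \<or>
        conn en ?Z u x" for x
      using conn_insert[of en e v u ?Z v x, OF e(2)] insZ conn_sym[of en ?Z]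
      by auto
    have IH: "cost (U x) \<le> sum c Y" if "x \<in> V" "Y \<subseteq> ?Z" "reaches Y (set S) x" for x Y
    proof -
      have "card Y \<le> r" using that cardZ finZ card_mono[of ?Z Y] by auto
      then show ?thesis using opt that Z unfolding optimal_upto_def by blast
    qed
    show ?thesis
    proof (cases "conn en ?Z v u")
      case True
      have "reaches ?Z (set S) v"
        using re con True conn_trans[of en ?Z v u] by (auto simp: reaches_def)
      then show ?thesis using IH[of v ?Z] v sumZ ce le[of v] by simp
    next
      case nvu: False
      let ?Zu = "component en ?Z u" and ?A = "filter (conn en ?Z u) S"
        and ?C = "filter (\<lambda>s. \<not> conn en ?Z u s) S"
      let ?Zv = "?Z - ?Zu"
      have sub: "?Zu \<subseteq> ?Z" by (rule component_subset)
      have sum: "sum c ?Z = sum c ?Zv + sum c ?Zu"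
        using finZ sub by (intro sum.subset_diff) auto
      have A: "reaches ?Zu (set ?A) u" using conn_component by (auto simp: reaches_def)
      have C: "reaches ?Zv (set ?C) v"
      proof -
        have "\<not> conn en ?Z u v" using nvu conn_sym by metis
        moreover have "conn en ?Z v x" if "x \<in> set S" "\<not> conn en ?Z u x" for x
          using re con[of x] that by (auto simp: reaches_def)
        ultimately show ?thesis
          using conn_minus_component[of en ?Z v _ u] by (auto simp: reaches_def)
      qed
      have nonneg: "0 \<le> sum c ?Zu" "0 \<le> sum c ?Zv"
        using sub ZE c_nonneg by (auto intro!: sum_nonneg)
      have AC: "(?A, ?C) \<in> set (splits S)" by (rule filter_splits)
      consider "?A = []" | "?C = []" | "?A \<noteq> []" "?C \<noteq> []" by blast
      then show ?thesis
      proof cases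
        case 1
        then have "set ?C = set S" by (auto simp: filter_empty_conv)
        then have "cost (U v) \<le> sum c ?Zv" using C by (intro IH v) auto
        then show ?thesis using le[of v] sumZ sum ce nonneg by simp
      next
        case 2
        then have "set ?A = set S" by (auto simp: filter_empty_conv)
        then have "cost (U u) \<le> sum c ?Zu" using A sub by (intro IH u) auto
        moreover have "cost (?U v) \<le> cost (U u) + c e"
          using e Z set_llist by (intro cost_fold_relax) auto
        ultimately show ?thesis using sumZ sum nonneg by simp
      next
        case 3
        \<comment> \<open>\<open>e\<close> is charged to the side of \<open>u\<close>, so that both
          parts are rooted at \<open>v\<close>.\<close>
        have "conn en (insert e ?Zu) v u" using e by (intro conn_edge) auto
        moreover have "reaches (insert e ?Zu) (set ?A) u" using A by (rule reaches_mono[rotated]) auto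
        ultimately have "reaches (insert e ?Zu) (set ?A) v" by (rule reaches_step)
        moreover have "insert e ?Zu \<subseteq> leader I" "?Zv \<subseteq> leader I" using e sub Z by auto
        ultimately have "cost (U v) \<le> sum c (insert e ?Zu) + sum c ?Zv"
          using C by (intro mergedD[OF mg AC 3 v])
        moreover have "sum c (insert e ?Zu) = c e + sum c ?Zu"
          using sub finZ finite_subset[OF sub] by (subst sum.insert) auto
        ultimately show ?thesis using le[of v] sumZ sum by simp
      qed
    qed
  qed
qed

lemma merged_mono:
  "merged R U \<Longrightarrow> (\<And>v. v \<in> V \<Longrightarrow> cost (U' v) \<le> cost (U v)) \<Longrightarrow> merged R U'"
  unfolding merged_def by (meson order_trans)

lemma optimal_upto_mono:
  "optimal_upto r S U \<Longrightarrow> (\<And>v. v \<in> V \<Longrightarrow> cost (U' v) \<le> cost (U v)) \<Longrightarrow> optimal_upto r S U'"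
  unfolding optimal_upto_def by (meson order_trans)

text \<open>After \<open>r\<close> rounds all competitors with at most \<open>r\<close> edges are
  matched, and none has more than \<open>card (leader I)\<close>. \<open>merged\<close> and
  \<open>optimal_upto 0\<close> persist because relaxation never raises a cost.\<close>

lemma steiner_table_rounds:
  assumes "sound (set S) U" "optimal_upto 0 (set S) U" "merged (splits S) U"
  shows "steiner_table (set S) ((fold relax llist ^^ card (leader I)) U)"
proof -
  have dec: "cost (fold relax llist U v) \<le> cost (U v)" for U v
    by (rule cost_fold_relax) (simp add: set_llist)
  have "sound (set S) ((fold relax llist ^^ r) U) \<and> optimal_upto 0 (set S) ((fold relax llist ^^ r) U)
    \<and> merged (splits S) ((fold relax llist ^^ r) U) \<and> optimal_upto r (set S) ((fold relax llist ^^ r) U)"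
    for r
  proof (induction r)
    case (Suc r)
    let ?U = "(fold relax llist ^^ r) U"
    have "sound (set S) (fold relax llist ?U)"
      using Suc by (intro sound_fold_relax) (auto simp: set_llist)
    moreover have "optimal_upto 0 (set S) (fold relax llist ?U)"
      using Suc dec by (blast intro: optimal_upto_mono)
    moreover have "merged (splits S) (fold relax llist ?U)"
      using Suc dec by (blast intro: merged_mono)
    moreover have "optimal_upto (Suc r) (set S) (fold relax llist ?U)"
      using Suc by (intro optimal_upto_Suc) auto
    ultimately show ?case by simp
  qed (use assms in simp)
  then show ?thesis by (simp add: steiner_table_def)
qed

lemma steiner_tableD:
  assumes "steiner_table S U" "v \<in> V" "Z \<subseteq> leader I" "reaches Z S v"
  shows "cost (U v) \<le> sum c Z" "reaches (set (U v)) S v"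
proof -
  have "card Z \<le> card (leader I)" using assms(3) finite_leader by (rule card_mono[rotated])
  then show "cost (U v) \<le> sum c Z"
    using assms unfolding steiner_table_def optimal_upto_def by blast
  have "reaches (leader I) S v" using assms(3,4) by (rule reaches_mono)
  then show "reaches (set (U v)) S v"
    using assms unfolding steiner_table_def sound_def by blast
qed

lemma steiner_edge_table: "steiner_table S U \<Longrightarrow> edge_table U"
  by (simp add: steiner_table_def sound_def)

lemma cost_combine: "cost (combine X U U' v) \<le> cost (X v)"
  by (simp add: combine_def cost_cheaper)

lemma merged_combine:
  assumes "steiner_table (set A) U" "steiner_table (set C) U'"
  shows "merged [(A, C)] (combine X U U')"
  unfolding merged_def
proof (intro allI impI)
  fix A' C' v Y Z
  assume "(A', C') \<in> set [(A, C)]" "v \<in> V" "Y \<subseteq> leader I" "Z \<subseteq> leader I"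
    "reaches Y (set A') v" "reaches Z (set C') v"
  then have 1: "cost (U v) \<le> sum c Y" "cost (U' v) \<le> sum c Z"
    using steiner_tableD(1)[OF assms(1)] steiner_tableD(1)[OF assms(2)] by auto
  note t = edge_tableD[OF steiner_edge_table[OF assms(1)] \<open>v \<in> V\<close>]
    edge_tableD[OF steiner_edge_table[OF assms(2)] \<open>v \<in> V\<close>]
  have "cost (combine X U U' v) \<le> cost (List.union (U v) (U' v))"
    by (simp add: combine_def cost_cheaper)
  also have "\<dots> \<le> cost (U v) + cost (U' v)" using t by (intro cost_union)
  finally show "cost (combine X U U' v) \<le> sum c Y + sum c Z" using 1 by simp
qed

lemma sound_combine:
  assumes X: "sound (set A \<union> set C) X"
    and U: "steiner_table (set A) U" and U': "steiner_table (set C) U'"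
  shows "sound (set A \<union> set C) (combine X U U')"
  unfolding sound_def edge_table_def
proof (intro conjI ballI impI)
  fix v assume v: "v \<in> V"
  note t = edge_tableD[OF steiner_edge_table[OF U] v] edge_tableD[OF steiner_edge_table[OF U'] v]
  have Xv: "distinct (X v)" "set (X v) \<subseteq> leader I" using X v by (auto simp: sound_def edge_table_def)
  have "combine X U U' v = X v \<or> combine X U U' v = List.union (U v) (U' v)"
    unfolding combine_def by (rule cheaper_cases)
  then show "distinct (combine X U U' v)" "set (combine X U U' v) \<subseteq> leader I" using t Xv by auto
  assume r: "reaches (leader I) (set A \<union> set C) v"
  then have "reaches (set (U v)) (set A) v" "reaches (set (U' v)) (set C) v"
    using steiner_tableD(2)[OF U v subset_refl] steiner_tableD(2)[OF U' v subset_refl]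
    by (auto simp: reaches_Un)
  then have "reaches (set (List.union (U v) (U' v))) (set A \<union> set C) v"
    using reaches_mono[of "set (U v)" "set (List.union (U v) (U' v))"]
      reaches_mono[of "set (U' v)" "set (List.union (U v) (U' v))"] by (auto simp: reaches_Un)
  moreover have "reaches (set (X v)) (set A \<union> set C) v" using X v r by (auto simp: sound_def)
  ultimately show "reaches (set (combine X U U' v)) (set A \<union> set C) v"
    using cheaper_cases[of "X v" "List.union (U v) (U' v)"] by (auto simp: combine_def)
qed

lemma merged_Cons: "merged [r] U \<Longrightarrow> merged R U \<Longrightarrow> merged (r # R) U"
  unfolding merged_def by (metis (no_types, lifting) list.set_intros(1) set_ConsD)

text \<open>\<open>Merge\<close> and \<open>Steiner\<close> are mutually recursive; the hypothesis
  \<open>steiner\<close> is the induction hypothesis of \<open>fn_steiner\<close>, and both parts of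
  a nontrivial split have at most \<open>n\<close> entries. Splits merged earlier stay merged since
  costs only decrease.\<close>

lemma fn_merge:
  assumes steiner: "\<And>A. A \<noteq> [] \<Longrightarrow> set A \<subseteq> V \<Longrightarrow> length A \<le> n \<Longrightarrow>
      \<exists>U. steiner_table (set A) U \<and> fn 24 [enc_inst, enc_nats A] (enc_etab U) (F * B^10)"
    and S: "set S \<subseteq> V" "length S = Suc n"
    and "sound (set S) X" and "set R \<subseteq> set (splits S)"
  shows "\<exists>U. sound (set S) U \<and> (\<forall>v. cost (U v) \<le> cost (X v)) \<and> merged R U \<and>
    fn 23 [enc_inst, enc_splits R, enc_etab X] (enc_etab U) ((length R + 1) * (2 * F * B^10 + B^10))"
  using assms(4,5)
proof (induction R arbitrary: X)
  case Nil
  have "fn 23 [enc_inst, enc_splits [], enc_etab X] (enc_etab X)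
      ((length ([] :: (nat list \<times> nat list) list) + 1) * (2 * F * B^10 + B^10))"
    by (simp only: enc_simps, rule fn_intro, simp,
        (rule step | (simp; fail))+,
        use B_pows in \<open>auto simp: algebra_simps\<close>)
  then show ?case using Nil by (auto simp: merged_def)
next
  case (Cons r R)
  obtain A C where r: "r = (A, C)" by force
  have AC: "set A \<union> set C = set S" "length A + length C = length S"
    using splitsD[of A C S] Cons.prems r by auto
  have R: "set R \<subseteq> set (splits S)" using Cons.prems by simp
  let ?inner = "IfCons (Head (Head (Var 1)))
            (IfCons (Tail (Head (Var 1)))
               (Combine (Var 2) (Steiner (Var 0) (Head (Head (Var 1))))
                  (Steiner (Var 0) (Tail (Head (Var 1)))))
               (Var 2))
            (Var 2)"
  let ?env = "\<lambda>A C. [enc_inst, Pair (Pair (enc_nats A) (enc_nats C)) (enc_splits R), enc_etab X]"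
  have "\<exists>X'. sound (set S) X' \<and> (\<forall>v. cost (X' v) \<le> cost (X v)) \<and> merged [(A, C)] X' \<and>
      evb (?env A C) ?inner (enc_etab X') (2 * F * B^10 + B^9)"
  proof (cases "A = [] \<or> C = []")
    case True
    have "evb (?env A C) ?inner (enc_etab X) (2 * F * B^10 + B^9)"
    proof (cases A)
      case A: Nil
      show ?thesis
        by (simp only: A enc_simps, rule evb_mono,
            (rule step)+,
            use B_pows in \<open>auto simp: algebra_simps\<close>)
    next
      case A: (Cons a A')
      then have C: "C = []" using True by simp
      show ?thesis
        by (simp only: A C enc_simps, rule evb_mono,
            (rule step)+,
            use B_pows in \<open>auto simp: algebra_simps\<close>)
    qed
    then show ?thesis using Cons.prems True by (intro exI[of _ X]) (auto simp: merged_def)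
  next
    case False
    then have len: "length A \<le> n" "length C \<le> n" using AC S by (cases A; cases C; simp)+
    from steiner[of A] len False S AC obtain U where
      U: "steiner_table (set A) U" "fn 24 [enc_inst, enc_nats A] (enc_etab U) (F * B^10)" by blast
    from steiner[of C] len False S AC obtain U' where
      U': "steiner_table (set C) U'" "fn 24 [enc_inst, enc_nats C] (enc_etab U') (F * B^10)" by blast
    obtain a A' d C' where AC': "A = a # A'" "C = d # C'" using False by (meson neq_Nil_conv)
    have X: "edge_table X" using Cons.prems by (simp add: sound_def)
    note fn = U(2)[unfolded AC' enc_simps] U'(2)[unfolded AC' enc_simps]
      fn_combine[OF X steiner_edge_table[OF U(1)] steiner_edge_table[OF U'(1)]]
    have "evb (?env A C) ?inner (enc_etab (combine X U U')) (2 * F * B^10 + B^9)"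
      by (simp only: AC' enc_simps, rule evb_mono,
          (rule step fn)+,
          use B_pows in \<open>auto simp: algebra_simps\<close>)
    moreover have "sound (set S) (combine X U U')"
      using sound_combine[OF _ U(1) U'(1)] Cons.prems AC by simp
    ultimately show ?thesis
      using cost_combine merged_combine[OF U(1) U'(1)] by blast
  qed
  then obtain X' where X': "sound (set S) X'" "\<And>v. cost (X' v) \<le> cost (X v)" "merged [r] X'"
    and inner: "evb (?env A C) ?inner (enc_etab X') (2 * F * B^10 + B^9)" by (auto simp: r)
  from Cons.IH[OF X'(1) R] obtain U where U: "sound (set S) U" "\<And>v. cost (U v) \<le> cost (X' v)"
    "merged R U" and fn: "fn 23 [enc_inst, enc_splits R, enc_etab X'] (enc_etab U)
      ((length R + 1) * (2 * F * B^10 + B^10))" by blast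
  have "fn 23 [enc_inst, enc_splits (r # R), enc_etab X] (enc_etab U)
      ((length (r # R) + 1) * (2 * F * B^10 + B^10))"
    by (simp only: r enc_simps prod.case, rule fn_intro, simp,
        (rule inner step fn | (simp; fail))+,
        use B_pows in \<open>auto simp: algebra_simps\<close>)
  moreover have "merged (r # R) U"
    using merged_mono[OF X'(3) U(2)] U(3) by (rule merged_Cons)
  moreover have "cost (U v) \<le> cost (X v)" for v using U(2) X'(2) by (rule order_trans)
  ultimately show ?case using U(1) by blast
qed

lemma fn_steiner:
  assumes "S \<noteq> []" "set S \<subseteq> V" "length S \<le> n"
  shows "\<exists>U. steiner_table (set S) U \<and> fn 24 [enc_inst, enc_nats S] (enc_etab U) (fpt n * B^10)"
  using assms
proof (induction n arbitrary: S)
  case 0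
  then show ?case by simp
next
  case (Suc n)
  show ?case
  proof (cases "length S \<le> n")
    case True
    have "fpt n * B ^ 10 \<le> fpt (Suc n) * B ^ 10" by (simp add: fpt_mono)
    then show ?thesis using Suc.IH[OF Suc.prems(1,2) True] by (blast intro: fn_mono)
  next
    case False
    then have len: "length S = Suc n" using Suc.prems by simp
    obtain s S' where S: "S = s # S'" using Suc.prems by (cases S) auto
    have s: "s \<in> V" "set S' \<subseteq> V" using S Suc.prems by auto
    \<comment> \<open>A single terminal \<open>s\<close> needs an entry of cost zero at
      \<open>s\<close> from the start: its splits are trivial, so merging contributes
      nothing.\<close>
    define X where "X = (if S' = [] then (\<lambda>_. llist)(s := []) else (\<lambda>_. llist))"
    have X: "sound (set S) X"
      using set_llist distinct_llist by (auto simp: sound_def edge_table_def X_def S reaches_def)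
    obtain U where U: "sound (set S) U" "\<And>v. cost (U v) \<le> cost (X v)" "merged (splits S) U"
      "fn 23 [enc_inst, enc_splits (splits S), enc_etab X] (enc_etab U)
        ((length (splits S) + 1) * (2 * fpt n * B^10 + B^10))"
      using fn_merge[OF Suc.IH Suc.prems(2) len X subset_refl] by blast
    define Q where "Q = 2 ^ (length S + 2) * B"
    have "1000 \<le> B" using B_W by simp
    note bounds = this B_pows(2-)
    define M where "M = (length (splits S) + 1) * (2 * fpt n * B^10 + B^10)"
    have "optimal_upto 0 (set S) U"
      unfolding optimal_upto_def
    proof (intro ballI allI impI)
      fix v Z assume v: "v \<in> V" and Z: "Z \<subseteq> leader I" "card Z \<le> 0" "reaches Z (set S) v"
      then have [simp]: "Z = {}" using finite_leader_subset by auto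
      show "cost (U v) \<le> sum c Z"
      proof (cases "S' = []")
        case True
        have "s = v" using Z conn_singleton_class[of "{}" v en s] S by (auto simp: reaches_def)
        then show ?thesis using U(2)[of v] True by (simp add: X_def)
      next
        \<comment> \<open>A list with several entries may still name a single vertex, as terminals
          can repeat. Merging the empty edge set with itself then gives cost zero.\<close>
        case False
        have "([s], S') \<in> set (splits S)"
          using filter_splits[of "\<lambda>_. False" S'] by (simp add: S set_distribute)
        from mergedD[OF U(3) this _ False v, of "{}" "{}"] show ?thesis
          using Z by (simp add: S reaches_def)
      qed
    qed
    from steiner_table_rounds[OF U(1) this U(3)]
    have st: "steiner_table (set S) ((fold relax llist ^^ card (leader I)) U)" .
    have tab: "enc_tab (\<lambda>_. enc_edges llist) = enc_etab (\<lambda>_. llist)" by simp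
    have init: "evb [enc_inst, enc_nats S] (IfCons (Tail (Var 1))
            (Constant (InstLeader (Var 0)) (InstVerts (Var 0)))
            (Update (Head (Var 1)) (Lit 0)
               (Constant (InstLeader (Var 0)) (InstVerts (Var 0))))) (enc_etab X) (B^3)"
    proof (cases S')
      case Nil
      have X: "enc_etab X = enc_tab ((\<lambda>_. enc_edges llist)(s := Num 0))"
        by (rule enc_table_cong) (simp add: X_def Nil)
      show ?thesis
        by (simp only: X S Nil enc_simps, rule evb_mono,
            (rule step fn_update fn_constant s)+,
            use B_pows in \<open>auto simp: algebra_simps\<close>)
    next
      case (Cons s' S'')
      have X: "enc_etab X = enc_tab (\<lambda>_. enc_edges llist)"
        by (simp add: X_def Cons)
      show ?thesis
        by (simp only: X S Cons enc_simps, rule evb_mono,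
            (rule step fn_update fn_constant s)+,
            use B_pows in \<open>auto simp: algebra_simps\<close>)
    qed
    \<comment> \<open>\<open>M\<close> is the time of \<open>Merge\<close> and \<open>Q\<close> that
      of \<open>Splits\<close>; the summand \<open>2 * B ^ 10\<close> absorbs \<open>Rounds\<close>
      and the initial table.\<close>
    have "((2 ^ Suc n + 1) * (2 * fpt n + 1) + 2 ^ (n + 3) + 2) * B ^ 10 \<le> fpt (Suc n) * B ^ 10"
      by (intro mult_le_mono1 fpt_step)
    moreover have "2 ^ (length S + 2) * B \<le> 2 ^ (n + 3) * B ^ 10"
      using len self_le_power[of B 10] B_W by (intro mult_le_mono) (auto simp: power_add)
    ultimately have time: "M + Q + 2 * B ^ 10 \<le> fpt (Suc n) * B ^ 10"
      by (simp add: M_def Q_def length_splits len algebra_simps)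
    note fn = U(4)[folded M_def] fn_splits[of S, folded Q_def] fn_rounds
    have edge: "edge_table U" using U by (simp add: sound_def)
    have "fn 24 [enc_inst, enc_nats S] (enc_etab ((fold relax llist ^^ card (leader I)) U))
        (fpt (Suc n) * B^10)"
      by (rule fn_intro, simp,
          (rule init edge step fn)+,
          simp,
          use bounds time in linarith)
    then show ?thesis using st by blast
  qed
qed

section \<open>Leader's choices as lists, and their objective values\<close>

definition leader_list :: "nat list \<Rightarrow> bool" where
  "leader_list X \<longleftrightarrow> distinct X \<and> set X \<subseteq> leader I"

lemma leader_listD: "leader_list X \<Longrightarrow> distinct X" "leader_list X \<Longrightarrow> set X \<subseteq> leader I"
  "leader_list X \<Longrightarrow> set X \<subseteq> E"
  using leader_E by (auto simp: leader_list_def)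

lemma leader_list_union: "leader_list X \<Longrightarrow> leader_list Z \<Longrightarrow> leader_list (List.union Z X)"
  by (auto simp: leader_list_def)

text \<open>The spanning forest restores cycle-freeness, which a union of Steiner trees and
  \<open>X\<close> may lack, and connects the same vertices as the union.\<close>

definition complete :: "nat list \<Rightarrow> nat list \<Rightarrow> nat list" where
  "complete X Z = select both en {} (List.union Z X)"

definition obj :: "nat list \<Rightarrow> real" where
  "obj X = cost X + cost (select both en (set X) (follower I))"

definition better :: "nat list \<Rightarrow> nat list \<Rightarrow> nat list" where
  "better X Y = (if obj Y < obj X then Y else X)"

lemma distinct_follower: "distinct (follower I)"
  and leader_follower: "leader I \<inter> set (follower I) = {}"
  using inst by (auto simp: bmst_instance_def)

lemma leader_list_complete: "leader_list X \<Longrightarrow> leader_list Z \<Longrightarrow> leader_list (complete X Z)"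
  using leader_list_union[of X Z] set_select[of "{}" "List.union Z X"]
  unfolding complete_def leader_list_def by (blast intro: distinct_select)

lemma fn_complete:
  assumes "leader_list X" "leader_list Z"
  shows "fn 25 [enc_inst, enc_edges X, enc_edges Z] (enc_edges (complete X Z)) (B^6)"
proof -
  note l = leader_listD[OF assms(1)] leader_listD[OF assms(2)]
    leader_listD[OF leader_list_union[OF assms]]
  note fn = fn_identity fn_union fn_select[OF labelling_empty, of "List.union Z X"]
  show ?thesis
    by (rule fn_intro, simp,
        (rule step fn | (simp add: l l[simplified]; fail))+,
        use B_pows in \<open>auto simp: algebra_simps complete_def\<close>)
qed

lemma select_follower:
  "distinct (select both en F (follower I))" "set (select both en F (follower I)) \<subseteq> set (follower I)"
  using distinct_follower by (simp_all add: distinct_select set_select)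

lemma fn_obj:
  assumes "leader_list X"
  shows "fn 26 [enc_inst, enc_edges X] (Num (obj X)) (B^6)"
proof -
  note l = leader_listD[OF assms]
  obtain l' where l': "labelling l' (set X)"
    and fn: "fn 5 [enc_tab enc_nat, enc_edges X] (enc_tab (\<lambda>v. enc_nat (l' v))) (B^5)"
    using fn_joins[OF labelling_empty l(3,1)] by auto
  have sel: "set (select both en (set X) (follower I)) \<subseteq> E"
    "distinct (select both en (set X) (follower I))"
    using select_follower follower_E by auto
  note fn = fn fn_identity fn_select[OF l' follower_E distinct_follower] fn_total
  show ?thesis
    by (rule fn_intro, simp,
        (rule step fn | (simp add: l sel small_cost; fail))+,
        use B_pows in \<open>auto simp: algebra_simps obj_def\<close>)
qed

text \<open>Leader's and follower's edges are disjoint, so the objective value is the cost of a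
  single duplicate-free list.\<close>

lemma small_obj:
  assumes "leader_list X"
  shows "small (obj X)"
proof -
  have "small (cost (X @ select both en (set X) (follower I)))"
    using leader_listD[OF assms] select_follower[of "set X"] leader_follower follower_E
    by (intro small_cost) auto
  then show ?thesis by (simp add: obj_def)
qed

lemma fn_better:
  assumes "leader_list X" "leader_list Y"
  shows "fn 27 [enc_inst, enc_edges X, enc_edges Y] (enc_edges (better X Y)) (B^7)"
  unfolding better_def
  by (rule fn_intro, simp,
      (rule step fn_obj | (simp add: assms small_obj; fail))+,
      use B_pows in \<open>auto simp: algebra_simps\<close>)

text \<open>End vertices shared by several edges are listed repeatedly; the Steiner tables allow for
  repeated terminals.\<close>

definition terminals :: "nat list \<Rightarrow> nat list" where
  "terminals es = concat (map (\<lambda>e. [fst_end e, snd_end e]) es)"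

lemma length_terminals: "length (terminals es) = 2 * length es"
  by (induction es) (auto simp: terminals_def)

lemma set_terminals: "set (terminals es) = (\<Union>e\<in>set es. {fst_end e, snd_end e})"
  by (auto simp: terminals_def)

lemma fn_terminals: "fn 30 [enc_edges es] (enc_nats (terminals es)) ((length es + 1) * B)"
proof (induction es)
  case Nil
  show ?case
    by (simp only: enc_simps terminals_def concat.simps, rule fn_intro, simp,
        (rule step | (simp; fail))+,
        use B_pows in \<open>auto simp: algebra_simps\<close>)
next
  case (Cons e es)
  have t: "terminals (e # es) = fst_end e # snd_end e # terminals es" by (simp add: terminals_def)
  show ?case
    by (simp only: t enc_simps, rule fn_intro, simp,
        (rule step Cons.IH | (simp; fail))+,
        use B_pows in \<open>auto simp: algebra_simps\<close>)
qed

lemma fn_names: "fn 31 [enc_edges es] (enc_edge_names es) ((length es + 1) * B)"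
proof (induction es)
  case Nil
  show ?case
    by (simp only: enc_edge_names_def enc_simps, rule fn_intro, simp,
        (rule step | (simp; fail))+,
        use B_pows in \<open>auto simp: algebra_simps\<close>)
next
  case (Cons e es)
  show ?case
    by (simp only: enc_edge_names_def enc_simps, rule fn_intro, simp,
        (rule step Cons.IH[unfolded enc_edge_names_def] | (simp; fail))+,
        use B_pows in \<open>auto simp: algebra_simps\<close>)
qed

subsection \<open>Exhaustive search over the partitions of the terminals\<close>

text \<open>\<open>T\<close> are the terminals still to be distributed and \<open>Z\<close> the
  edges bought so far. \<open>Z'\<close> is what the search has bought at the leaf reached by
  following the partition of \<open>T\<close> that \<open>H\<close> induces; the additional
  purchases are paid for by \<open>H\<close>.\<close>

definition good :: "nat list \<Rightarrow> nat set \<Rightarrow> nat list \<Rightarrow> nat set \<Rightarrow> nat list \<Rightarrow> bool" where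
  "good X T Z H R \<longleftrightarrow>
    (\<exists>Z'. leader_list Z' \<and> set Z \<subseteq> set Z' \<and> cost Z' \<le> cost Z + sum c H \<and>
      (\<forall>s\<in>T. \<forall>t\<in>T. conn en H s t \<longrightarrow> conn en (set Z') s t) \<and> obj R \<le> obj (complete X Z'))"

definition solution :: "nat list \<Rightarrow> bool" where
  "solution X \<longleftrightarrow> leader_list X \<and> feasible I (set X)"

lemma good_mono: "good X T Z H R \<Longrightarrow> obj R' \<le> obj R \<Longrightarrow> good X T Z H R'"
  unfolding good_def by (meson order_trans)

text \<open>The component of \<open>t\<close> in \<open>H\<close> is a competitor for the Steiner
  tree of the block and pays for it; the rest of \<open>H\<close> pays for the remaining search and
  still connects the terminals of \<open>C\<close> as \<open>H\<close> does. Terminals within the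
  block are connected through \<open>t\<close>.\<close>

lemma good_block:
  assumes U: "steiner_table (set (t # A)) U" and t: "t \<in> V" and H: "H \<subseteq> leader I"
    and A: "reaches H (set A) t" and C: "\<And>s. s \<in> set C \<Longrightarrow> \<not> conn en H t s"
    and Z: "leader_list Z"
    and good: "good X (set C) (List.union (U t) Z) (H - component en H t) R"
  shows "good X (insert t (set A \<union> set C)) Z H R"
proof -
  let ?Ht = "component en H t"
  note Ut = edge_tableD[OF steiner_edge_table[OF U] t]
  from good obtain Z' where Z': "leader_list Z'" "set (List.union (U t) Z) \<subseteq> set Z'"
    "cost Z' \<le> cost (List.union (U t) Z) + sum c (H - ?Ht)"
    "\<And>s s'. s \<in> set C \<Longrightarrow> s' \<in> set C \<Longrightarrow> conn en (H - ?Ht) s s' \<Longrightarrow> conn en (set Z') s s'"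
    "obj R \<le> obj (complete X Z')"
    unfolding good_def by blast
  have sub: "?Ht \<subseteq> H" by (rule component_subset)
  have reach: "reaches ?Ht (set (t # A)) t" using A by (auto simp: reaches_def intro: conn_component)
  have "?Ht \<subseteq> leader I" using sub H by blast
  note Ut' = steiner_tableD[OF U t this reach]
  have "cost Z' \<le> cost (U t) + cost Z + sum c (H - ?Ht)"
    using Z'(3) cost_union[OF Ut(1) leader_listD(1,3)[OF Z]] by simp
  also have "\<dots> \<le> cost Z + sum c H"
    using Ut'(1) sum.subset_diff[OF sub finite_leader_subset[OF H], of c] by simp
  finally have cost: "cost Z' \<le> cost Z + sum c H" .
  have tZ: "conn en (set Z') t s" if "s = t \<or> s \<in> set A" for s
  proof -
    have "conn en (set (U t)) t s" using Ut'(2) that by (auto simp: reaches_def)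
    then show ?thesis by (rule conn_mono[rotated]) (use Z'(2) in auto)
  qed
  have tH: "conn en H t s" if "s = t \<or> s \<in> set A" for s
    using that A by (auto simp: reaches_def)
  have "conn en (set Z') s s'"
    if s: "s \<in> insert t (set A \<union> set C)" and s': "s' \<in> insert t (set A \<union> set C)"
      and con: "conn en H s s'" for s s'
  proof (cases "conn en H t s")
    case True
    then have "conn en H t s'" using con conn_trans by metis
    then have "s = t \<or> s \<in> set A" "s' = t \<or> s' \<in> set A" using True s s' C by auto
    then show ?thesis using tZ conn_trans conn_sym by metis
  next
    case False
    then have "\<not> conn en H t s'" using con conn_trans conn_sym by metis
    then have "s \<in> set C" "s' \<in> set C" using False s s' tH by auto
    then show ?thesis using Z'(4) conn_minus_component[OF con False] by blast
  qed
  then show ?thesis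
    unfolding good_def using Z'(1,2,5) cost by (intro exI[of _ Z']) auto
qed

lemma better_props:
  "obj (better X Y) \<le> obj X" "obj (better X Y) \<le> obj Y"
  "solution X \<Longrightarrow> solution Y \<Longrightarrow> solution (better X Y)"
  by (simp_all add: better_def)

text \<open>The order of quantifiers matters: \<open>R\<close> is the output of the program and must
  serve every \<open>H\<close> at once.\<close>

definition search_result :: "nat list \<Rightarrow> nat list \<Rightarrow> nat list \<Rightarrow> nat list \<Rightarrow> nat \<Rightarrow> bool" where
  "search_result X T Z best F \<longleftrightarrow>
    (\<exists>R. solution R \<and> obj R \<le> obj best \<and> (\<forall>H\<subseteq>leader I. good X (set T) Z H R) \<and>
      fn 28 [enc_inst, enc_edges X, enc_nats T, enc_edges Z, enc_edges best] (enc_edges R) F)"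

definition search_spec :: "nat list \<Rightarrow> nat \<Rightarrow> nat \<Rightarrow> bool" where
  "search_spec X n F \<longleftrightarrow>
    (\<forall>T Z best. length T \<le> n \<longrightarrow> set T \<subseteq> V \<longrightarrow> leader_list Z \<longrightarrow> solution best \<longrightarrow>
      search_result X T Z best F)"

text \<open>The part of the guarantee owed to the splits in \<open>Rs\<close>: it concerns those
  \<open>H\<close> for which some split separates the block of \<open>t\<close> from the other
  terminals.\<close>

definition covers ::
    "nat list \<Rightarrow> nat \<Rightarrow> nat list \<Rightarrow> nat list \<Rightarrow> (nat list \<times> nat list) list \<Rightarrow> nat list \<Rightarrow> bool" where
  "covers X t ts Z Rs R \<longleftrightarrow>
    (\<forall>A C H. (A, C) \<in> set Rs \<longrightarrow> H \<subseteq> leader I \<longrightarrow> reaches H (set A) t \<longrightarrow>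
      (\<forall>s\<in>set C. \<not> conn en H t s) \<longrightarrow> good X (insert t (set ts)) Z H R)"

lemma coversD:
  assumes "covers X t ts Z Rs R" "(A, C) \<in> set Rs" "H \<subseteq> leader I" "reaches H (set A) t"
    and "\<forall>s\<in>set C. \<not> conn en H t s"
  shows "good X (insert t (set ts)) Z H R"
  by (rule assms(1)[unfolded covers_def, rule_format]) (use assms in auto)

text \<open>The Steiner call has at most \<open>Suc n\<close> terminals including \<open>t\<close>,
  the recursive search at most \<open>n\<close>. Charging the search \<open>fpt (Suc n)\<close> as
  well gives two calls of equal price per split, the shape required by \<open>fpt_step\<close>.
  Later splits only improve the best choice, so \<open>good\<close> persists.\<close>

lemma fn_search_block:
  assumes spec: "search_spec X n (fpt (Suc n) * B^11)"
    and t: "t \<in> V" "set ts \<subseteq> V" "length ts \<le> n"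
    and Z: "leader_list Z" and "solution best" and "set Rs \<subseteq> set (splits ts)"
  shows "\<exists>R. solution R \<and> obj R \<le> obj best \<and> covers X t ts Z Rs R \<and>
    fn 29 [enc_inst, enc_edges X, enc_nat t, enc_splits Rs, enc_edges Z, enc_edges best] (enc_edges R)
      ((length Rs + 1) * (2 * fpt (Suc n) * B^11 + B^11))"
  using assms(6,7)
proof (induction Rs arbitrary: best)
  case Nil
  have "fn 29 [enc_inst, enc_edges X, enc_nat t, enc_splits [], enc_edges Z, enc_edges best]
      (enc_edges best)
      ((length ([] :: (nat list \<times> nat list) list) + 1) * (2 * fpt (Suc n) * B^11 + B^11))"
    by (simp only: enc_simps, rule fn_intro, simp,
        (rule step | (simp; fail))+,
        use B_pows in \<open>auto simp: algebra_simps\<close>)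
  then show ?case using Nil by (auto simp: covers_def)
next
  case (Cons r Rs)
  obtain A C where r: "r = (A, C)" by force
  have AC: "set A \<union> set C = set ts" "length A + length C = length ts"
    using splitsD[of A C ts] Cons.prems r by auto
  have tA: "set (t # A) \<subseteq> V" "length (t # A) \<le> Suc n" using AC t by auto
  have C: "set C \<subseteq> V" "length C \<le> n" using AC t by auto
  obtain U where U: "steiner_table (set (t # A)) U"
    and fn_U: "fn 24 [enc_inst, enc_nats (t # A)] (enc_etab U) (fpt (Suc n) * B^10)"
    using fn_steiner[OF _ tA] by blast
  note Ut = edge_tableD[OF steiner_edge_table[OF U] t(1)]
  have ZU: "leader_list (List.union (U t) Z)"
    using Z Ut by (auto simp: leader_list_def)
  from spec[unfolded search_spec_def, rule_format, OF C(2,1) ZU Cons.prems(1)] obtain S where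
    S: "solution S" "obj S \<le> obj best"
    "\<And>H. H \<subseteq> leader I \<Longrightarrow> good X (set C) (List.union (U t) Z) H S"
    and fn_S: "fn 28 [enc_inst, enc_edges X, enc_nats C, enc_edges (List.union (U t) Z),
      enc_edges best] (enc_edges S) (fpt (Suc n) * B^11)"
    unfolding search_result_def by blast
  have Rs: "set Rs \<subseteq> set (splits ts)" using Cons.prems by simp
  from Cons.IH[OF S(1) Rs] obtain R where R: "solution R" "obj R \<le> obj S"
    and cov: "covers X t ts Z Rs R"
    and fn_R: "fn 29 [enc_inst, enc_edges X, enc_nat t, enc_splits Rs, enc_edges Z, enc_edges S]
      (enc_edges R) ((length Rs + 1) * (2 * fpt (Suc n) * B^11 + B^11))" by blast
  have good_r: "good X (insert t (set ts)) Z H R"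
    if H: "H \<subseteq> leader I" "reaches H (set A) t" "\<forall>s\<in>set C. \<not> conn en H t s" for H
  proof -
    have "good X (set C) (List.union (U t) Z) (H - component en H t) S" using H by (intro S) auto
    then have "good X (insert t (set A \<union> set C)) Z H S"
      using H by (intro good_block[OF U t(1) _ _ _ Z]) auto
    then show ?thesis using R(2) AC good_mono by metis
  qed
  have fp: "fpt (Suc n) * B^10 \<le> fpt (Suc n) * B^11" using B_pows by (intro mult_le_mono2) linarith
  note fn = fn_mono[OF fn_U fp, unfolded enc_simps] fn_R fn_S fn_lookup[OF t(1)] fn_union
  have "fn 29 [enc_inst, enc_edges X, enc_nat t, enc_splits (r # Rs), enc_edges Z, enc_edges best]
      (enc_edges R) ((length (r # Rs) + 1) * (2 * fpt (Suc n) * B^11 + B^11))"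
    by (simp only: r enc_simps prod.case, rule fn_intro, simp,
        (rule step fn | (simp add: Ut leader_listD[OF Z]; fail))+,
        use B_pows in \<open>auto simp: algebra_simps\<close>)
  moreover have "obj R \<le> obj best" using R S by simp
  moreover have "covers X t ts Z (r # Rs) R"
    using cov good_r unfolding covers_def r by auto
  ultimately show ?case using R(1) by blast
qed

lemma search_spec:
  assumes X: "leader_list X" and complete: "\<And>Z. leader_list Z \<Longrightarrow> solution (complete X Z)"
  shows "search_spec X n (fpt (Suc n) * B^11)"
proof -
  have B8: "B^8 \<le> fpt m * B^11" for m
  proof -
    have "1 * B^8 \<le> fpt m * B^11" using B_pows fpt_pos[of m] by (intro mult_le_mono) linarith+
    then show ?thesis by simp
  qed
  have base: "search_result X [] Z best (fpt m * B^11)"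
    if Z: "leader_list Z" "solution best" for Z best m
    unfolding search_result_def
  proof (intro exI conjI allI impI)
    let ?R = "better best (complete X Z)"
    show "solution ?R" "obj ?R \<le> obj best"
      using Z complete by (auto intro: better_props)
    \<comment> \<open>The witness is \<open>Z\<close> itself: no terminals remain to be connected,
      and \<open>sum c H\<close> is nonnegative.\<close>
    show "good X (set []) Z H ?R" if "H \<subseteq> leader I" for H
    proof -
      have "0 \<le> sum c H" using that leader_E c_nonneg by (intro sum_nonneg) auto
      then show ?thesis using Z better_props(2) unfolding good_def by (intro exI[of _ Z]) auto
    qed
    have l: "leader_list best" "leader_list (complete X Z)"
      using Z X leader_list_complete by (auto simp: solution_def)
    show "fn 28 [enc_inst, enc_edges X, enc_nats [], enc_edges Z, enc_edges best]
        (enc_edges ?R) (fpt m * B^11)"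
      by (rule fn_mono[OF _ B8],
          simp only: enc_simps, rule fn_intro, simp,
          (rule step fn_better fn_complete X Z l | (simp; fail))+,
          use B_pows in \<open>auto simp: algebra_simps\<close>)
  qed
  show ?thesis
  proof (induction n)
    case 0
    then show ?case using base[of _ _ "Suc 0"] by (simp add: search_spec_def)
  next
    case (Suc n)
    show ?case
      unfolding search_spec_def
    proof (intro allI impI)
      fix T Z best
      assume T: "length T \<le> Suc n" "set T \<subseteq> V" and Z: "leader_list Z" and best: "solution best"
      show "search_result X T Z best (fpt (Suc (Suc n)) * B^11)"
      proof (cases T)
        case Nil
        then show ?thesis using base[OF Z best] by simp
      next
        case (Cons t ts)
        then have ts: "t \<in> V" "set ts \<subseteq> V" "length ts \<le> n" using T by auto
        define M where "M = (length (splits ts) + 1) * (2 * fpt (Suc n) * B^11 + B^11)"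
        define Q where "Q = 2 ^ (length ts + 2) * B"
        obtain R where R: "solution R" "obj R \<le> obj best"
          and cov: "covers X t ts Z (splits ts) R"
          and fn_R: "fn 29 [enc_inst, enc_edges X, enc_nat t, enc_splits (splits ts), enc_edges Z,
            enc_edges best] (enc_edges R) M"
          using fn_search_block[OF Suc.IH ts Z best subset_refl, folded M_def] by (elim exE conjE)
        \<comment> \<open>The terminals connected to \<open>t\<close> in \<open>H\<close> form one
          of the splits, so the exhaustive list covers every \<open>H\<close>.\<close>
        have good_T: "good X (set T) Z H R" if H: "H \<subseteq> leader I" for H
        proof -
          have "good X (insert t (set ts)) Z H R"
            by (rule coversD[OF cov filter_splits[of "conn en H t" ts] H]) (simp_all add: reaches_def)
          then show ?thesis by (simp add: Cons)
        qed
        have pow: "(2::nat) ^ length ts \<le> 2 ^ Suc (Suc n)" using ts by (intro power_increasing) auto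
        have "M \<le> (2 ^ Suc (Suc n) + 1) * (2 * fpt (Suc n) * B^11 + B^11)"
          unfolding M_def length_splits by (intro mult_le_mono1 add_le_mono1 pow)
        moreover have "Q \<le> 2 ^ (Suc n + 3) * B ^ 11"
        proof -
          have "Q \<le> 2 ^ (length ts + 2) * B ^ 11"
            unfolding Q_def using self_le_power[of B 11] B_W by (intro mult_le_mono2) auto
          also have "(2::nat) ^ (length ts + 2) \<le> 2 ^ (Suc n + 3)" using ts by (intro power_increasing) auto
          finally show ?thesis by simp
        qed
        moreover have "((2 ^ Suc (Suc n) + 1) * (2 * fpt (Suc n) + 1) + 2 ^ (Suc n + 3) + 2) * B ^ 11
            \<le> fpt (Suc (Suc n)) * B ^ 11"
          by (intro mult_le_mono1 fpt_step)
        ultimately have time: "M + Q + 2 * B ^ 11 \<le> fpt (Suc (Suc n)) * B ^ 11"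
          by (simp add: algebra_simps)
        have "1000 \<le> B" using B_W by simp
        note bounds = this B_pows(2-)
        have "fn 28 [enc_inst, enc_edges X, enc_nats T, enc_edges Z, enc_edges best] (enc_edges R)
            (fpt (Suc (Suc n)) * B^11)"
          by (simp only: Cons enc_simps, rule fn_intro, simp,
              (rule step fn_R fn_splits[of ts, folded Q_def] | (simp; fail))+,
              use bounds time in linarith)
        then show ?thesis using R good_T unfolding search_result_def by blast
      qed
    qed
  qed
qed

subsection \<open>The approximation guarantee\<close>

text \<open>The set \<open>M\<close> of the overview: Kruskal's algorithm after contracting the
  follower's edges.\<close>

definition backbone :: "nat list" where
  "backbone = select both en (set (follower I)) (sort_key c llist)"

lemma sorted_leader: "set (sort_key c llist) = leader I" "distinct (sort_key c llist)"
  "set (sort_key c llist) \<subseteq> E"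
  using set_llist distinct_llist leader_E by auto

lemma leader_list_backbone: "leader_list backbone"
  using set_select[of "set (follower I)" "sort_key c llist"] sorted_leader
  by (auto simp: leader_list_def backbone_def intro: distinct_select)

lemma conn_V: "u \<in> V \<Longrightarrow> v \<in> V \<Longrightarrow> conn en E u v"
  using inst by (simp add: bmst_instance_def connected_graph_iff)

lemma feasibleD:
  assumes "feasible I X"
  shows "X \<subseteq> leader I" "cycle_free en X" "u \<in> V \<Longrightarrow> v \<in> V \<Longrightarrow> conn en (X \<union> set (follower I)) u v"
  using assms by (auto simp: feasible_def leader_choice_def connected_graph_iff)

text \<open>A feasible choice connects the graph together with the follower's edges, which makes it
  a competitor for Kruskal's algorithm.\<close>

lemma cost_backbone:
  assumes "feasible I X"
  shows "cost backbone \<le> sum c X"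
proof -
  have "sum c (set backbone) \<le> sum c X"
    unfolding backbone_def
  proof (rule select_sorted_minimal[OF sorted_leader(3)])
    show "sorted (map c (sort_key c llist))" by simp
    show "distinct (sort_key c llist)" by (rule sorted_leader)
    show "0 \<le> c e" if "e \<in> set (sort_key c llist)" for e
      using that sorted_leader leader_E c_nonneg by auto
    show "X \<subseteq> set (sort_key c llist)" using feasibleD(1)[OF assms] sorted_leader by simp
    show "conn en (set (follower I) \<union> X) (fst (both e)) (snd (both e))"
      if "e \<in> set (sort_key c llist)" for e
    proof -
      have "e \<in> E" using that sorted_leader by blast
      from feasibleD(3)[OF assms, of "fst_end e" "snd_end e"] ends_V[OF this]
      show ?thesis by (simp add: Un_commute)
    qed
  qed
  then show ?thesis using leader_list_backbone by (simp add: cost_eq_sum leader_list_def)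
qed

lemma conn_complete:
  assumes "leader_list Z"
  shows "conn en (set (complete backbone Z)) u v \<longleftrightarrow> conn en (set Z \<union> set backbone) u v"
  using conn_select[of "List.union Z backbone" "{}" u v]
    leader_listD(3)[OF leader_list_union[OF leader_list_backbone assms]]
  by (simp add: complete_def)

text \<open>Connectedness is due to the backbone and the follower's edges, whatever \<open>Z\<close>
  is; hence every candidate met by the search is feasible.\<close>

lemma solution_complete:
  assumes Z: "leader_list Z"
  shows "solution (complete backbone Z)"
proof -
  let ?C = "complete backbone Z"
  note l = leader_list_complete[OF leader_list_backbone Z]
  note un = leader_list_union[OF leader_list_backbone Z]
  have "cycle_free en ({} \<union> set ?C)"
    unfolding complete_def using leader_listD[OF un]
    by (intro cycle_free_select) (auto simp: cycle_free_empty)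
  moreover have "conn en (set ?C \<union> set (follower I)) u v" if "u \<in> V" "v \<in> V" for u v
  proof -
    have C: "conn en (set ?C \<union> set (follower I)) x y" if "conn en (set backbone) x y" for x y
    proof -
      have "conn en (set Z \<union> set backbone) x y" using that by (rule conn_mono[rotated]) auto
      then have "conn en (set ?C) x y" by (simp add: conn_complete[OF Z])
      then show ?thesis by (rule conn_mono[rotated]) auto
    qed
    have "conn en (set (follower I) \<union> leader I) u v"
      using conn_V[OF that] by (simp add: edges_def Un_commute)
    then have "conn en (set (follower I) \<union> set backbone) u v"
      unfolding backbone_def using conn_select[OF sorted_leader(3)] sorted_leader(1) by simp
    then show ?thesis
    proof (rule conn_span[rotated])
      fix e x y assume e: "e \<in> set (follower I) \<union> set backbone" "en e = {x, y}"
      show "conn en (set ?C \<union> set (follower I)) x y"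
      proof (cases "e \<in> set (follower I)")
        case True
        then show ?thesis using e by (intro conn_edge) auto
      next
        case False
        then show ?thesis using e by (intro C conn_edge) auto
      qed
    qed
  qed
  moreover have "V \<noteq> {}" using inst by (simp add: bmst_instance_def connected_graph_def)
  ultimately show ?thesis
    using l by (simp add: solution_def feasible_def leader_choice_def connected_graph_iff leader_list_def)
qed

lemma response_eq:
  assumes "feasible I X"
  shows "response I X = set (select both en X (follower I))"
proof -
  have "set (follower I) \<inter> (X \<union> {}) = {}" "cycle_free en (X \<union> {})"
    using feasibleD[OF assms] leader_follower by auto
  from foldl_select[OF follower_E distinct_follower this] show ?thesis
    by (simp add: response_def)
qed

lemma objective_eq:
  assumes "feasible I X"
  shows "objective I X = sum c X + sum c (response I X)"
proof -
  have "response I X \<subseteq> set (follower I)"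
    by (simp add: response_eq[OF assms] select_follower)
  moreover have "X \<subseteq> leader I" using feasibleD[OF assms] by simp
  ultimately show ?thesis
    unfolding objective_def using leader_follower finite_leader_subset
    by (intro sum.union_disjoint) (auto intro: finite_subset)
qed

lemma objective_solution: "solution X \<Longrightarrow> objective I (set X) = obj X"
  by (simp add: solution_def objective_eq obj_def cost_eq_sum leader_list_def response_eq
      select_follower)

text \<open>The response can only shrink: every follower edge rejected against \<open>H\<close> has its end vertices
  connected by \<open>H\<close> and earlier follower edges, and \<open>Z'\<close> connects the terminals at least as well
  as \<open>H\<close>.\<close>

lemma good_approx:
  assumes H: "feasible I H" and good: "good backbone (set (terminals (follower I))) [] H R"
  shows "obj R \<le> 2 * objective I H"
proof -
  let ?T = "set (terminals (follower I))"
  obtain Z where Z: "leader_list Z" "cost Z \<le> sum c H" "obj R \<le> obj (complete backbone Z)"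
    and con: "\<And>s t. s \<in> ?T \<Longrightarrow> t \<in> ?T \<Longrightarrow> conn en H s t \<Longrightarrow> conn en (set Z) s t"
    using good unfolding good_def by auto
  let ?C = "complete backbone Z"
  have "set (select both en (set ?C) (follower I)) \<subseteq> set (select both en H (follower I))"
  proof (rule select_antimono[OF follower_E])
    fix es1 e es2
    assume f: "follower I = es1 @ e # es2"
      and c: "conn en (H \<union> set es1) (fst (both e)) (snd (both e))"
    have es1: "en f \<subseteq> ?T" if "f \<in> set es1" for f
    proof -
      have "f \<in> set (follower I)" using that f by simp
      then show ?thesis using ends_E[of f] follower_E by (auto simp: set_terminals)
    qed
    have "e \<in> set (follower I)" using f by simp
    then have e: "fst (both e) \<in> ?T" "snd (both e) \<in> ?T" by (auto simp: set_terminals)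
    \<comment> \<open>Follower's edges run between terminals only, so \<open>H\<close> may be
      replaced by \<open>Z\<close> in the presence of \<open>es1\<close>.\<close>
    have "conn en (set Z \<union> set es1) (fst (both e)) (snd (both e))"
      by (rule conn_terminals[OF con es1 e c])
    then show "conn en (set ?C \<union> set es1) (fst (both e)) (snd (both e))"
    proof (rule conn_span[rotated])
      fix g x y assume g: "g \<in> set Z \<union> set es1" "en g = {x, y}"
      show "conn en (set ?C \<union> set es1) x y"
      proof (cases "g \<in> set es1")
        case True
        then show ?thesis using g by (intro conn_edge) auto
      next
        case False
        then have "conn en (set Z \<union> set backbone) x y" using g by (intro conn_edge) auto
        then have "conn en (set ?C) x y" by (simp add: conn_complete[OF Z(1)])
        then show ?thesis by (rule conn_mono[rotated]) auto
      qed
    qed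
  qed
  then have "sum c (set (select both en (set ?C) (follower I))) \<le> sum c (response I H)"
    unfolding response_eq[OF H]
    by (rule sum_c_mono) (rule order_trans[OF select_follower(2) follower_E])
  moreover have "sum c (set ?C) \<le> sum c (set (List.union Z backbone))"
    unfolding complete_def
    using leader_listD[OF leader_list_union[OF leader_list_backbone Z(1)]]
    by (intro sum_c_mono set_select) auto
  moreover have "cost (List.union Z backbone) \<le> cost Z + cost backbone"
    using leader_listD[OF Z(1)] leader_listD[OF leader_list_backbone] by (intro cost_union)
  moreover have "cost backbone \<le> sum c H" by (rule cost_backbone[OF H])
  moreover have "obj ?C = sum c (set ?C) + sum c (set (select both en (set ?C) (follower I)))"
    using leader_list_complete[OF leader_list_backbone Z(1)] select_follower
    by (simp add: obj_def cost_eq_sum leader_list_def)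
  moreover have "cost (List.union Z backbone) = sum c (set (List.union Z backbone))"
    using leader_listD[OF leader_list_union[OF leader_list_backbone Z(1)]] by (intro cost_eq_sum)
  \<comment> \<open>\<open>Z\<close> and the backbone cost at most \<open>sum c H\<close> each and
    the response at most that to \<open>H\<close>; nonnegativity lets the bound count the response
    twice.\<close>
  moreover have "0 \<le> sum c (response I H)"
    unfolding response_eq[OF H] using select_follower(2) follower_E c_nonneg
    by (intro sum_nonneg) blast
  ultimately show ?thesis using Z by (simp add: objective_eq[OF H])
qed

lemma fn_main:
  "\<exists>R. solution R \<and> (\<forall>H. feasible I H \<longrightarrow> obj R \<le> 2 * objective I H) \<and>
    fn 0 [enc_inst] (enc_edge_names R) (fpt (2 * length (follower I) + 1) * B^12)"
proof -
  let ?T = "terminals (follower I)"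
  have T: "length ?T \<le> 2 * length (follower I)" "set ?T \<subseteq> V"
    using ends_V follower_E by (auto simp: length_terminals set_terminals)
  have nil: "leader_list []" by (simp add: leader_list_def)
  note l = leader_list_backbone nil leader_list_complete[OF leader_list_backbone nil]
  have "search_result backbone ?T [] (complete backbone []) (fpt (2 * length (follower I) + 1) * B^11)"
    using search_spec[OF leader_list_backbone solution_complete, of "2 * length (follower I)"]
      T nil solution_complete[OF nil] unfolding search_spec_def by simp
  then obtain R where R: "solution R"
    "\<And>H. H \<subseteq> leader I \<Longrightarrow> good backbone (set ?T) [] H R"
    and fn_R: "fn 28 [enc_inst, enc_edges backbone, enc_nats ?T, enc_edges [],
      enc_edges (complete backbone [])] (enc_edges R) (fpt (2 * length (follower I) + 1) * B^11)"
    unfolding search_result_def by blast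
  have lenF: "length (follower I) < B" by (rule length_edges[OF distinct_follower follower_E])
  have lR: "leader_list R" using R by (simp add: solution_def)
  obtain l' where l': "labelling l' (set (follower I))"
    and fn_F: "fn 5 [enc_tab enc_nat, enc_edges (follower I)] (enc_tab (\<lambda>v. enc_nat (l' v))) (B^5)"
    using fn_joins[OF labelling_empty follower_E distinct_follower] by auto
  note fn = fn_F fn_identity fn_sort[OF llist_E distinct_llist]
    fn_select[OF l' sorted_leader(3,2), folded backbone_def]
    fn_mono[OF fn_names pow_bounds(1)[OF length_edges[OF leader_listD(1,3)[OF lR]]]]
    fn_mono[OF fn_terminals pow_bounds(1)[OF lenF]]
    fn_R[unfolded list.map enc_list.simps]
    fn_complete[OF l(1,2), unfolded list.map enc_list.simps]
  define M where "M = fpt (2 * length (follower I) + 1) * B^11"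
  have "1 * B^11 \<le> M" unfolding M_def
    using fpt_pos[of "2 * length (follower I) + 1"] by (intro mult_le_mono1) linarith
  moreover have "1000 * M \<le> fpt (2 * length (follower I) + 1) * B^12"
    unfolding M_def mult.left_commute[of 1000] by (intro mult_le_mono2 B_pows)
  moreover have "1000 \<le> B" using B_W by simp
  ultimately have bounds: "1 * B^11 \<le> M" "1000 * M \<le> fpt (2 * length (follower I) + 1) * B^12"
    "1000 \<le> B" by auto
  note bounds = bounds B_pows(2-)
  have "fn 0 [enc_inst] (enc_edge_names R) (fpt (2 * length (follower I) + 1) * B^12)"
    by (rule fn_intro, simp,
        (rule step fn[folded M_def] | (simp; fail))+,
        use bounds in linarith)
  moreover have "obj R \<le> 2 * objective I H" if "feasible I H" for H
    using good_approx[OF that R(2)] feasibleD(1)[OF that] by blast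
  ultimately show ?thesis using R(1) by blast
qed

lemma two_approximation:
  "\<exists>xs t. runs w bmst_program (enc_instance I) (enc_edge_names xs) t \<and>
    t \<le> fpt (2 * card (set (follower I)) + 1) * B^12 \<and>
    feasible I (set xs) \<and> objective I (set xs) \<le> 2 * opt_value I"
proof -
  obtain R where R: "solution R" "\<And>H. feasible I H \<Longrightarrow> obj R \<le> 2 * objective I H"
    and fn: "fn 0 [enc_inst] (enc_edge_names R) (fpt (2 * length (follower I) + 1) * B^12)"
    using fn_main by blast
  then obtain t where "runs w bmst_program (enc_instance I) (enc_edge_names R) t"
    "t \<le> fpt (2 * length (follower I) + 1) * B^12"
    by (auto simp: fn_def evb_def runs_def)
  moreover have "length (follower I) = card (set (follower I))"
    using distinct_follower by (simp add: distinct_card)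
  moreover have feas: "feasible I (set R)" using R by (simp add: solution_def)
  moreover have "objective I (set R) \<le> 2 * opt_value I"
  proof -
    have "{X. feasible I X} \<subseteq> Pow (leader I)" using feasibleD(1) by blast
    then have "finite {X. feasible I X}" using finite_leader finite_subset by blast
    then have "opt_value I \<in> objective I ` {X. feasible I X}"
      unfolding opt_value_def using feas by (intro Min_in) auto
    then obtain H where "feasible I H" "opt_value I = objective I H" by auto
    then show ?thesis using R objective_solution by metis
  qed
  ultimately show ?thesis by metis
qed

end

section \<open>Lengths of numbers\<close>

text \<open>Bounding numerator plus denominator makes the estimate multiplicative under addition:
  \<open>a / b + a' / b' = (a b' + a' b) / (b b')\<close> and \<open>a b' + a' b + b b' \<le> (a + b) (a' + b')\<close>.\<close>

definition frac_bound :: "real \<Rightarrow> nat \<Rightarrow> bool" where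
  "frac_bound x n \<longleftrightarrow>
    (\<exists>a b :: int. 0 \<le> a \<and> 0 < b \<and> x = real_of_int a / real_of_int b \<and> a + b \<le> 2 ^ n)"

lemma rat_cases:
  assumes "x \<in> \<rat>"
  obtains a b where "bit_length x = 1 + nat (bitlen \<bar>a\<bar>) + nat (bitlen b)" "0 < b" "coprime a b"
    "x = real_of_int a / real_of_int b"
proof -
  from assms obtain q where q: "x = of_rat q" by (auto simp: Rats_def)
  obtain a b where ab: "quotient_of q = (a, b)" by force
  have "inj (of_rat :: rat \<Rightarrow> real)" by (auto intro: injI)
  then have "the_inv of_rat x = q" by (simp add: q the_inv_f_f)
  then have "bit_length x = 1 + nat (bitlen \<bar>a\<bar>) + nat (bitlen b)"
    by (simp add: bit_length_def ab)
  moreover have "x = real_of_int a / real_of_int b"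
    using quotient_of_div[OF ab] by (simp add: q of_rat_divide)
  ultimately show thesis
    using that quotient_of_denom_pos[OF ab] quotient_of_coprime[OF ab] by blast
qed

lemma less_power_bitlen: "0 \<le> a \<Longrightarrow> a < 2 ^ nat (bitlen a)"
  using bitlen_bounds[of a] by (cases "a = 0") auto

text \<open>With \<open>m\<close> and \<open>n\<close> bits,
  \<open>a + b \<le> 2 ^ m + 2 ^ n \<le> 2 ^ (m + n + 1)\<close>; the extra one is the constant in
  \<open>bit_length\<close>.\<close>

lemma frac_bound_bit_length:
  assumes "x \<in> \<rat>" "0 \<le> x"
  shows "frac_bound x (bit_length x)"
proof -
  obtain a b where l: "bit_length x = 1 + nat (bitlen \<bar>a\<bar>) + nat (bitlen b)" and b: "0 < b"
    and x: "x = real_of_int a / real_of_int b"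
    using rat_cases[OF assms(1)] by metis
  have a: "0 \<le> a" using assms(2) x b by (auto simp: zero_le_divide_iff)
  let ?m = "nat (bitlen a)" and ?n = "nat (bitlen b)"
  have "a + b \<le> 2 ^ ?m + 2 ^ ?n"
    using less_power_bitlen[OF a] less_power_bitlen[of b] b by linarith
  also have "\<dots> \<le> 2 ^ (?m + ?n) + 2 ^ (?m + ?n)"
    by (intro add_mono power_increasing) auto
  finally show ?thesis
    unfolding frac_bound_def using a b x l by (intro exI[of _ a] exI[of _ b]) simp
qed

lemma frac_bound_add:
  assumes "frac_bound x m" "frac_bound y n"
  shows "frac_bound (x + y) (m + n)"
proof -
  obtain a b a' b' :: int where a: "0 \<le> a" "0 < b" "x = real_of_int a / real_of_int b" "a + b \<le> 2 ^ m"
    and a': "0 \<le> a'" "0 < b'" "y = real_of_int a' / real_of_int b'" "a' + b' \<le> 2 ^ n"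
    using assms unfolding frac_bound_def by blast
  have "x + y = real_of_int (a * b' + a' * b) / real_of_int (b * b')"
    using a a' by (simp add: field_simps)
  moreover have "a * b' + a' * b + b * b' \<le> (a + b) * (a' + b')"
    using a a' by (simp add: algebra_simps)
  moreover have "(a + b) * (a' + b') \<le> 2 ^ m * 2 ^ n" using a a' by (intro mult_mono) auto
  ultimately show ?thesis
    unfolding frac_bound_def power_add using a a'
    by (intro exI[of _ "a * b' + a' * b"] exI[of _ "b * b'"]) auto
qed

text \<open>Reducing a fraction only shrinks numerator and denominator, so each has at most
  \<open>n + 1\<close> bits, and \<open>2 * n + 3 = 1 + 2 * (n + 1)\<close>.\<close>

lemma bit_length_frac_bound:
  assumes "frac_bound x n"
  shows "bit_length x \<le> 2 * n + 3"
proof -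
  obtain a b :: int where a: "0 \<le> a" "0 < b" "x = real_of_int a / real_of_int b" "a + b \<le> 2 ^ n"
    using assms unfolding frac_bound_def by blast
  have "x \<in> \<rat>" using a by simp
  then obtain p q where l: "bit_length x = 1 + nat (bitlen \<bar>p\<bar>) + nat (bitlen q)" and q: "0 < q"
    and cop: "coprime p q" and x: "x = real_of_int p / real_of_int q"
    using rat_cases by metis
  have "real_of_int (a * q) = real_of_int (p * b)" using a x q by (simp add: field_simps)
  then have eq: "a * q = p * b" by linarith
  have "q dvd p * b" using eq by (metis dvd_triv_right)
  then have "q dvd b" using cop by (simp add: coprime_commute coprime_dvd_mult_right_iff)
  then have "q \<le> b" using a by (simp add: zdvd_imp_le)
  have "p dvd a * q" using eq by simp
  then have pa: "p dvd a" using cop by (simp add: coprime_dvd_mult_left_iff)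
  have "\<bar>p\<bar> \<le> a"
  proof (cases "a = 0")
    case True
    then show ?thesis using eq a by simp
  next
    case False
    then show ?thesis using dvd_imp_le_int[OF _ pa] a by simp
  qed
  have le: "nat (bitlen y) \<le> n + 1" if "y \<le> 2 ^ n" for y :: int
  proof -
    have "(2 :: int) ^ n < 2 ^ (n + 1)" by simp
    then have "y < 2 ^ (n + 1)" using that by linarith
    then have "bitlen y \<le> int (n + 1)" unfolding bitlen_le_iff_power nat_int by simp
    then show ?thesis by linarith
  qed
  have "nat (bitlen \<bar>p\<bar>) \<le> n + 1" "nat (bitlen q) \<le> n + 1"
    using \<open>\<bar>p\<bar> \<le> a\<close> \<open>q \<le> b\<close> a(1,2,4) by (intro le; linarith)+
  then show ?thesis using l by simp
qed

lemma bit_length_sum_list: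
  assumes "\<And>x. x \<in> set xs \<Longrightarrow> x \<in> \<rat> \<and> 0 \<le> x"
  shows "bit_length (sum_list xs) \<le> 2 * sum_list (map bit_length xs) + 3"
proof (rule bit_length_frac_bound)
  show "frac_bound (sum_list xs) (sum_list (map bit_length xs))"
    using assms
  proof (induction xs)
    case Nil
    have "frac_bound 0 0" unfolding frac_bound_def by (intro exI[of _ 0] exI[of _ 1]) simp
    then show ?case by simp
  next
    case (Cons x xs)
    then show ?case by (auto intro!: frac_bound_add frac_bound_bit_length)
  qed
qed

section \<open>Size of an instance\<close>

lemma length_le_val_size: "length vs \<le> val_size w (enc_list vs)"
  by (induction vs) auto

lemma val_size_member: "v \<in> set vs \<Longrightarrow> val_size w v \<le> val_size w (enc_list vs)"
  by (induction vs) auto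

lemma sum_le_val_size:
  "(\<And>x. x \<in> set xs \<Longrightarrow> g x \<le> val_size w (h x)) \<Longrightarrow>
    sum_list (map g xs) \<le> val_size w (enc_list (map h xs))"
  by (induction xs) (auto intro: add_mono le_SucI)

lemma val_size_enc_edge: "w (real e) + w (ccost I e) \<le> val_size w (enc_edge I e)"
  by (simp add: enc_edge_def)

lemma val_size_enc_instance:
  "val_size w (enc_list (map enc_nat (sorted_list_of_set (verts I)))) +
   val_size w (enc_list (map (enc_edge I) (sorted_list_of_set (leader I)))) +
   val_size w (enc_list (map (enc_edge I) (follower I))) \<le> val_size w (enc_instance I)"
  by (simp add: enc_instance_def)

lemma instance_size:
  fixes w :: "real \<Rightarrow> nat"
  assumes "bmst_instance I"
  defines "N \<equiv> val_size w (enc_instance I)"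
  shows "card (verts I) \<le> N" "card (edges I) \<le> N"
    and "v \<in> verts I \<Longrightarrow> w (real v) \<le> N" "e \<in> edges I \<Longrightarrow> w (real e) \<le> N"
    and "(\<Sum>e\<in>edges I. w (ccost I e)) \<le> N"
proof -
  let ?V = "enc_list (map enc_nat (sorted_list_of_set (verts I)))"
    and ?L = "enc_list (map (enc_edge I) (sorted_list_of_set (leader I)))"
    and ?F = "enc_list (map (enc_edge I) (follower I))"
  have fin: "finite (verts I)" "finite (leader I)" and dF: "distinct (follower I)"
    and disj: "leader I \<inter> set (follower I) = {}"
    using assms(1) by (auto simp: bmst_instance_def)
  have N: "val_size w ?V + val_size w ?L + val_size w ?F \<le> N"
    unfolding N_def by (rule val_size_enc_instance)
  have "card (verts I) \<le> val_size w ?V"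
    using length_le_val_size[of "map enc_nat (sorted_list_of_set (verts I))" w] by simp
  then show "card (verts I) \<le> N" using N by linarith
  have "card (leader I) \<le> val_size w ?L"
    using length_le_val_size[of "map (enc_edge I) (sorted_list_of_set (leader I))" w] by simp
  moreover have "card (set (follower I)) \<le> val_size w ?F"
    using length_le_val_size[of "map (enc_edge I) (follower I)" w] dF by (simp add: distinct_card)
  moreover have "card (edges I) = card (leader I) + card (set (follower I))"
    unfolding edges_def using fin disj by (intro card_Un_disjoint) auto
  ultimately show "card (edges I) \<le> N" using N by linarith
  show "w (real v) \<le> N" if "v \<in> verts I"
  proof -
    have "val_size w (enc_nat v) \<le> val_size w ?V"
      using that fin by (intro val_size_member) auto
    then show ?thesis using N by simp
  qed
  show "w (real e) \<le> N" if "e \<in> edges I"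
  proof -
    have "val_size w (enc_edge I e) \<le> val_size w ?L \<or> val_size w (enc_edge I e) \<le> val_size w ?F"
      using that fin by (auto simp: edges_def intro: val_size_member)
    then show ?thesis using N val_size_enc_edge[of w e I] by linarith
  qed
  have edge: "w (ccost I e) \<le> val_size w (enc_edge I e)" for e
    using val_size_enc_edge[of w e I] by simp
  have "(\<Sum>e\<in>leader I. w (ccost I e)) \<le> val_size w ?L"
    using sum_le_val_size[of "sorted_list_of_set (leader I)" "\<lambda>e. w (ccost I e)", OF edge] fin
    by (simp add: sum_list_distinct_conv_sum_set)
  moreover have "(\<Sum>e\<in>set (follower I). w (ccost I e)) \<le> val_size w ?F"
    using sum_le_val_size[of "follower I" "\<lambda>e. w (ccost I e)", OF edge] dF
    by (simp add: sum_list_distinct_conv_sum_set)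
  moreover have "(\<Sum>e\<in>edges I. w (ccost I e)) =
      (\<Sum>e\<in>leader I. w (ccost I e)) + (\<Sum>e\<in>set (follower I). w (ccost I e))"
    unfolding edges_def using fin disj by (intro sum.union_disjoint) auto
  ultimately show "(\<Sum>e\<in>edges I. w (ccost I e)) \<le> N" using N by linarith
qed

text \<open>Each edge enters the sum at most once, and its cost is part of the encoded instance;
  this is what summing duplicate-free lists buys.\<close>

lemma admissible_total:
  assumes inst: "bmst_instance I" and adm: "admissible w I"
    and es: "distinct es" "set es \<subseteq> edges I"
  shows "w (sum_list (map (ccost I) es)) \<le> 2 * val_size w (enc_instance I) + 3"
  using adm unfolding admissible_def
proof (elim disjE conjE)
  assume "w = unit_length"
  then show ?thesis by (simp add: unit_length_def)
next
  assume w: "w = bit_length" and rat: "rational_costs I"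
  have "finite (edges I)" using inst by (simp add: bmst_instance_def edges_def)
  then have "(\<Sum>e\<in>set es. w (ccost I e)) \<le> (\<Sum>e\<in>edges I. w (ccost I e))"
    using es by (intro sum_mono2) auto
  also have "\<dots> \<le> val_size w (enc_instance I)" by (rule instance_size[OF inst])
  finally have "sum_list (map (\<lambda>e. w (ccost I e)) es) \<le> val_size w (enc_instance I)"
    using es by (simp add: sum_list_distinct_conv_sum_set)
  moreover have "bit_length (sum_list (map (ccost I) es))
      \<le> 2 * sum_list (map bit_length (map (ccost I) es)) + 3"
    using inst rat es by (intro bit_length_sum_list) (auto simp: bmst_instance_def rational_costs_def)
  ultimately show ?thesis by (simp add: w comp_def)
qed

section \<open>Computability of the parameter dependence\<close>

lemma computable_fpt: "computable (\<lambda>n. fpt (2 * n + 1))"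
proof -
  \<comment> \<open>\<open>?pow\<close> doubles its result for \<open>n - 1\<close>;
    \<open>?main\<close> applies it twice, starting from \<open>2 * n + 4\<close>, which is the
    inner exponent of \<open>fpt (2 * n + 1)\<close>.\<close>
  let ?pow = "Cond (Less (Var 0) (Lit 1)) (Lit 1)
     (Bind (Call 1 [Sub (Var 0) (Lit 1)]) (Add (Var 0) (Var 0)))"
  let ?main = "Call 1 [Call 1 [Add (Add (Var 0) (Var 0)) (Lit 4)]]"
  let ?P = "[?main, ?pow]"
  interpret interpreter unit_length ?P 2 .
  have small: "small x" for x by (simp add: small_def unit_length_def)
  have lit: "evb \<rho> (Lit n) (enc_nat n) 1" for \<rho> n
    unfolding evb_def using ev_Lit by blast
  \<comment> \<open>These variants of \<open>evb_Cond\<close> fix the branch in advance, so that the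
    recursive call is examined only where it is made.\<close>
  have true: "b \<Longrightarrow> evb \<rho> a (Num (of_bool b)) s \<Longrightarrow> evb \<rho> d v t \<Longrightarrow>
      evb \<rho> (Cond a d e) v (1 + s + t)" for \<rho> a b s d v t e
    using evb_Cond[of \<rho> a b s d v t e v t] by simp
  have false: "\<not> b \<Longrightarrow> evb \<rho> a (Num (of_bool b)) s \<Longrightarrow> evb \<rho> e v t \<Longrightarrow>
      evb \<rho> (Cond a d e) v (1 + s + t)" for \<rho> a b s d v t e
    using evb_Cond[of \<rho> a b s d v t e v t] by simp
  have pow: "\<exists>t. fn 1 [enc_nat n] (enc_nat (2 ^ n)) t" for n
  proof (induction n)
    case 0
    show ?case
      by (rule exI, rule fnI[where b = ?pow], simp, simp,
          rule true[of "real 0 < 1"], simp,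
          (rule evb_rules small)+,
          simp,
          rule order_refl)
  next
    case (Suc n)
    then obtain t where "fn 1 [enc_nat n] (enc_nat (2 ^ n)) t" by blast
    then have t: "fn 1 [Num (real (Suc n) - 1)] (enc_nat (2 ^ n)) t" by simp
    show ?case
      by (rule exI, rule fnI[where b = ?pow], simp, simp,
          rule false[of "real (Suc n) < 1"], simp,
          (rule evb_rules t small)+,
          simp,
          rule order_refl)
  qed
  have "\<exists>t. fn 0 [enc_nat n] (enc_nat (fpt (2 * n + 1))) t" for n
  proof -
    obtain s where "fn 1 [enc_nat (n + n + 4)] (enc_nat (2 ^ (n + n + 4))) s" using pow by blast
    then have s: "fn 1 [Num (real n + real n + real 4)] (enc_nat (2 ^ (n + n + 4))) s" by simp
    obtain t where t: "fn 1 [enc_nat (2 ^ (n + n + 4))] (enc_nat (2 ^ 2 ^ (n + n + 4))) t"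
      using pow by blast
    have "2 * n + 1 + 3 = n + n + 4" by simp
    then have eq: "fpt (2 * n + 1) = 2 ^ 2 ^ (n + n + 4)" by (simp only: fpt_def)
    show ?thesis
      by (rule exI, rule fnI[where b = ?main], simp, simp,
          (rule evb_Call evb_rules s t small lit)+,
          simp only: eq,
          rule order_refl)
  qed
  then have "\<exists>t. runs unit_length ?P (enc_nat n) (enc_nat (fpt (2 * n + 1))) t" for n
    unfolding runs_def fn_def evb_def by blast
  then show ?thesis unfolding computable_def by blast
qed

theorem theorem7:
  "\<exists>(P :: prog) (f :: nat \<Rightarrow> nat) (p :: nat poly).
     computable f \<and>
     (\<forall>I w. bmst_instance I \<and> admissible w I \<longrightarrow>
        (\<exists>xs t.
           runs w P (enc_instance I) (enc_edge_names xs) t \<and>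
           t \<le> f (card (set (follower I))) * poly p (val_size w (enc_instance I)) \<and>
           feasible I (set xs) \<and>
           objective I (set xs) \<le> 2 * opt_value I))"
proof (intro exI[of _ bmst_program] exI[of _ "\<lambda>n. fpt (2 * n + 1)"]
    exI[of _ "[:4000, 2000:] ^ 12"] conjI allI impI)
  show "computable (\<lambda>n. fpt (2 * n + 1))" by (rule computable_fpt)
  fix I w
  assume "bmst_instance I \<and> admissible w I"
  then have inst: "bmst_instance I" and adm: "admissible w I" by auto
  let ?N = "val_size w (enc_instance I)"
  \<comment> \<open>\<open>2 * ?N + 3\<close> is the bound of \<open>admissible_total\<close>, and
    \<open>4000 + 2000 * ?N\<close> is \<open>1000 * (W + 1)\<close> for this
    \<open>W\<close>.\<close>
  interpret bmst_run w "2 * ?N + 3" I "4000 + 2000 * ?N"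
  proof
    show "bmst_instance I" by (rule inst)
    show "w (real v) \<le> 2 * ?N + 3" if "v \<in> verts I" for v
      using instance_size(3)[OF inst that, of w] by simp
    show "w (real e) \<le> 2 * ?N + 3" if "e \<in> edges I" for e
      using instance_size(4)[OF inst that, of w] by simp
    show "w (sum_list (map (ccost I) es)) \<le> 2 * ?N + 3" if "distinct es" "set es \<subseteq> edges I" for es
      using that by (rule admissible_total[OF inst adm])
    show "card (verts I) < 4000 + 2000 * ?N" "card (edges I) < 4000 + 2000 * ?N"
      using instance_size(1,2)[OF inst, of w] by linarith+
  qed simp
  have "poly ([:4000, 2000:] ^ 12) ?N = (4000 + 2000 * ?N) ^ 12"
    by (simp add: poly_power mult.commute)
  with two_approximation show "\<exists>xs t.
       runs w bmst_program (enc_instance I) (enc_edge_names xs) t \<and>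
       t \<le> fpt (2 * card (set (follower I)) + 1) * poly ([:4000, 2000:] ^ 12) ?N \<and>
       feasible I (set xs) \<and> objective I (set xs) \<le> 2 * opt_value I"
    by metis
qed

end
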